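(* Let $K\in\mathrm{InSy}(\infty)$ and let $U=(U_i)_{i\in\mathbb{N}}$ be an i.i.d. sequence of uniform random variables on $[0,1]$. Then the process $$\Bigg(\Big\{\big\{j\in[n]:x<U_j<y\big\}:(x,y)\in K\Big\}\cup\Big\{\{j\}:j\in[n]\Big\}\cup\{\emptyset\}\Bigg)_{n\in\mathbb{N}}$$ is an ergodic exchangeable interval hypergraph on $\mathbb{N}$, and the law of every ergodic exchangeable interval hypergraph on $\mathbb{N}$ can be expressed in this form. Denote the law of this process by $\mathrm{Law}^{\mathrm{ih}}(K)$. The map $\mathrm{InSy}(\infty)\to\mathrm{erg}(\mathtt{ExInHy})$, $K\mapsto\mathrm{Law}^{\mathrm{ih}}(K)$, is surjective and continuous.
   Context: $\mathrm{InSy}(\infty)$ is the set of compact $K\subseteq\{(x,y)\in\mathbb{R}^2:0\le x\le y\le1\}$ with $(x,x)\in K$ for all $x\in[0,1]$, equipped with the Hausdorff distance induced by the $\ell^1$-metric on $\mathbb{R}^2$. An interval hypergraph on $[n]=\{1,\dots,n\}$ is a set $\mathtt{H}$ of subsets of $[n]$ containing $\emptyset$ and all singletons $\{j\}$, $j\in[n]$, such that for some linear order $l$ on $[n]$ every $e\in\mathtt{H}$ is an interval with respect to $l$. $\mathrm{InHy}(n)$ is the finite set of these. For $k\le n$ let $\mathtt{H}_{|k}:=\{[k]\cap e:e\in\mathtt{H}\}$, and for a permutation $\pi$ of $[n]$ let $\pi(\mathtt{H}):=\{\pi(e):e\in\mathtt{H}\}$. An exchangeable interval hypergraph on $\mathbb{N}$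 is a process $(H_n)_{n\in\mathbb{N}}$ with $H_n\in\mathrm{InHy}(n)$, $H_n=(H_{n+1})_{|n}$ a.s., and $\pi(H_n)\overset{d}{=}H_n$ for all $n$ and all permutations $\pi$ of $[n]$. $\mathtt{ExInHy}$ is the set of laws of such processes. Let $\mathrm{InHy}(\mathbb{N}):=\{(\mathtt{H}_n)_n:\mathtt{H}_n\in\mathrm{InHy}(n),\ \mathtt{H}_n=(\mathtt{H}_{n+1})_{|n}\text{ for all }n\}$, a compact subset of $\prod_n\mathrm{InHy}(n)$ (each factor discrete); $\mathtt{ExInHy}$ is viewed as a set of Borel probability measures on $\mathrm{InHy}(\mathbb{N})$ with the topology of weak convergence. The group $\mathbb{S}_\infty$ of finitely supported bijections of $\mathbb{N}$ acts on $\mathrm{InHy}(\mathbb{N})$: if $m$ is such that $\pi(i)=i$ for all $i\ge m$, then $\pi((\mathtt{H}_n)_n)=(\mathtt{H}'_n)_n$ with $\mathtt{H}'_n=\{\pi(e):e\in\mathtt{H}_n\}$ for $n\ge m$ and $\mathtt{H}'_n=(\mathtt{H}'_m)_{|n}$ for $n<m$. $\mathtt{ExInHy}$ is exactly the set of $\mathbb{S}_\infty$-invariant Borel probability measures; $P\in\mathtt{ExInHy}$ is called ergodic if $P(E)\in\{0,1\}$ for every $\mathbb{S}_\infty$-invariant event $E\subseteq\mathrm{InHy}(\mathbb{N})$. $\mathrm{erg}(\mathtt{ExInHy})$ is the set of ergodic $P\in\mathtt{ExInHy}$, and an exchangeable interval hypergraph is called ergodic if its law is. *)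

theory Defs
  imports "HOL-Probability.Probability"
begin

text \<open>The natural numbers of the source start at 1: sequences indexed by them are functions on
  \<open>nat\<close> that are relevant on \<open>{1..}\<close> only, and \<open>{1..n}\<close> is the set of the first \<open>n\<close> numbers.\<close>

section \<open>Compact sets above the diagonal\<close>

definition l1_dist :: "real \<times> real \<Rightarrow> real \<times> real \<Rightarrow> real" where
  "l1_dist p q = \<bar>fst p - fst q\<bar> + \<bar>snd p - snd q\<bar>"

definition InSy :: "(real \<times> real) set set" where
  "InSy = {K. compact K \<and> K \<subseteq> {(x, y). 0 \<le> x \<and> x \<le> y \<and> y \<le> 1} \<and> (\<forall>x\<in>{0..1}. (x, x) \<in> K)}"

text \<open>The value for arguments that are not compact and non-empty is irrelevant; it is 0 only because
  the locale \<open>Metric_space\<close> wants a distance that is non-negative on the whole type.\<close>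

definition hausdorff_l1 :: "(real \<times> real) set \<Rightarrow> (real \<times> real) set \<Rightarrow> real" where
  "hausdorff_l1 A B =
     (if compact A \<and> A \<noteq> {} \<and> compact B \<and> B \<noteq> {}
      then max (SUP a\<in>A. INF b\<in>B. l1_dist a b) (SUP b\<in>B. INF a\<in>A. l1_dist a b) else 0)"

lemma l1_dist_commute: "l1_dist p q = l1_dist q p"
  by (simp add: l1_dist_def abs_minus_commute)

lemma continuous_on_l1_dist [continuous_intros]:
  "continuous_on S f \<Longrightarrow> continuous_on S g \<Longrightarrow> continuous_on S (\<lambda>x. l1_dist (f x) (g x))"
  unfolding l1_dist_def by (intro continuous_intros)

lemma SUP_INF_l1_le_iff:
  assumes "compact A" "A \<noteq> {}" "compact B" "B \<noteq> {}"
  shows "(SUP a\<in>A. INF b\<in>B. l1_dist a b) \<le> r \<longleftrightarrow> (\<forall>a\<in>A. \<exists>b\<in>B. l1_dist a b \<le> r)"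
proof -
  have bdd: "bdd_below (l1_dist a ` B)" for a
    by (auto simp: l1_dist_def intro!: bdd_belowI[of _ 0])
  have att: "(INF b\<in>B. l1_dist a b) \<le> r \<longleftrightarrow> (\<exists>b\<in>B. l1_dist a b \<le> r)" for a r
  proof
    have "continuous_on B (l1_dist a)" by (intro continuous_intros)
    then obtain b where b: "b \<in> B" "\<forall>y\<in>B. l1_dist a b \<le> l1_dist a y"
      using continuous_attains_inf[OF assms(3,4)] by metis
    have "l1_dist a b \<le> (INF b\<in>B. l1_dist a b)"
      by (rule cINF_greatest) (use b in auto)
    then show "\<exists>b\<in>B. l1_dist a b \<le> r" if "(INF b\<in>B. l1_dist a b) \<le> r"
      using that b(1) order_trans by blast
  next
    assume "\<exists>b\<in>B. l1_dist a b \<le> r"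
    then obtain b where "b \<in> B" "l1_dist a b \<le> r" by blast
    then show "(INF b\<in>B. l1_dist a b) \<le> r" by (rule cINF_lower2[OF bdd])
  qed
  obtain b0 where b0: "b0 \<in> B" using assms by auto
  have "compact ((\<lambda>a. l1_dist a b0) ` A)"
    by (intro compact_continuous_image continuous_intros assms)
  then have "bdd_above ((\<lambda>a. l1_dist a b0) ` A)"
    by (intro bounded_imp_bdd_above compact_imp_bounded)
  then obtain C where C: "\<And>a. a \<in> A \<Longrightarrow> l1_dist a b0 \<le> C"
    unfolding bdd_above_def by blast
  have "bdd_above ((\<lambda>a. INF b\<in>B. l1_dist a b) ` A)"
    using C att b0 by (intro bdd_aboveI2[where M = C]) blast
  then show ?thesis
    using att assms(2) by (simp add: cSUP_le_iff)
qed

lemma hausdorff_l1_le_iff: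
  assumes "compact A" "A \<noteq> {}" "compact B" "B \<noteq> {}"
  shows "hausdorff_l1 A B \<le> r \<longleftrightarrow>
    (\<forall>a\<in>A. \<exists>b\<in>B. l1_dist a b \<le> r) \<and> (\<forall>b\<in>B. \<exists>a\<in>A. l1_dist a b \<le> r)"
  using SUP_INF_l1_le_iff[of A B] SUP_INF_l1_le_iff[of B A] assms
  by (simp add: hausdorff_l1_def l1_dist_commute)

lemma InSy_D: "K \<in> InSy \<Longrightarrow> compact K" "K \<in> InSy \<Longrightarrow> K \<noteq> {}"
proof -
  assume K: "K \<in> InSy"
  show "compact K" using K by (simp add: InSy_def)
  have "(0, 0) \<in> K" using K by (auto simp: InSy_def)
  then show "K \<noteq> {}" by blast
qed

lemma Metric_space_InSy: "Metric_space InSy hausdorff_l1"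
proof
  show nonneg: "0 \<le> hausdorff_l1 A B" for A B
  proof (cases "compact A \<and> A \<noteq> {} \<and> compact B \<and> B \<noteq> {}")
    case True
    then obtain a where "a \<in> A" by blast
    with hausdorff_l1_le_iff[of A B "hausdorff_l1 A B"] True
    obtain b where "l1_dist a b \<le> hausdorff_l1 A B" by blast
    then show ?thesis by (simp add: l1_dist_def)
  next
    case False
    then show ?thesis unfolding hausdorff_l1_def by (simp only: if_False)
  qed
  show "hausdorff_l1 A B = hausdorff_l1 B A" for A B
    by (simp add: hausdorff_l1_def l1_dist_commute max.commute conj_ac)
  show "hausdorff_l1 A B = 0 \<longleftrightarrow> A = B" if "A \<in> InSy" "B \<in> InSy" for A B
  proof -
    note ne = InSy_D[OF that(1)] InSy_D[OF that(2)]
    have eq: "l1_dist a b \<le> 0 \<longleftrightarrow> a = b" for a b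
      by (auto simp: l1_dist_def prod_eq_iff)
    have "hausdorff_l1 A B \<le> 0 \<longleftrightarrow> A = B"
      unfolding hausdorff_l1_le_iff[OF ne] eq by blast
    then show ?thesis using nonneg[of A B] by linarith
  qed
  show "hausdorff_l1 A C \<le> hausdorff_l1 A B + hausdorff_l1 B C"
    if "A \<in> InSy" "B \<in> InSy" "C \<in> InSy" for A B C
  proof -
    note A = InSy_D[OF that(1)] and B = InSy_D[OF that(2)] and C = InSy_D[OF that(3)]
    have tri: "l1_dist a c \<le> l1_dist a b + l1_dist b c" for a b c
      by (simp add: l1_dist_def)
    have AB: "\<forall>a\<in>A. \<exists>b\<in>B. l1_dist a b \<le> hausdorff_l1 A B" "\<forall>b\<in>B. \<exists>a\<in>A. l1_dist a b \<le> hausdorff_l1 A B"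
      using hausdorff_l1_le_iff[of A B "hausdorff_l1 A B", OF A B] by auto
    have BC: "\<forall>b\<in>B. \<exists>c\<in>C. l1_dist b c \<le> hausdorff_l1 B C" "\<forall>c\<in>C. \<exists>b\<in>B. l1_dist b c \<le> hausdorff_l1 B C"
      using hausdorff_l1_le_iff[of B C "hausdorff_l1 B C", OF B C] by auto
    have "\<exists>c\<in>C. l1_dist a c \<le> hausdorff_l1 A B + hausdorff_l1 B C" if "a \<in> A" for a
    proof -
      obtain b where b: "b \<in> B" "l1_dist a b \<le> hausdorff_l1 A B" using AB(1) \<open>a \<in> A\<close> by auto
      obtain c where "c \<in> C" "l1_dist b c \<le> hausdorff_l1 B C" using BC(1) b(1) by auto
      then show ?thesis using b(2) tri[of a c b] by (intro bexI[of _ c]) auto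
    qed
    moreover have "\<exists>a\<in>A. l1_dist a c \<le> hausdorff_l1 A B + hausdorff_l1 B C" if "c \<in> C" for c
    proof -
      obtain b where b: "b \<in> B" "l1_dist b c \<le> hausdorff_l1 B C" using BC(2) \<open>c \<in> C\<close> by auto
      obtain a where "a \<in> A" "l1_dist a b \<le> hausdorff_l1 A B" using AB(2) b(1) by auto
      then show ?thesis using b(2) tri[of a c b] by (intro bexI[of _ a]) auto
    qed
    ultimately show ?thesis by (simp add: hausdorff_l1_le_iff[OF A C])
  qed
qed

definition InSy_topology :: "(real \<times> real) set topology" where
  "InSy_topology = Metric_space.mtopology InSy hausdorff_l1"

section \<open>Interval hypergraphs\<close>

definition interval_wrt :: "nat \<Rightarrow> nat rel \<Rightarrow> nat set \<Rightarrow> bool" where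
  "interval_wrt n l e \<longleftrightarrow> e \<subseteq> {1..n} \<and>
     (\<forall>a\<in>e. \<forall>b\<in>e. \<forall>c\<in>{1..n}. (a, c) \<in> l \<and> (c, b) \<in> l \<longrightarrow> c \<in> e)"

definition InHy :: "nat \<Rightarrow> nat set set set" where
  "InHy n = {H. H \<subseteq> Pow {1..n} \<and> {} \<in> H \<and> (\<forall>j\<in>{1..n}. {j} \<in> H) \<and>
     (\<exists>l. linear_order_on {1..n} l \<and> (\<forall>e\<in>H. interval_wrt n l e))}"

definition restrict_hy :: "nat \<Rightarrow> nat set set \<Rightarrow> nat set set" where
  "restrict_hy k H = {{1..k} \<inter> e | e. e \<in> H}"

definition relabel_hy :: "(nat \<Rightarrow> nat) \<Rightarrow> nat set set \<Rightarrow> nat set set" where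
  "relabel_hy \<pi> H = {\<pi> ` e | e. e \<in> H}"

definition InHy_prod_topology :: "(nat \<Rightarrow> nat set set) topology" where
  "InHy_prod_topology = product_topology (\<lambda>n. discrete_topology (InHy n)) {1..}"

definition InHyN :: "(nat \<Rightarrow> nat set set) set" where
  "InHyN = {h \<in> (\<Pi>\<^sub>E n\<in>{1..}. InHy n). \<forall>n\<in>{1..}. h n = restrict_hy n (h (Suc n))}"

definition InHyN_topology :: "(nat \<Rightarrow> nat set set) topology" where
  "InHyN_topology = subtopology InHy_prod_topology InHyN"

section \<open>Borel measures and weak convergence on an abstract topological space\<close>

definition borel_of :: "'a topology \<Rightarrow> 'a measure" where
  "borel_of X = sigma (topspace X) {S. openin X S}"

definition borel_prob_measures :: "'a topology \<Rightarrow> 'a measure set" where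
  "borel_prob_measures X = {P. prob_space P \<and> sets P = sets (borel_of X)}"

text \<open>The coarsest topology that makes integration of every bounded continuous function continuous.\<close>

definition weak_topology :: "'a topology \<Rightarrow> 'a measure topology" where
  "weak_topology X = topology_generated_by
     {{P \<in> borel_prob_measures X. integral\<^sup>L P f \<in> V} | f V.
        continuous_map X euclideanreal f \<and> bounded (f ` topspace X) \<and> open V}"

section \<open>Exchangeable interval hypergraphs\<close>

definition exch_int_hypergraph :: "'a measure \<Rightarrow> (nat \<Rightarrow> 'a \<Rightarrow> nat set set) \<Rightarrow> bool" where
  "exch_int_hypergraph M H \<longleftrightarrow>
     prob_space M \<and>
     (\<forall>n\<in>{1..}. H n \<in> M \<rightarrow>\<^sub>M count_space (InHy n)) \<and>
     (\<forall>n\<in>{1..}. AE \<omega> in M. H n \<omega> = restrict_hy n (H (Suc n) \<omega>)) \<and>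
     (\<forall>n\<in>{1..}. \<forall>\<pi>. \<pi> permutes {1..n} \<longrightarrow>
        distr M (count_space (InHy n)) (\<lambda>\<omega>. relabel_hy \<pi> (H n \<omega>)) =
        distr M (count_space (InHy n)) (H n))"

text \<open>Paths are consistent only almost surely, so the distribution of a process lives on the product
  of the \<open>InHy n\<close>; since it gives full measure to the closed set \<open>InHyN\<close>, it is
  a Borel probability measure on \<open>InHyN\<close> after restriction.\<close>

definition hy_law :: "'a measure \<Rightarrow> (nat \<Rightarrow> 'a \<Rightarrow> nat set set) \<Rightarrow> (nat \<Rightarrow> nat set set) measure" where
  "hy_law M H = restrict_space
     (distr M (borel_of InHy_prod_topology) (\<lambda>\<omega>. \<lambda>n\<in>{1..}. H n \<omega>)) InHyN"

text \<open>A set cannot collect processes on probability spaces of all types. The type used here loses no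
  law, because the coordinate process under a given law lives on it.\<close>

definition ExInHy :: "(nat \<Rightarrow> nat set set) measure set" where
  "ExInHy = {hy_law M H | (M :: (nat \<Rightarrow> nat set set) measure) H. exch_int_hypergraph M H}"

definition S_infinity :: "(nat \<Rightarrow> nat) set" where
  "S_infinity = {\<pi>. \<pi> permutes {1..} \<and> finite {i. \<pi> i \<noteq> i}}"

text \<open>Any \<open>m\<close> such that \<open>\<pi>\<close> fixes all \<open>i \<ge> m\<close> gives the same action; the least one is taken.\<close>

definition S_infinity_act :: "(nat \<Rightarrow> nat) \<Rightarrow> (nat \<Rightarrow> nat set set) \<Rightarrow> (nat \<Rightarrow> nat set set)" where
  "S_infinity_act \<pi> h =
     (let m = (LEAST m. 1 \<le> m \<and> (\<forall>i\<ge>m. \<pi> i = i)) in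
      (\<lambda>n\<in>{1..}. if m \<le> n then relabel_hy \<pi> (h n) else restrict_hy n (relabel_hy \<pi> (h m))))"

definition erg_ExInHy :: "(nat \<Rightarrow> nat set set) measure set" where
  "erg_ExInHy = {P \<in> ExInHy. \<forall>E\<in>sets (borel_of InHyN_topology).
     (\<forall>\<pi>\<in>S_infinity. S_infinity_act \<pi> ` E = E) \<longrightarrow> measure P E \<in> {0, 1}}"

definition ergodic_exch_int_hypergraph :: "'a measure \<Rightarrow> (nat \<Rightarrow> 'a \<Rightarrow> nat set set) \<Rightarrow> bool" where
  "ergodic_exch_int_hypergraph M H \<longleftrightarrow> exch_int_hypergraph M H \<and> hy_law M H \<in> erg_ExInHy"

section \<open>Sampling from an interval system\<close>

definition iid_uniform :: "'a measure \<Rightarrow> (nat \<Rightarrow> 'a \<Rightarrow> real) \<Rightarrow> bool" where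
  "iid_uniform M U \<longleftrightarrow>
     prob_space M \<and>
     prob_space.indep_vars M (\<lambda>_. borel) U {1..} \<and>
     (\<forall>i\<in>{1..}. distr M borel (U i) = uniform_measure lborel {0..1})"

definition sample_hy :: "(real \<times> real) set \<Rightarrow> nat \<Rightarrow> (nat \<Rightarrow> real) \<Rightarrow> nat set set" where
  "sample_hy K n u =
     {{j \<in> {1..n}. x < u j \<and> u j < y} | x y. (x, y) \<in> K} \<union> {{j} | j. j \<in> {1..n}} \<union> {{}}"

definition Law_ih :: "(real \<times> real) set \<Rightarrow> (nat \<Rightarrow> nat set set) measure" where
  "Law_ih K = hy_law (\<Pi>\<^sub>M i\<in>{1..}. uniform_measure lborel {0..1}) (sample_hy K)"

end

theory Submission
  imports Defs "HOL-Real_Asymp.Real_Asymp"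
begin

text \<open>All constructions go through one operation: \<open>pull n \<iota> H\<close> is the hypergraph on \<open>[n]\<close> whose edges are
the preimages of the edges of \<open>H\<close> under \<open>\<iota>\<close>. Restriction, relabelling and the action of
\<open>S_infinity\<close> are pull-backs, and pulling back a sampled hypergraph along an injection amounts to
reindexing the sample points (\<open>pull_sample_hy\<close>). This gives consistency and exchangeability of the
sampled process.

\<^emph>\<open>Ergodicity.\<close> The hypergraph on \<open>[k]\<close> and the one on a block of indices beyond \<open>k\<close> use
different sample points. Hence every event becomes independent of a cylinder event that is shifted far away
(\<open>Law_ih_mixing\<close>). An invariant event does not notice the shift, so it is independent of
all cylinders, hence of itself (\<open>Law_ih_zero_one\<close>).

\<^emph>\<open>Continuity.\<close> A set of at least two indices is a sampled edge iff \<open>K\<close> meets one of finitely many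
boxes whose sides are given by the sample points. These boxes are neither open nor closed, but for a fixed
\<open>K\<close> it happens only with probability zero that \<open>K\<close> meets the closed box and misses the open one
(\<open>AE_hits_open\<close>): if the inequalities are made strict for one sample point after the other, each
step matters for finitely many values of that point only. Convergence of \<open>Ks k\<close> to \<open>K\<close> in the Hausdorff
distance implies convergence in the hit-or-miss sense: the open boxes that are hit stay hit
and the closed boxes that are missed stay missed. So the hypergraphs sampled from \<open>Ks k\<close> with the same points
agree with the one sampled from \<open>K\<close> eventually, almost surely (\<open>AE_sample_hy_fell_conv\<close>), and
dominated convergence yields weak convergence of the laws.

\<^emph>\<open>Surjectivity.\<close> Let \<open>P\<close> be ergodic and let the frequency of \<open>G\<close> at level \<open>N\<close> be the proportion
of the maps \<open>\<iota>\<close> from \<open>[n]\<close> to \<open>[N]\<close> that pull the hypergraph on \<open>[N]\<close> back to \<open>G\<close>. Two random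
maps are injective with disjoint ranges up to a probability of order \<open>1 / N\<close>; by exchangeability
the frequencies therefore form a Cauchy sequence in mean square (\<open>freq_cauchy\<close>). They do not change under
permutations of \<open>[N]\<close>, so ergodicity forces their limit to be the constant \<open>P (H n = G)\<close>
(\<open>freq_limit_constant\<close>). Thus a single deterministic hypergraph on a large \<open>[N]\<close> has all
frequencies close to the probabilities under \<open>P\<close>. Lining up its vertices as adjacent intervals of length
\<open>1 / N\<close> turns it into an element of \<open>InSy\<close>, and sampling from this element is drawing vertices with
replacement unless two points share an interval (\<open>interval_system_sample_prob\<close>). Finally \<open>InSy\<close>
is sequentially compact for hit-or-miss convergence (\<open>InSy_fell_compact\<close>) and the sampling probabilities are
continuous, so a limit of such systems reproduces \<open>P\<close> exactly (\<open>erg_law_eq_Law_ih\<close>).\<close>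

section \<open>Pull-backs of hypergraphs\<close>

text \<open>Restriction, relabelling, the action of \<open>S_infinity\<close> and sampling with reindexed points are all
instances of this operation, so their compatibility reduces to \<open>pull_pull\<close>.\<close>

definition pull :: "nat \<Rightarrow> (nat \<Rightarrow> nat) \<Rightarrow> nat set set \<Rightarrow> nat set set" where
  "pull n \<iota> H = (\<lambda>e. {j \<in> {1..n}. \<iota> j \<in> e}) ` H"

lemma restrict_hy_eq_pull: "restrict_hy k H = pull k id H"
proof -
  have "{1..k} \<inter> e = {j \<in> {1..k}. id j \<in> e}" for e by auto
  then show ?thesis unfolding restrict_hy_def pull_def by (simp add: Setcompr_eq_image)
qed

lemma relabel_hy_eq_pull:
  assumes "\<pi> permutes {1..n}" "H \<subseteq> Pow {1..n}"
  shows "relabel_hy \<pi> H = pull n (inv \<pi>) H"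
proof -
  have "\<pi> ` e = {j \<in> {1..n}. inv \<pi> j \<in> e}" if "e \<in> H" for e
  proof -
    have "e \<subseteq> {1..n}" using assms that by auto
    moreover have "\<pi> x \<in> {1..n}" if "x \<in> {1..n}" for x using permutes_in_image[OF assms(1)] that by simp
    moreover have "inv \<pi> (\<pi> x) = x" "\<pi> (inv \<pi> x) = x" for x
      using permutes_inverses[OF assms(1)] by auto
    ultimately show ?thesis unfolding set_eq_iff image_iff mem_Collect_eq by (metis subsetD)
  qed
  then show ?thesis unfolding relabel_hy_def pull_def by auto
qed

lemma pull_pull:
  assumes "\<iota> ` {1..n} \<subseteq> {1..N}"
  shows "pull n \<iota> (pull N \<kappa> H) = pull n (\<kappa> \<circ> \<iota>) H"
proof -
  have "{j \<in> {1..n}. \<iota> j \<in> {i \<in> {1..N}. \<kappa> i \<in> e}} = {j \<in> {1..n}. (\<kappa> \<circ> \<iota>) j \<in> e}" for e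
    using assms by fastforce
  then show ?thesis unfolding pull_def by (simp add: image_image)
qed

lemma pull_cong:
  assumes "\<And>j. j \<in> {1..n} \<Longrightarrow> \<iota> j = \<kappa> j"
  shows "pull n \<iota> H = pull n \<kappa> H"
proof -
  have "{j \<in> {1..n}. \<iota> j \<in> e} = {j \<in> {1..n}. \<kappa> j \<in> e}" for e
    using assms by auto
  then show ?thesis unfolding pull_def by simp
qed

lemma InHy_subset_Pow: "H \<in> InHy n \<Longrightarrow> H \<subseteq> Pow {1..n}"
  by (simp add: InHy_def)

lemma finite_InHy: "finite (InHy n)"
  by (rule finite_subset[of _ "Pow (Pow {1..n})"]) (auto simp: InHy_def)

lemma pull_id: "H \<in> InHy n \<Longrightarrow> pull n id H = H"
proof -
  assume "H \<in> InHy n"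
  then have "{j \<in> {1..n}. id j \<in> e} = e" if "e \<in> H" for e
    using that InHy_subset_Pow by fastforce
  then show ?thesis unfolding pull_def by simp
qed

lemma pull_InHy:
  assumes H: "H \<in> InHy N" and inj: "inj_on \<iota> {1..n}" and sub: "\<iota> ` {1..n} \<subseteq> {1..N}"
  shows "pull n \<iota> H \<in> InHy n"
proof -
  obtain l where l: "linear_order_on {1..N} l" and iv: "\<And>e. e \<in> H \<Longrightarrow> interval_wrt N l e"
    using H by (auto simp: InHy_def)
  define l' where "l' = {(a, b). a \<in> {1..n} \<and> b \<in> {1..n} \<and> (\<iota> a, \<iota> b) \<in> l}"
  have "{j} \<in> pull n \<iota> H" if "j \<in> {1..n}" for j
  proof -
    have "\<iota> j \<in> {1..N}" using sub that by blast
    then have "{\<iota> j} \<in> H" using H unfolding InHy_def by blast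
    moreover have "{i \<in> {1..n}. \<iota> i \<in> {\<iota> j}} = {j}" using that inj by (auto dest: inj_onD)
    ultimately show ?thesis unfolding pull_def by (intro image_eqI[of _ _ "{\<iota> j}"]) simp_all
  qed
  moreover have "{} \<in> pull n \<iota> H"
    using H unfolding pull_def InHy_def by (intro image_eqI[of _ _ "{}"]) simp_all
  moreover have "linear_order_on {1..n} l'"
  proof -
    note [simp del] = atLeastAtMost_iff
    have sub': "\<iota> j \<in> {1..N}" if "j \<in> {1..n}" for j using sub that by blast
    have "trans l" "antisym l" and rfl: "\<And>a. a \<in> {1..N} \<Longrightarrow> (a, a) \<in> l"
      and tot: "\<And>a b. a \<in> {1..N} \<Longrightarrow> b \<in> {1..N} \<Longrightarrow> a \<noteq> b \<Longrightarrow> (a, b) \<in> l \<or> (b, a) \<in> l"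
      using l unfolding linear_order_on_def partial_order_on_def preorder_on_def refl_on_def
        total_on_def by blast+
    have "refl_on {1..n} l'" "l' \<subseteq> {1..n} \<times> {1..n}"
      using rfl sub' by (auto simp: refl_on_def l'_def)
    moreover have "trans l'"
      using \<open>trans l\<close> unfolding l'_def by (auto intro!: transI dest: transD)
    moreover have "antisym l'"
      using \<open>antisym l\<close> inj unfolding l'_def by (auto intro!: antisymI dest: antisymD inj_onD)
    moreover have "total_on {1..n} l'"
      unfolding total_on_def
    proof (intro ballI impI)
      fix a b assume ab: "a \<in> {1..n}" "b \<in> {1..n}" "a \<noteq> b"
      then have "\<iota> a \<noteq> \<iota> b" using inj by (auto dest: inj_onD)
      then show "(a, b) \<in> l' \<or> (b, a) \<in> l'"
        using tot[OF sub'[OF ab(1)] sub'[OF ab(2)]] ab by (simp add: l'_def)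
    qed
    ultimately show ?thesis
      by (simp add: linear_order_on_def partial_order_on_def preorder_on_def)
  qed
  moreover have "interval_wrt n l' e" if e_in: "e \<in> pull n \<iota> H" for e
  proof -
    obtain e' where "e' \<in> H" and e: "e = {j \<in> {1..n}. \<iota> j \<in> e'}"
      using e_in unfolding pull_def by blast
    then have "interval_wrt N l e'" using iv by auto
    then have *: "\<And>a b c. a \<in> e' \<Longrightarrow> b \<in> e' \<Longrightarrow> c \<in> {1..N} \<Longrightarrow> (a, c) \<in> l \<Longrightarrow> (c, b) \<in> l \<Longrightarrow> c \<in> e'"
      unfolding interval_wrt_def by blast
    have "\<iota> j \<in> {1..N}" if "j \<in> {1..n}" for j using sub that by blast
    then show ?thesis unfolding interval_wrt_def e l'_def using * by blast
  qed
  moreover have "pull n \<iota> H \<subseteq> Pow {1..n}" by (auto simp: pull_def)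
  ultimately show ?thesis unfolding InHy_def by blast
qed

text \<open>The order of the sample points, with ties broken by the index, makes every sampled edge an
interval, whatever the sample points are.\<close>

lemma sample_hy_InHy: "sample_hy K n u \<in> InHy n"
proof -
  let ?l = "{(a, b). a \<in> {1..n} \<and> b \<in> {1..n} \<and> (u a < u b \<or> (u a = u b \<and> a \<le> b))}"
  have "linear_order_on {1..n} ?l"
    unfolding linear_order_on_def partial_order_on_def preorder_on_def refl_on_def trans_def
      antisym_def total_on_def by auto
  moreover have "interval_wrt n ?l e" if "e \<in> sample_hy K n u" for e
    using that unfolding sample_hy_def interval_wrt_def by auto
  ultimately show ?thesis unfolding InHy_def sample_hy_def by blast
qed

text \<open>Injectivity keeps the singletons under control: a singleton in the range of \<open>\<iota>\<close> is pulled back to a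
singleton and any other one to the empty set, so the edges that sampling always includes are reproduced.\<close>

lemma pull_sample_hy:
  assumes inj: "inj_on \<iota> {1..n}" and sub: "\<iota> ` {1..n} \<subseteq> {1..N}"
  shows "pull n \<iota> (sample_hy K N u) = sample_hy K n (u \<circ> \<iota>)"
proof -
  let ?p = "\<lambda>e. {j \<in> {1..n}. \<iota> j \<in> e}"
  have 1: "?p {j \<in> {1..N}. x < u j \<and> u j < y} = {j \<in> {1..n}. x < (u \<circ> \<iota>) j \<and> (u \<circ> \<iota>) j < y}" for x y
    using sub by fastforce
  have 2: "?p {i} = {} \<or> (\<exists>j\<in>{1..n}. ?p {i} = {j})" for i
  proof (cases "\<exists>j\<in>{1..n}. \<iota> j = i")
    case True
    then obtain j where j: "j \<in> {1..n}" "\<iota> j = i" by blast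
    then have "?p {i} = {j}" using inj by (auto dest: inj_onD)
    then show ?thesis using j by blast
  qed auto
  have 3: "?p {\<iota> j} = {j}" if "j \<in> {1..n}" for j
    using that inj by (auto dest: inj_onD)
  have split: "pull n \<iota> (sample_hy K N u) = ?p ` {{j \<in> {1..N}. x < u j \<and> u j < y} | x y. (x, y) \<in> K}
      \<union> (?p ` {{j} | j. j \<in> {1..N}} \<union> {{}})"
    unfolding sample_hy_def pull_def by (auto simp: image_Un)
  have edges: "?p ` {{j \<in> {1..N}. x < u j \<and> u j < y} | x y. (x, y) \<in> K} =
     {{j \<in> {1..n}. x < (u \<circ> \<iota>) j \<and> (u \<circ> \<iota>) j < y} | x y. (x, y) \<in> K}"
    unfolding 1[symmetric] by blast
  have trivial: "?p ` {{j} | j. j \<in> {1..N}} \<union> {{}} = {{j} | j. j \<in> {1..n}} \<union> {{}}"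
  proof -
    have "?p ` {{j} | j. j \<in> {1..N}} \<subseteq> {{j} | j. j \<in> {1..n}} \<union> {{}}"
      using 2 by blast
    then have A: "?p ` {{j} | j. j \<in> {1..N}} \<union> {{}} \<subseteq> {{j} | j. j \<in> {1..n}} \<union> {{}}"
      by (rule Un_least) (rule Un_upper2)
    have "{{j} | j. j \<in> {1..n}} \<subseteq> ?p ` {{j} | j. j \<in> {1..N}}"
    proof
      fix e assume "e \<in> {{j} | j. j \<in> {1..n}}"
      then obtain j where j: "j \<in> {1..n}" "e = {j}" by auto
      then have "e = ?p {\<iota> j}" "\<iota> j \<in> {1..N}"
        using 3 sub by (simp_all add: image_subset_iff del: atLeastAtMost_iff)
      then show "e \<in> ?p ` {{j} | j. j \<in> {1..N}}" by blast
    qed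
    then have B: "{{j} | j. j \<in> {1..n}} \<union> {{}} \<subseteq> ?p ` {{j} | j. j \<in> {1..N}} \<union> {{}}"
      by (rule Un_mono) (rule order_refl)
    show ?thesis using A B by (rule equalityI)
  qed
  show ?thesis
    unfolding sample_hy_def[of K n "u \<circ> \<iota>"] Un_assoc
    by (rule trans[OF split arg_cong2[where f = "(\<union>)", OF edges trivial]])
qed

lemma sample_hy_cong:
  assumes "\<And>j. j \<in> {1..n} \<Longrightarrow> u j = v j"
  shows "sample_hy K n u = sample_hy K n v"
proof -
  have "{j \<in> {1..n}. x < u j \<and> u j < y} = {j \<in> {1..n}. x < v j \<and> v j < y}" for x y
    using assms by auto
  then show ?thesis unfolding sample_hy_def by simp
qed

lemma InHyN_E:
  assumes "h \<in> InHyN" "1 \<le> n"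
  shows "h n \<in> InHy n" "h n = restrict_hy n (h (Suc n))"
proof -
  have n: "n \<in> {1..}" using assms(2) by simp
  from assms(1) have *: "h \<in> (\<Pi>\<^sub>E n\<in>{1..}. InHy n)" "\<forall>n\<in>{1..}. h n = restrict_hy n (h (Suc n))"
    unfolding InHyN_def mem_Collect_eq by (rule conjunct1, rule conjunct2)
  show "h n \<in> InHy n" using *(1) n by (rule PiE_mem)
  show "h n = restrict_hy n (h (Suc n))" using *(2) n by (rule bspec)
qed

text \<open>By consistency, a pull-back along a map with range in \<open>[N]\<close> can be computed at any level above \<open>N\<close>.\<close>

lemma InHyN_pull:
  assumes h: "h \<in> InHyN" and "1 \<le> N" "N \<le> M" "\<iota> ` {1..n} \<subseteq> {1..N}"
  shows "pull n \<iota> (h M) = pull n \<iota> (h N)"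
  using \<open>N \<le> M\<close>
proof (induction M rule: dec_induct)
  case (step M)
  have sub_M: "\<iota> ` {1..n} \<subseteq> {1..M}" by (rule subset_trans[OF assms(4)]) (use step in auto)
  have "h M = pull M id (h (Suc M))"
    using InHyN_E(2)[OF h order_trans[OF \<open>1 \<le> N\<close> step(1)]] by (simp only: restrict_hy_eq_pull)
  then have "pull n \<iota> (h M) = pull n \<iota> (h (Suc M))"
    using pull_pull[OF sub_M, of id "h (Suc M)"] by simp
  then show ?case using step by (simp only:)
qed (rule refl)

lemma InHyN_restrict:
  assumes h: "h \<in> InHyN" and "1 \<le> n" "n \<le> N"
  shows "h n = pull n id (h N)"
  using InHyN_pull[OF h, of n N id n] assms(2,3) pull_id[OF InHyN_E(1)[OF h \<open>1 \<le> n\<close>]] by simp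

lemma InHyN_eqI:
  assumes "g \<in> InHyN" "h \<in> InHyN" "\<And>n. 1 \<le> n \<Longrightarrow> g n = h n"
  shows "g = h"
proof (rule PiE_ext)
  show "g \<in> (\<Pi>\<^sub>E n\<in>{1..}. InHy n)"
    using assms(1) unfolding InHyN_def mem_Collect_eq by (rule conjunct1)
  show "h \<in> (\<Pi>\<^sub>E n\<in>{1..}. InHy n)"
    using assms(2) unfolding InHyN_def mem_Collect_eq by (rule conjunct1)
qed (use assms(3) in simp)

lemma sample_hy_restrict: "sample_hy K n u = restrict_hy n (sample_hy K (Suc n) u)"
proof -
  have "id ` {1..n} \<subseteq> {1..Suc n}" by auto
  then have "pull n id (sample_hy K (Suc n) u) = sample_hy K n (u \<circ> id)"
    by (intro pull_sample_hy) (rule inj_on_id)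
  then show ?thesis unfolding restrict_hy_eq_pull comp_id by (rule sym)
qed

lemma sample_path_InHyN: "(\<lambda>n\<in>{1..}. sample_hy K n u) \<in> InHyN"
proof -
  have "\<forall>n\<in>{1..}. (\<lambda>n\<in>{1..}. sample_hy K n u) n = restrict_hy n ((\<lambda>n\<in>{1..}. sample_hy K n u) (Suc n))"
  proof
    fix n :: nat assume "n \<in> {1..}"
    then have "n \<in> {1..}" "Suc n \<in> {1..}" by simp_all
    then show "(\<lambda>n\<in>{1..}. sample_hy K n u) n = restrict_hy n ((\<lambda>n\<in>{1..}. sample_hy K n u) (Suc n))"
      using sample_hy_restrict[of K n u] by (simp only: restrict_apply if_True)
  qed
  moreover have "(\<lambda>n\<in>{1..}. sample_hy K n u) \<in> (\<Pi>\<^sub>E n\<in>{1..}. InHy n)"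
    by (rule restrict_PiE_iff[THEN iffD2]) (simp add: sample_hy_InHy)
  ultimately show ?thesis unfolding InHyN_def by (intro CollectI conjI)
qed

text \<open>This turns exchangeability, which speaks of permutations, into invariance under injections
between index sets of different sizes.\<close>

lemma extend_injection:
  assumes inj: "inj_on \<iota> {1..n}" and sub: "\<iota> ` {1..n} \<subseteq> {1..N}" and "n \<le> N"
  obtains \<pi> where "\<pi> permutes {1..N::nat}" "\<And>j. j \<in> {1..n} \<Longrightarrow> \<pi> j = \<iota> j"
proof -
  have "card ({1..N} - {1..n}) = card ({1..N} - \<iota> ` {1..n})"
    using card_image[OF inj] sub \<open>n \<le> N\<close> by (subst (1 2) card_Diff_subset) simp_all
  then obtain g where g: "bij_betw g ({1..N} - {1..n}) ({1..N} - \<iota> ` {1..n})"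
    by (meson finite_Diff finite_atLeastAtMost finite_same_card_bij)
  define \<pi> where "\<pi> j = (if j \<in> {1..n} then \<iota> j else if j \<in> {1..N} then g j else j)" for j
  have "bij_betw \<iota> {1..n} (\<iota> ` {1..n})" using inj by (simp add: bij_betw_def)
  then have "bij_betw \<pi> {1..n} (\<iota> ` {1..n})"
    by (subst bij_betw_cong[of _ _ \<iota>]) (auto simp: \<pi>_def)
  moreover have "bij_betw \<pi> ({1..N} - {1..n}) ({1..N} - \<iota> ` {1..n})"
    using g by (subst bij_betw_cong[of _ _ g]) (auto simp: \<pi>_def)
  ultimately have "bij_betw \<pi> ({1..n} \<union> ({1..N} - {1..n})) (\<iota> ` {1..n} \<union> ({1..N} - \<iota> ` {1..n}))"
    by (rule bij_betw_combine) auto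
  moreover have "{1..n} \<union> ({1..N} - {1..n}) = {1..N}" using \<open>n \<le> N\<close> by auto
  moreover have "\<iota> ` {1..n} \<union> ({1..N} - \<iota> ` {1..n}) = {1..N}" by (simp only: Un_Diff_cancel Un_absorb1[OF sub])
  ultimately have "bij_betw \<pi> {1..N} {1..N}" by (simp only:)
  moreover have "\<pi> j = j" if "j \<notin> {1..N}" for j using that \<open>n \<le> N\<close> by (auto simp: \<pi>_def)
  ultimately have "\<pi> permutes {1..N}" by (rule bij_imp_permutes)
  then show thesis by (rule that) (simp add: \<pi>_def)
qed

text \<open>The definition of the action distinguishes two cases and refers to the least \<open>m\<close> beyond which \<open>\<pi>\<close>
is the identity. On consistent sequences all sufficiently large levels \<open>N\<close> lead to the same value, which is
the form used from here on.\<close>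

lemma S_infinity_act_eq_pull:
  assumes pi: "\<pi> \<in> S_infinity"
  obtains m where "1 \<le> m" "\<pi> permutes {1..m}"
    "\<And>h n N. h \<in> InHyN \<Longrightarrow> 1 \<le> n \<Longrightarrow> n \<le> N \<Longrightarrow> m \<le> N \<Longrightarrow>
       S_infinity_act \<pi> h n = pull n (inv \<pi>) (h N)"
proof -
  have perm: "\<pi> permutes {1..}" and fin: "finite {i. \<pi> i \<noteq> i}"
    using pi unfolding S_infinity_def by blast+
  obtain B where B: "\<forall>i\<in>{i. \<pi> i \<noteq> i}. i < B"
    using finite_nat_set_iff_bounded[THEN iffD1, OF fin] by blast
  have "1 \<le> Suc B \<and> (\<forall>i\<ge>Suc B. \<pi> i = i)"
    using B by (auto dest: Suc_le_lessD less_asym)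
  then have ex: "\<exists>m. 1 \<le> m \<and> (\<forall>i\<ge>m. \<pi> i = i)" by blast
  define m where "m = (LEAST m. 1 \<le> m \<and> (\<forall>i\<ge>m. \<pi> i = i))"
  have "1 \<le> m \<and> (\<forall>i\<ge>m. \<pi> i = i)" unfolding m_def by (rule LeastI_ex[OF ex])
  then have m: "1 \<le> m" "\<And>i. i \<ge> m \<Longrightarrow> \<pi> i = i" by blast+
  have zero: "\<pi> 0 = 0" using perm by (rule permutes_not_in) simp
  have perm_N: "\<pi> permutes {1..N}" if "m \<le> N" for N
  proof (rule bij_imp_permutes)
    have inj: "inj \<pi>" using perm by (rule permutes_inj)
    have "\<pi> i \<in> {1..N}" if "i \<in> {1..N}" for i
    proof (rule ccontr)
      assume *: "\<pi> i \<notin> {1..N}"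
      have "\<pi> i \<noteq> 0"
      proof
        assume "\<pi> i = 0"
        then have "i = 0" using injD[OF inj, of i 0] zero by simp
        then show False using that by simp
      qed
      then have "\<pi> i \<ge> m" using * \<open>m \<le> N\<close> by auto
      then have "\<pi> (\<pi> i) = \<pi> i" using m(2) by blast
      then have "\<pi> i = i" by (rule injD[OF inj])
      then show False using * that by simp
    qed
    then have "\<pi> ` {1..N} \<subseteq> {1..N}" by blast
    moreover have "inj_on \<pi> {1..N}" using inj by (rule inj_on_subset) simp
    ultimately show "bij_betw \<pi> {1..N} {1..N}"
      using endo_inj_surj[of "{1..N}" \<pi>] by (auto simp: bij_betw_def)
    fix i assume "i \<notin> {1..N}"
    then have "i = 0 \<or> i \<ge> m" using \<open>m \<le> N\<close> by auto
    then show "\<pi> i = i" using zero m(2) by auto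
  qed
  have act: "S_infinity_act \<pi> h n = pull n (inv \<pi>) (h N)"
    if h: "h \<in> InHyN" and n: "1 \<le> n" "n \<le> N" "m \<le> N" for h n N
  proof -
    have inv_sub: "inv \<pi> ` {1..k} \<subseteq> {1..k}" if "m \<le> k" for k
      using permutes_image[OF permutes_inv[OF perm_N[OF that]]] by simp
    have hk: "h k \<subseteq> Pow {1..k}" if "1 \<le> k" for k
      using InHyN_E(1)[OF h that] by (rule InHy_subset_Pow)
    have "n \<in> {1..}" using n(1) by simp
    then have act_n: "S_infinity_act \<pi> h n =
        (if m \<le> n then relabel_hy \<pi> (h n) else restrict_hy n (relabel_hy \<pi> (h m)))"
      unfolding S_infinity_act_def Let_def m_def by (simp only: restrict_apply if_True)
    show ?thesis
    proof (cases "m \<le> n")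
      case True
      then have "S_infinity_act \<pi> h n = pull n (inv \<pi>) (h n)"
        using relabel_hy_eq_pull[OF perm_N[OF True] hk[OF n(1)]] by (simp only: act_n if_True)
      also have "\<dots> = pull n (inv \<pi>) (h N)"
        using InHyN_pull[OF h n(1,2) inv_sub[OF True]] by simp
      finally show ?thesis .
    next
      case False
      have "id ` {1..n} \<subseteq> {1..m}" using False by auto
      then have "S_infinity_act \<pi> h n = pull n (inv \<pi>) (h m)"
        using False relabel_hy_eq_pull[OF perm_N[OF order_refl] hk[OF m(1)]]
        by (simp only: act_n if_False restrict_hy_eq_pull pull_pull comp_id)
      also have "\<dots> = pull n (inv \<pi>) (h N)"
      proof (rule InHyN_pull[OF h m(1) n(3), symmetric])
        have "inv \<pi> ` {1..n} \<subseteq> inv \<pi> ` {1..m}" using False by (intro image_mono) simp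
        then show "inv \<pi> ` {1..n} \<subseteq> {1..m}" using inv_sub[OF order_refl] by (rule subset_trans)
      qed
      finally show ?thesis .
    qed
  qed
  show thesis using that[OF m(1) perm_N[OF order_refl] act] .
qed

section \<open>Borel sets and laws of consistent sequences\<close>

abbreviation hy_borel :: "(nat \<Rightarrow> nat set set) measure" where
  "hy_borel \<equiv> borel_of InHyN_topology"

definition cyl :: "nat \<Rightarrow> nat set set \<Rightarrow> (nat \<Rightarrow> nat set set) set" where
  "cyl n G = {h \<in> InHyN. h n = G}"

text \<open>Two cylinders are nested or disjoint; with the empty set added the family is stable under
intersections.\<close>

definition cylinders :: "(nat \<Rightarrow> nat set set) set set" where
  "cylinders = insert {} (\<Union>n\<in>{1..}. cyl n ` InHy n)"

lemma sets_borel_of: "sets (borel_of X) = sigma_sets (topspace X) {S. openin X S}"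
  and space_borel_of: "space (borel_of X) = topspace X"
proof -
  have "{S. openin X S} \<subseteq> Pow (topspace X)" by (auto dest: openin_subset)
  then show "sets (borel_of X) = sigma_sets (topspace X) {S. openin X S}"
    "space (borel_of X) = topspace X"
    unfolding borel_of_def by (simp_all add: space_measure_of_conv)
qed

lemma topspace_InHy_prod: "topspace InHy_prod_topology = (\<Pi>\<^sub>E n\<in>{1..}. InHy n)"
  by (simp add: InHy_prod_topology_def)

lemma InHyN_subset_prod: "InHyN \<subseteq> (\<Pi>\<^sub>E n\<in>{1..}. InHy n)"
  unfolding InHyN_def by (rule Collect_restrict)

lemma topspace_InHyN: "topspace InHyN_topology = InHyN"
  unfolding InHyN_topology_def topspace_subtopology topspace_InHy_prod
  using InHyN_subset_prod by blast

lemma openin_InHy_prod_iff: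
  "openin InHy_prod_topology S \<longleftrightarrow>
    (\<forall>h\<in>S. \<exists>N\<ge>1. h \<in> (\<Pi>\<^sub>E n\<in>{1..}. InHy n) \<and> {g \<in> (\<Pi>\<^sub>E n\<in>{1..}. InHy n). \<forall>i\<in>{1..N}. g i = h i} \<subseteq> S)"
  (is "?L \<longleftrightarrow> ?R")
proof
  assume ?L
  show ?R
  proof
    fix h assume h: "h \<in> S"
    have "\<exists>U. finite {i \<in> {1..}. U i \<noteq> InHy i} \<and> (\<forall>i\<in>{1..}. U i \<subseteq> InHy i) \<and>
        h \<in> Pi\<^sub>E {1..} U \<and> Pi\<^sub>E {1..} U \<subseteq> S"
      using \<open>?L\<close> h unfolding InHy_prod_topology_def openin_product_topology_alt
        openin_discrete_topology topspace_discrete_topology by (rule bspec)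
    then obtain U where U: "finite {i \<in> {1..}. U i \<noteq> InHy i}" "\<forall>i\<in>{1..}. U i \<subseteq> InHy i"
        "h \<in> Pi\<^sub>E {1..} U" "Pi\<^sub>E {1..} U \<subseteq> S" by blast
    obtain B where B: "\<forall>i\<in>{i \<in> {1..}. U i \<noteq> InHy i}. i < B"
      using finite_nat_set_iff_bounded[THEN iffD1, OF U(1)] by blast
    have "{g \<in> (\<Pi>\<^sub>E n\<in>{1..}. InHy n). \<forall>i\<in>{1..Suc B}. g i = h i} \<subseteq> S"
    proof
      fix g assume "g \<in> {g \<in> (\<Pi>\<^sub>E n\<in>{1..}. InHy n). \<forall>i\<in>{1..Suc B}. g i = h i}"
      then have g: "g \<in> (\<Pi>\<^sub>E n\<in>{1..}. InHy n)" "\<forall>i\<in>{1..Suc B}. g i = h i" by blast+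
      have "g i \<in> U i" if i: "i \<in> {1..}" for i
      proof (cases "U i = InHy i")
        case True then show ?thesis using PiE_mem[OF g(1) i] by simp
      next
        case False
        then have "i \<in> {1..Suc B}" using B i by auto
        then show ?thesis using g(2) PiE_mem[OF U(3) i] by simp
      qed
      then have "g \<in> Pi\<^sub>E {1..} U" using g(1) by (auto simp: PiE_iff)
      then show "g \<in> S" using U(4) by blast
    qed
    moreover have "h \<in> (\<Pi>\<^sub>E n\<in>{1..}. InHy n)"
      using U(2,3) by (auto simp: PiE_iff)
    ultimately show "\<exists>N\<ge>1. h \<in> (\<Pi>\<^sub>E n\<in>{1..}. InHy n) \<and> {g \<in> (\<Pi>\<^sub>E n\<in>{1..}. InHy n). \<forall>i\<in>{1..N}. g i = h i} \<subseteq> S"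
      by (intro exI[of _ "Suc B"] conjI) simp_all
  qed
next
  assume R: ?R
  show ?L
    unfolding InHy_prod_topology_def openin_product_topology_alt
  proof
    fix h assume "h \<in> S"
    then obtain N where N: "h \<in> (\<Pi>\<^sub>E n\<in>{1..}. InHy n)"
      "{g \<in> (\<Pi>\<^sub>E n\<in>{1..}. InHy n). \<forall>i\<in>{1..N}. g i = h i} \<subseteq> S"
      using bspec[OF R, of h] by blast
    define U where "U i = (if i \<le> N then {h i} else InHy i)" for i
    have "finite {i \<in> {1..}. U i \<noteq> topspace (discrete_topology (InHy i))}"
      by (rule finite_subset[of _ "{..N}"]) (auto simp: U_def)
    moreover have "\<forall>i\<in>{1..}. openin (discrete_topology (InHy i)) (U i)"
      using N(1) by (auto simp: U_def PiE_iff)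
    moreover have "h \<in> Pi\<^sub>E {1..} U" using N(1) by (auto simp: U_def PiE_iff)
    moreover have "Pi\<^sub>E {1..} U \<subseteq> S"
    proof
      fix g assume g: "g \<in> Pi\<^sub>E {1..} U"
      then have "g i = h i" if "i \<in> {1..N}" for i
        using that PiE_mem[OF g, of i] by (simp add: U_def)
      then have "\<forall>i\<in>{1..N}. g i = h i" by blast
      moreover have "g \<in> (\<Pi>\<^sub>E n\<in>{1..}. InHy n)"
      proof (rule PiE_I)
        fix i :: nat assume i: "i \<in> {1..}"
        then show "g i \<in> InHy i"
          using PiE_mem[OF g i] PiE_mem[OF N(1) i] by (auto simp: U_def split: if_splits)
      qed (rule PiE_arb[OF g])
      ultimately show "g \<in> S" using N(2) by blast
    qed
    ultimately show "\<exists>U. finite {i \<in> {1..}. U i \<noteq> topspace (discrete_topology (InHy i))} \<and>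
        (\<forall>i\<in>{1..}. openin (discrete_topology (InHy i)) (U i)) \<and> h \<in> Pi\<^sub>E {1..} U \<and> Pi\<^sub>E {1..} U \<subseteq> S"
      by blast
  qed
qed

lemma InHyN_eq_below:
  assumes "g \<in> InHyN" "h \<in> InHyN" "1 \<le> n" "n \<le> N" "g N = h N"
  shows "g n = h n"
  using InHyN_restrict[OF assms(1,3,4)] InHyN_restrict[OF assms(2,3,4)] assms(5) by simp

text \<open>A coordinate of a consistent sequence determines all earlier ones, so basic neighbourhoods are
given by a single coordinate.\<close>

lemma openin_InHyN_iff:
  "openin InHyN_topology S \<longleftrightarrow> S \<subseteq> InHyN \<and> (\<forall>h\<in>S. \<exists>n\<ge>1. cyl n (h n) \<subseteq> S)"
  (is "?L \<longleftrightarrow> ?R")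
proof
  assume ?L
  then obtain T where T: "openin InHy_prod_topology T" "S = T \<inter> InHyN"
    unfolding InHyN_topology_def openin_subtopology by blast
  show ?R
  proof (intro conjI ballI)
    fix h assume h: "h \<in> S"
    then obtain N where N: "N \<ge> 1"
        "{g \<in> (\<Pi>\<^sub>E n\<in>{1..}. InHy n). \<forall>i\<in>{1..N}. g i = h i} \<subseteq> T"
      using T unfolding openin_InHy_prod_iff by blast
    have "g \<in> S" if "g \<in> cyl N (h N)" for g
    proof -
      have g: "g \<in> InHyN" "g N = h N" using that by (auto simp: cyl_def)
      have "g i = h i" if "i \<in> {1..N}" for i
        by (rule InHyN_eq_below[where N = N]) (use T(2) h that g in auto)
      then show ?thesis using N(2) g(1) InHyN_subset_prod T(2) by blast
    qed
    then show "\<exists>n\<ge>1. cyl n (h n) \<subseteq> S" using N(1) by blast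
  qed (use T(2) in blast)
next
  assume R: ?R
  define T where "T = (\<Union>h\<in>S. \<Union>n\<in>{n. 1 \<le> n \<and> cyl n (h n) \<subseteq> S}. {g \<in> (\<Pi>\<^sub>E n\<in>{1..}. InHy n). g n = h n})"
  have "openin InHy_prod_topology T"
    unfolding openin_InHy_prod_iff
  proof
    fix g assume "g \<in> T"
    then obtain h n where hn: "h \<in> S" "1 \<le> n" "cyl n (h n) \<subseteq> S" "g \<in> (\<Pi>\<^sub>E n\<in>{1..}. InHy n)" "g n = h n"
      unfolding T_def by blast
    have "{f \<in> (\<Pi>\<^sub>E n\<in>{1..}. InHy n). \<forall>i\<in>{1..n}. f i = g i} \<subseteq> T"
    proof
      fix f assume f: "f \<in> {f \<in> (\<Pi>\<^sub>E n\<in>{1..}. InHy n). \<forall>i\<in>{1..n}. f i = g i}"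
      then have "f n = h n" using hn(2,5) by auto
      then show "f \<in> T" unfolding T_def using f hn by blast
    qed
    then show "\<exists>N\<ge>1. g \<in> (\<Pi>\<^sub>E n\<in>{1..}. InHy n) \<and> {f \<in> (\<Pi>\<^sub>E n\<in>{1..}. InHy n). \<forall>i\<in>{1..N}. f i = g i} \<subseteq> T"
      using hn by blast
  qed
  moreover have "S = T \<inter> InHyN"
  proof
    show "S \<subseteq> T \<inter> InHyN" using R InHyN_subset_prod unfolding T_def by blast
    show "T \<inter> InHyN \<subseteq> S" unfolding T_def cyl_def by blast
  qed
  ultimately show ?L unfolding InHyN_topology_def openin_subtopology by blast
qed

lemma countable_cylinders: "countable cylinders"
  unfolding cylinders_def
  by (intro countable_insert countable_UN countable_image countableI_type countable_finite[OF finite_InHy])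

lemma cyl_Int:
  assumes "1 \<le> n" "n \<le> N" "G' \<in> InHy N"
  shows "cyl n G \<inter> cyl N G' = (if pull n id G' = G then cyl N G' else {})"
  using InHyN_restrict[OF _ assms(1,2)] unfolding cyl_def by auto

lemma Int_stable_cylinders: "Int_stable cylinders"
proof (rule Int_stableI)
  fix A B assume "A \<in> cylinders" "B \<in> cylinders"
  then consider "A = {} \<or> B = {}" | n G N G' where "1 \<le> n" "1 \<le> N" "G \<in> InHy n" "G' \<in> InHy N"
      "A = cyl n G" "B = cyl N G'"
    unfolding cylinders_def by auto
  then show "A \<inter> B \<in> cylinders"
  proof cases
    case 1 then show ?thesis by (auto simp: cylinders_def)
  next
    case 2
    have *: "cyl n G \<inter> cyl N G' \<in> cylinders"
      if "1 \<le> n" "n \<le> N" "1 \<le> N" "G' \<in> InHy N" for n N G G'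
      using cyl_Int[OF that(1,2,4), of G] that unfolding cylinders_def by auto
    show ?thesis
      using *[of n N G' G] *[of N n G G'] 2 by (cases "n \<le> N") (auto simp: Int_commute)
  qed
qed

lemma cylinders_Pow: "cylinders \<subseteq> Pow InHyN"
  unfolding cylinders_def cyl_def by auto

lemma openin_cyl: "1 \<le> n \<Longrightarrow> openin InHyN_topology (cyl n G)"
  unfolding openin_InHyN_iff by (auto simp: cyl_def)

text \<open>There are only countably many cylinders because every \<open>InHy n\<close> is finite, so every open set is a
countable union of cylinders.\<close>

lemma sets_hy_borel: "sets hy_borel = sigma_sets InHyN cylinders"
proof -
  have "S \<in> sigma_sets InHyN cylinders" if S: "openin InHyN_topology S" for S
  proof -
    have "S = \<Union> {C \<in> cylinders. C \<subseteq> S}"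
    proof
      show "S \<subseteq> \<Union> {C \<in> cylinders. C \<subseteq> S}"
      proof
        fix h assume h: "h \<in> S"
        then obtain n where n: "n \<ge> 1" "cyl n (h n) \<subseteq> S" "h \<in> InHyN"
          using S unfolding openin_InHyN_iff by blast
        then have "cyl n (h n) \<in> cylinders" "h \<in> cyl n (h n)"
          using InHyN_E(1)[OF n(3,1)] by (auto simp: cylinders_def cyl_def)
        then show "h \<in> \<Union> {C \<in> cylinders. C \<subseteq> S}" using n by blast
      qed
    qed blast
    moreover have "\<Union> {C \<in> cylinders. C \<subseteq> S} \<in> sigma_sets InHyN cylinders"
    proof (rule sigma_sets_UNION)
      show "countable {C \<in> cylinders. C \<subseteq> S}"
        by (rule countable_subset[OF _ countable_cylinders]) blast
    qed (auto intro: sigma_sets.Basic)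
    ultimately show ?thesis by simp
  qed
  then have "sigma_sets InHyN {S. openin InHyN_topology S} \<subseteq> sigma_sets InHyN cylinders"
    by (intro sigma_sets_mono) auto
  moreover have "sigma_sets InHyN cylinders \<subseteq> sigma_sets InHyN {S. openin InHyN_topology S}"
  proof (intro sigma_sets_mono subsetI)
    fix C assume "C \<in> cylinders"
    then show "C \<in> sigma_sets InHyN {S. openin InHyN_topology S}"
      unfolding cylinders_def by (auto intro: sigma_sets.Empty intro!: sigma_sets.Basic openin_cyl)
  qed
  ultimately show ?thesis unfolding sets_borel_of topspace_InHyN by blast
qed

lemma space_hy_borel: "space hy_borel = InHyN"
  by (simp add: space_borel_of topspace_InHyN)

text \<open>The set is closed: inconsistency at level \<open>n\<close> is visible in the coordinates \<open>n\<close> and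
\<open>n + 1\<close>.\<close>

lemma InHyN_in_prod_borel: "InHyN \<in> sets (borel_of InHy_prod_topology)"
proof -
  let ?X = "\<Pi>\<^sub>E n\<in>{1..}. InHy n"
  have "openin InHy_prod_topology (?X - InHyN)"
    unfolding openin_InHy_prod_iff
  proof
    fix h assume h: "h \<in> ?X - InHyN"
    then obtain n where n: "n \<ge> 1" "h n \<noteq> restrict_hy n (h (Suc n))"
      unfolding InHyN_def by auto
    have "{g \<in> ?X. \<forall>i\<in>{1..Suc n}. g i = h i} \<subseteq> ?X - InHyN"
    proof
      fix g assume g: "g \<in> {g \<in> ?X. \<forall>i\<in>{1..Suc n}. g i = h i}"
      then have "g n = h n" "g (Suc n) = h (Suc n)" using n by auto
      then have "g \<notin> InHyN" using n InHyN_E(2)[of g n] by metis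
      then show "g \<in> ?X - InHyN" using g by blast
    qed
    then show "\<exists>N\<ge>1. h \<in> ?X \<and> {g \<in> ?X. \<forall>i\<in>{1..N}. g i = h i} \<subseteq> ?X - InHyN"
      using h by (intro exI[of _ "Suc n"]) auto
  qed
  then have "?X - InHyN \<in> sets (borel_of InHy_prod_topology)"
    unfolding sets_borel_of by (intro sigma_sets.Basic) simp
  then have "space (borel_of InHy_prod_topology) - (?X - InHyN) \<in> sets (borel_of InHy_prod_topology)"
    by (rule sets.compl_sets)
  moreover have "space (borel_of InHy_prod_topology) - (?X - InHyN) = InHyN"
    unfolding space_borel_of topspace_InHy_prod using InHyN_subset_prod by blast
  ultimately show ?thesis by simp
qed

text \<open>Again the factors are finite, so countably many sets that fix finitely many coordinates form a
base of the product topology. This makes a process with measurable coordinates Borel measurable as a path.\<close>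

lemma sets_prod_borel_subset:
  "sets (borel_of InHy_prod_topology) \<subseteq> sets (\<Pi>\<^sub>M n\<in>{1..}. count_space (InHy n))"
proof -
  let ?X = "\<Pi>\<^sub>E n\<in>{1..}. InHy n" and ?P = "\<Pi>\<^sub>M n\<in>{1..}. count_space (InHy n)"
  define Z where "Z N g = {f \<in> ?X. \<forall>i\<in>{1..N}. f i = g i}" for N :: nat and g
  define \<Z> where "\<Z> = (\<Union>N. Z N ` (\<Pi>\<^sub>E n\<in>{1..N}. InHy n))"
  have "countable \<Z>"
    unfolding \<Z>_def
    by (intro countable_UN countable_image countableI_type countable_finite finite_PiE finite_InHy finite_atLeastAtMost)
  have Z_sets: "Z N g \<in> sets ?P" if g: "g \<in> (\<Pi>\<^sub>E n\<in>{1..N}. InHy n)" for N g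
  proof -
    have "Z N g = (\<Pi>\<^sub>E i\<in>{1..}. if i \<in> {1..N} then {g i} else InHy i)"
    proof
      show "Z N g \<subseteq> (\<Pi>\<^sub>E i\<in>{1..}. if i \<in> {1..N} then {g i} else InHy i)"
      proof
        fix f assume "f \<in> Z N g"
        then have f: "f \<in> ?X" "\<forall>i\<in>{1..N}. f i = g i" unfolding Z_def by blast+
        show "f \<in> (\<Pi>\<^sub>E i\<in>{1..}. if i \<in> {1..N} then {g i} else InHy i)"
          using PiE_mem[OF f(1)] f(2) by (intro PiE_I) (simp_all add: PiE_arb[OF f(1)])
      qed
      show "(\<Pi>\<^sub>E i\<in>{1..}. if i \<in> {1..N} then {g i} else InHy i) \<subseteq> Z N g"
      proof
        fix f assume f: "f \<in> (\<Pi>\<^sub>E i\<in>{1..}. if i \<in> {1..N} then {g i} else InHy i)"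
        have eq: "f i = g i" if "i \<in> {1..N}" for i
          using PiE_mem[OF f, of i] that by simp
        have f_in: "f i \<in> InHy i" if "i \<in> {1..}" for i
        proof (cases "i \<in> {1..N}")
          case True then show ?thesis using eq[OF True] PiE_mem[OF g True] by simp
        next
          case False then show ?thesis using PiE_mem[OF f that] by (simp only: if_False)
        qed
        have "f \<in> ?X" by (rule PiE_I) (erule f_in, erule PiE_arb[OF f])
        then show "f \<in> Z N g" unfolding Z_def using eq by blast
      qed
    qed
    also have "\<dots> \<in> sets ?P"
      by (rule sets_PiM_I_countable) (use that in \<open>auto simp: PiE_iff\<close>)
    finally show ?thesis .
  qed
  have "S \<in> sets ?P" if S: "openin InHy_prod_topology S" for S
  proof -
    have "S = \<Union> {C \<in> \<Z>. C \<subseteq> S}"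
    proof
      show "S \<subseteq> \<Union> {C \<in> \<Z>. C \<subseteq> S}"
      proof
        fix h assume h: "h \<in> S"
        have "\<exists>N\<ge>1. h \<in> ?X \<and> Z N h \<subseteq> S"
          unfolding Z_def by (rule bspec[OF S[unfolded openin_InHy_prod_iff] h])
        then obtain N where N: "h \<in> ?X" "Z N h \<subseteq> S" by blast
        have "Z N h = Z N (restrict h {1..N})" unfolding Z_def by simp
        moreover have "restrict h {1..N} \<in> (\<Pi>\<^sub>E n\<in>{1..N}. InHy n)"
          using N(1) by (auto simp: PiE_iff)
        ultimately have "Z N h \<in> \<Z>" unfolding \<Z>_def by blast
        moreover have "h \<in> Z N h" using N by (simp add: Z_def)
        ultimately show "h \<in> \<Union> {C \<in> \<Z>. C \<subseteq> S}" using N(2) by blast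
      qed
    qed blast
    moreover have "\<Union> {C \<in> \<Z>. C \<subseteq> S} \<in> sets ?P"
    proof (rule sets.countable_Union)
      show "countable {C \<in> \<Z>. C \<subseteq> S}"
        by (rule countable_subset[OF _ \<open>countable \<Z>\<close>]) blast
    next
      show "{C \<in> \<Z>. C \<subseteq> S} \<subseteq> sets ?P"
        using Z_sets unfolding \<Z>_def by blast
    qed
    ultimately show ?thesis by simp
  qed
  then have "sigma_sets (space ?P) {S. openin InHy_prod_topology S} \<subseteq> sets ?P"
    by (intro sets.sigma_sets_subset) auto
  then show ?thesis
    unfolding sets_borel_of topspace_InHy_prod by (simp add: space_PiM)
qed

definition hy_path :: "(nat \<Rightarrow> 'a \<Rightarrow> nat set set) \<Rightarrow> 'a \<Rightarrow> nat \<Rightarrow> nat set set" where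
  "hy_path H \<omega> = (\<lambda>n\<in>{1..}. H n \<omega>)"

lemma hy_path_apply: "1 \<le> n \<Longrightarrow> hy_path H \<omega> n = H n \<omega>"
  by (simp add: hy_path_def)

lemma measurable_hy_path:
  assumes "\<And>n. 1 \<le> n \<Longrightarrow> H n \<in> M \<rightarrow>\<^sub>M count_space (InHy n)"
  shows "hy_path H \<in> M \<rightarrow>\<^sub>M borel_of InHy_prod_topology"
proof -
  let ?P = "\<Pi>\<^sub>M n\<in>{1..}. count_space (InHy n)"
  have p: "hy_path H \<in> M \<rightarrow>\<^sub>M ?P"
    unfolding hy_path_def[abs_def] using assms by (intro measurable_restrict) auto
  show ?thesis
  proof (rule measurableI)
    fix \<omega> assume "\<omega> \<in> space M"
    then show "hy_path H \<omega> \<in> space (borel_of InHy_prod_topology)"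
      using measurable_space[OF p] by (simp add: space_PiM space_borel_of topspace_InHy_prod)
  next
    fix A assume "A \<in> sets (borel_of InHy_prod_topology)"
    then show "hy_path H -` A \<inter> space M \<in> sets M"
      using sets_prod_borel_subset by (intro measurable_sets[OF p]) blast
  qed
qed

lemma hy_law_eq: "hy_law M H = restrict_space (distr M (borel_of InHy_prod_topology) (hy_path H)) InHyN"
  by (simp add: hy_law_def hy_path_def[abs_def])

text \<open>The law of a process is defined by restriction of a Borel measure on the product; the trace of the Borel
sets of the product on \<open>InHyN\<close> is generated by the trace of the topology.\<close>

lemma sets_hy_law: "sets (hy_law M H) = sets hy_borel"
proof -
  have "sets (hy_law M H) = (\<inter>) InHyN ` sets (borel_of InHy_prod_topology)"
    by (simp add: hy_law_eq sets_restrict_space)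
  also have "\<dots> = sigma_sets InHyN ((\<inter>) InHyN ` {S. openin InHy_prod_topology S})"
    unfolding sets_borel_of
    by (rule sigma_sets_Int[OF _ InHyN_subset_prod[folded topspace_InHy_prod]])
       (use InHyN_in_prod_borel in \<open>simp add: sets_borel_of\<close>)
  also have "(\<inter>) InHyN ` {S. openin InHy_prod_topology S} = {S. openin InHyN_topology S}"
    unfolding InHyN_topology_def openin_subtopology by (auto simp: image_iff Int_commute)
  finally show ?thesis by (simp add: sets_borel_of topspace_InHyN)
qed

lemma space_hy_law: "space (hy_law M H) = InHyN"
  using sets_eq_imp_space_eq[OF sets_hy_law[of M H]] by (simp add: space_hy_borel)

lemma emeasure_hy_law:
  assumes "\<And>n. 1 \<le> n \<Longrightarrow> H n \<in> M \<rightarrow>\<^sub>M count_space (InHy n)" "E \<in> sets hy_borel"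
  shows "emeasure (hy_law M H) E = emeasure M {\<omega> \<in> space M. hy_path H \<omega> \<in> E}"
    and "{\<omega> \<in> space M. hy_path H \<omega> \<in> E} \<in> sets M"
proof -
  have E: "E \<in> sets (hy_law M H)" using assms(2) by (simp add: sets_hy_law)
  have E': "E \<subseteq> InHyN" using assms(2) sets.sets_into_space[of E hy_borel] by (simp add: space_hy_borel)
  have E'': "E \<in> sets (borel_of InHy_prod_topology)"
    using E InHyN_in_prod_borel unfolding hy_law_eq by (subst (asm) sets_restrict_space_iff) auto
  have "emeasure (hy_law M H) E = emeasure (distr M (borel_of InHy_prod_topology) (hy_path H)) E"
    unfolding hy_law_eq using InHyN_in_prod_borel E' by (intro emeasure_restrict_space) auto
  also have "\<dots> = emeasure M (hy_path H -` E \<inter> space M)"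
    by (rule emeasure_distr[OF measurable_hy_path E'']) (rule assms(1))
  also have "hy_path H -` E \<inter> space M = {\<omega> \<in> space M. hy_path H \<omega> \<in> E}" by auto
  finally show "emeasure (hy_law M H) E = emeasure M {\<omega> \<in> space M. hy_path H \<omega> \<in> E}" .
  have "hy_path H -` E \<inter> space M \<in> sets M"
    by (rule measurable_sets[OF measurable_hy_path E'']) (rule assms(1))
  also have "hy_path H -` E \<inter> space M = {\<omega> \<in> space M. hy_path H \<omega> \<in> E}" by auto
  finally show "{\<omega> \<in> space M. hy_path H \<omega> \<in> E} \<in> sets M" .
qed

lemma law_eqI:
  assumes "prob_space P" "prob_space Q" "sets P = sets hy_borel" "sets Q = sets hy_borel"
    and eq: "\<And>n G. 1 \<le> n \<Longrightarrow> G \<in> InHy n \<Longrightarrow> measure P (cyl n G) = measure Q (cyl n G)"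
  shows "P = Q"
proof -
  interpret P: prob_space P by fact
  interpret Q: prob_space Q by fact
  show ?thesis
  proof (rule measure_eqI_generator_eq_countable[OF Int_stable_cylinders cylinders_Pow])
    show "emeasure P X = emeasure Q X" if "X \<in> cylinders" for X
      using that eq by (auto simp: cylinders_def P.emeasure_eq_measure Q.emeasure_eq_measure)
    show "sets P = sigma_sets InHyN cylinders" "sets Q = sigma_sets InHyN cylinders"
      using assms(3,4) by (simp_all add: sets_hy_borel)
    show "cyl 1 ` InHy 1 \<subseteq> cylinders" unfolding cylinders_def by auto
    show "\<Union> (cyl 1 ` InHy 1) = InHyN"
      using InHyN_E(1)[of _ 1] unfolding cyl_def by auto
    show "countable (cyl 1 ` InHy 1)" by (intro countable_image countable_finite finite_InHy)
    show "emeasure P a \<noteq> \<infinity>" for a by simp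
  qed
qed

lemma level_set_in_sets:
  assumes "sets P = sets hy_borel" "1 \<le> n"
  shows "{h \<in> InHyN. Q (h n)} \<in> sets P"
proof -
  have "{h \<in> InHyN. Q (h n)} = (\<Union>G\<in>{G \<in> InHy n. Q G}. cyl n G)"
    using InHyN_E(1)[OF _ assms(2)] unfolding cyl_def by blast
  also have "\<dots> \<in> sets hy_borel"
    unfolding sets_borel_of using assms(2)
    by (intro sigma_sets_UNION[OF countable_finite] sigma_sets.Basic)
       (auto simp: finite_InHy openin_cyl intro!: sigma_sets.Basic)
  finally show ?thesis by (simp add: assms(1))
qed

locale consistent_hy = prob_space M for M :: "'a measure" +
  fixes H :: "nat \<Rightarrow> 'a \<Rightarrow> nat set set"
  assumes meas: "\<And>n. 1 \<le> n \<Longrightarrow> H n \<in> M \<rightarrow>\<^sub>M count_space (InHy n)"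
    and consistent: "\<And>n. 1 \<le> n \<Longrightarrow> AE \<omega> in M. H n \<omega> = restrict_hy n (H (Suc n) \<omega>)"
begin

lemma AE_hy_path_InHyN: "AE \<omega> in M. hy_path H \<omega> \<in> InHyN"
proof -
  have "AE \<omega> in M. \<forall>n\<in>{1..}. H n \<omega> = restrict_hy n (H (Suc n) \<omega>)"
    using consistent by (subst AE_ball_countable) auto
  then show ?thesis
  proof (rule AE_mp, intro AE_I2 impI)
    fix \<omega> assume \<omega>: "\<omega> \<in> space M" and c: "\<forall>n\<in>{1..}. H n \<omega> = restrict_hy n (H (Suc n) \<omega>)"
    have "hy_path H \<omega> \<in> (\<Pi>\<^sub>E n\<in>{1..}. InHy n)"
      unfolding hy_path_def using measurable_space[OF meas \<omega>] by (intro restrict_PiE_iff[THEN iffD2]) auto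
    moreover have "\<forall>n\<in>{1..}. hy_path H \<omega> n = restrict_hy n (hy_path H \<omega> (Suc n))"
    proof
      fix n :: nat assume "n \<in> {1..}"
      then have "n \<in> {1..}" "1 \<le> n" "1 \<le> Suc n" by simp_all
      then show "hy_path H \<omega> n = restrict_hy n (hy_path H \<omega> (Suc n))"
        using c by (simp only: hy_path_apply)
    qed
    ultimately show "hy_path H \<omega> \<in> InHyN" unfolding InHyN_def by (intro CollectI conjI)
  qed
qed

lemma prob_space_hy_law: "prob_space (hy_law M H)"
proof
  have top: "InHyN \<in> sets hy_borel" by (metis sets.top space_hy_borel)
  have "{\<omega> \<in> space M. hy_path H \<omega> \<in> InHyN} \<in> sets M"
    by (rule emeasure_hy_law(2)[OF meas top])
  then have "emeasure M {\<omega> \<in> space M. hy_path H \<omega> \<in> InHyN} = 1"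
    using AE_hy_path_InHyN by (intro emeasure_eq_1_AE) auto
  then show "emeasure (hy_law M H) (space (hy_law M H)) = 1"
    unfolding space_hy_law
    using emeasure_hy_law(1)[OF meas top] by simp
qed

lemma measure_hy_law_level:
  assumes "1 \<le> n"
  shows "measure (hy_law M H) {h \<in> InHyN. Q (h n)} = measure M {\<omega> \<in> space M. Q (H n \<omega>)}"
    and "{\<omega> \<in> space M. Q (H n \<omega>)} \<in> sets M"
proof -
  have s: "{h \<in> InHyN. Q (h n)} \<in> sets hy_borel" by (rule level_set_in_sets[OF refl assms])
  have "{\<omega> \<in> space M. Q (H n \<omega>)} = H n -` {G \<in> InHy n. Q G} \<inter> space M"
    using measurable_space[OF meas[OF assms]] by auto
  also have "\<dots> \<in> sets M" by (rule measurable_sets[OF meas[OF assms]]) auto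
  finally show m: "{\<omega> \<in> space M. Q (H n \<omega>)} \<in> sets M" .
  have "measure (hy_law M H) {h \<in> InHyN. Q (h n)} = measure M {\<omega> \<in> space M. hy_path H \<omega> \<in> {h \<in> InHyN. Q (h n)}}"
    by (simp add: measure_def emeasure_hy_law(1)[OF meas s])
  also have "\<dots> = measure M {\<omega> \<in> space M. Q (H n \<omega>)}"
  proof (rule finite_measure_eq_AE[OF _ emeasure_hy_law(2)[OF meas s] m])
    show "AE \<omega> in M. (\<omega> \<in> {\<omega> \<in> space M. hy_path H \<omega> \<in> {h \<in> InHyN. Q (h n)}}) = (\<omega> \<in> {\<omega> \<in> space M. Q (H n \<omega>)})"
      using AE_hy_path_InHyN by eventually_elim (auto simp: hy_path_apply[OF assms])
  qed
  finally show "measure (hy_law M H) {h \<in> InHyN. Q (h n)} = measure M {\<omega> \<in> space M. Q (H n \<omega>)}" .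
qed

end

lemma exch_imp_consistent: "exch_int_hypergraph M H \<Longrightarrow> consistent_hy M H"
  unfolding exch_int_hypergraph_def consistent_hy_def consistent_hy_axioms_def by simp

lemma consistent_coords:
  assumes "prob_space P" "sets P = sets hy_borel"
  shows "consistent_hy P (\<lambda>n h. h n)" "hy_law P (\<lambda>n h. h n) = P"
proof -
  have sp: "space P = InHyN" using sets_eq_imp_space_eq[OF assms(2)] by (simp add: space_hy_borel)
  show c: "consistent_hy P (\<lambda>n h. h n)"
    unfolding consistent_hy_def consistent_hy_axioms_def
  proof (intro conjI allI impI)
    show "prob_space P" by fact
    fix n :: nat assume n: "1 \<le> n"
    show "(\<lambda>h. h n) \<in> P \<rightarrow>\<^sub>M count_space (InHy n)"
    proof (rule measurableI)
      fix A
      have "(\<lambda>h. h n) -` A \<inter> space P = {h \<in> InHyN. h n \<in> A}" by (auto simp: sp)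
      then show "(\<lambda>h. h n) -` A \<inter> space P \<in> sets P"
        using level_set_in_sets[OF assms(2) n, of "\<lambda>G. G \<in> A"] by simp
    qed (use sp InHyN_E(1)[OF _ n] in auto)
    show "AE h in P. h n = restrict_hy n (h (Suc n))"
      by (rule AE_I2) (use sp InHyN_E(2)[OF _ n] in blast)
  qed
  interpret consistent_hy P "\<lambda>n h. h n" by fact
  show "hy_law P (\<lambda>n h. h n) = P"
  proof (rule law_eqI[OF prob_space_hy_law assms(1) sets_hy_law assms(2)])
    fix n G assume "1 \<le> (n::nat)"
    then show "measure (hy_law P (\<lambda>n h. h n)) (cyl n G) = measure P (cyl n G)"
      using measure_hy_law_level(1)[of n "\<lambda>G'. G' = G"] by (simp add: sp cyl_def)
  qed
qed

text \<open>The coordinate process on \<open>InHyN\<close> has law \<open>P\<close>, which provides a process on the type of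
probability spaces that \<open>ExInHy\<close> refers to.\<close>

lemma ExInHyI:
  assumes "prob_space P" "sets P = sets hy_borel"
    and inv: "\<And>n \<pi> G. 1 \<le> n \<Longrightarrow> \<pi> permutes {1..n} \<Longrightarrow> G \<in> InHy n \<Longrightarrow>
       measure P {h \<in> InHyN. relabel_hy \<pi> (h n) = G} = measure P {h \<in> InHyN. h n = G}"
  shows "P \<in> ExInHy"
proof -
  have sp: "space P = InHyN" using sets_eq_imp_space_eq[OF assms(2)] by (simp add: space_hy_borel)
  interpret c: consistent_hy P "\<lambda>n h. h n" by (rule consistent_coords[OF assms(1,2)])
  have "exch_int_hypergraph P (\<lambda>n h. h n)"
    unfolding exch_int_hypergraph_def
  proof (intro conjI ballI allI impI)
    show "prob_space P" by fact
  next
    fix n :: nat and \<pi> assume "n \<in> {1..}" and \<pi>: "\<pi> permutes {1..n}"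
    then have n: "1 \<le> n" by simp
    have rel: "(\<lambda>h. relabel_hy \<pi> (h n)) \<in> P \<rightarrow>\<^sub>M count_space (InHy n)"
    proof (rule measurableI)
      fix h assume "h \<in> space P"
      then have hn: "h n \<in> InHy n" using InHyN_E(1)[OF _ n] by (simp add: sp)
      have "relabel_hy \<pi> (h n) = pull n (inv \<pi>) (h n)"
        by (rule relabel_hy_eq_pull[OF \<pi> InHy_subset_Pow[OF hn]])
      also have "\<dots> \<in> InHy n"
        using permutes_inv[OF \<pi>] by (intro pull_InHy[OF hn])
          (simp_all add: permutes_image permutes_inj_on)
      finally show "relabel_hy \<pi> (h n) \<in> space (count_space (InHy n))" by simp
    next
      fix A
      have "(\<lambda>h. relabel_hy \<pi> (h n)) -` A \<inter> space P = {h \<in> InHyN. relabel_hy \<pi> (h n) \<in> A}"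
        by (auto simp: sp)
      then show "(\<lambda>h. relabel_hy \<pi> (h n)) -` A \<inter> space P \<in> sets P"
        using level_set_in_sets[OF assms(2) n, of "\<lambda>G. relabel_hy \<pi> G \<in> A"] by simp
    qed
    show "distr P (count_space (InHy n)) (\<lambda>h. relabel_hy \<pi> (h n)) = distr P (count_space (InHy n)) (\<lambda>h. h n)"
    proof (rule measure_eqI_countable[of _ "InHy n"])
      fix G assume G: "G \<in> InHy n"
      have 1: "(\<lambda>h. relabel_hy \<pi> (h n)) -` {G} \<inter> space P = {h \<in> InHyN. relabel_hy \<pi> (h n) = G}"
        and 2: "(\<lambda>h. h n) -` {G} \<inter> space P = {h \<in> InHyN. h n = G}" by (auto simp: sp)
      show "emeasure (distr P (count_space (InHy n)) (\<lambda>h. relabel_hy \<pi> (h n))) {G} =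
          emeasure (distr P (count_space (InHy n)) (\<lambda>h. h n)) {G}"
        using inv[OF n \<pi> G] G
        by (simp add: emeasure_distr[OF rel] emeasure_distr[OF c.meas[OF n]] 1 2 c.emeasure_eq_measure)
    qed (auto intro: countable_finite finite_InHy)
  qed (use c.meas c.consistent in auto)
  then show ?thesis
    unfolding ExInHy_def using consistent_coords(2)[OF assms(1,2)] by (intro CollectI exI[of _ P]) (metis)
qed

text \<open>After an extension of \<open>\<iota>\<close> to a permutation of \<open>[N]\<close>, the pull-back is a relabelling at level
\<open>N\<close> followed by a restriction to \<open>[n]\<close>.\<close>

lemma exch_pull:
  assumes ex: "exch_int_hypergraph M H" and n: "1 \<le> n" "n \<le> N"
    and inj: "inj_on \<iota> {1..n}" and sub: "\<iota> ` {1..n} \<subseteq> {1..N}"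
  shows "measure (hy_law M H) {h \<in> InHyN. pull n \<iota> (h N) = G} = measure (hy_law M H) {h \<in> InHyN. h n = G}"
proof -
  interpret consistent_hy M H by (rule exch_imp_consistent[OF ex])
  have N: "1 \<le> N" using n by simp
  obtain \<kappa> where \<kappa>: "\<kappa> permutes {1..N}" "\<And>j. j \<in> {1..n} \<Longrightarrow> \<kappa> j = \<iota> j"
    using extend_injection[OF inj sub n(2)] by blast
  define \<pi> where "\<pi> = inv \<kappa>"
  have \<pi>: "\<pi> permutes {1..N}" "inv \<pi> = \<kappa>"
    using \<kappa>(1) by (simp_all add: \<pi>_def permutes_inv permutes_inv_inv)
  let ?A = "{G' \<in> InHy N. pull n id G' = G}"
  have id_sub: "id ` {1..n} \<subseteq> {1..N}" using n by auto
  have H_in: "H N \<omega> \<in> InHy N" if "\<omega> \<in> space M" for \<omega>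
    using measurable_space[OF meas[OF N] that] by simp
  have rel_eq: "relabel_hy \<pi> (H N \<omega>) = pull N \<kappa> (H N \<omega>)" if "\<omega> \<in> space M" for \<omega>
    using relabel_hy_eq_pull[OF \<pi>(1) InHy_subset_Pow[OF H_in[OF that]]] by (simp add: \<pi>(2))
  have rel_in: "relabel_hy \<pi> (H N \<omega>) \<in> InHy N" if "\<omega> \<in> space M" for \<omega>
    unfolding rel_eq[OF that]
    by (rule pull_InHy[OF H_in[OF that]]) (rule permutes_inj_on[OF \<kappa>(1)], rule equalityD1[OF permutes_image[OF \<kappa>(1)]])
  have pull_eq: "pull n \<iota> (H N \<omega>) = pull n id (relabel_hy \<pi> (H N \<omega>))" if "\<omega> \<in> space M" for \<omega>
    unfolding rel_eq[OF that] pull_pull[OF id_sub] by (rule pull_cong) (simp add: \<kappa>(2))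
  have rel_meas: "(\<lambda>\<omega>. relabel_hy \<pi> (H N \<omega>)) \<in> M \<rightarrow>\<^sub>M count_space (InHy N)"
  proof (rule measurableI)
    fix A
    have "(\<lambda>\<omega>. relabel_hy \<pi> (H N \<omega>)) -` A \<inter> space M = {\<omega> \<in> space M. relabel_hy \<pi> (H N \<omega>) \<in> A}" by auto
    then show "(\<lambda>\<omega>. relabel_hy \<pi> (H N \<omega>)) -` A \<inter> space M \<in> sets M"
      using measure_hy_law_level(2)[OF N, of "\<lambda>G. relabel_hy \<pi> G \<in> A"] by simp
  qed (use rel_in in simp)
  have "measure (hy_law M H) {h \<in> InHyN. pull n \<iota> (h N) = G} = measure M {\<omega> \<in> space M. pull n \<iota> (H N \<omega>) = G}"
    by (rule measure_hy_law_level(1)[OF N])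
  also have "{\<omega> \<in> space M. pull n \<iota> (H N \<omega>) = G} = (\<lambda>\<omega>. relabel_hy \<pi> (H N \<omega>)) -` ?A \<inter> space M"
    using pull_eq rel_in by auto
  also have "measure M \<dots> = measure (distr M (count_space (InHy N)) (\<lambda>\<omega>. relabel_hy \<pi> (H N \<omega>))) ?A"
    by (rule measure_distr[OF rel_meas, symmetric]) auto
  also have "\<dots> = measure (distr M (count_space (InHy N)) (H N)) ?A"
    using ex \<pi>(1) N unfolding exch_int_hypergraph_def by auto
  also have "\<dots> = measure M (H N -` ?A \<inter> space M)"
    by (rule measure_distr[OF meas[OF N]]) auto
  also have "H N -` ?A \<inter> space M = {\<omega> \<in> space M. pull n id (H N \<omega>) = G}"
    using H_in by auto
  also have "measure M \<dots> = measure (hy_law M H) {h \<in> InHyN. pull n id (h N) = G}"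
    by (rule measure_hy_law_level(1)[OF N, symmetric])
  also have "{h \<in> InHyN. pull n id (h N) = G} = {h \<in> InHyN. h n = G}"
    using InHyN_restrict[OF _ n] by auto
  finally show ?thesis .
qed

lemma hy_law_in_ExInHy:
  assumes ex: "exch_int_hypergraph M H"
  shows "hy_law M H \<in> ExInHy"
proof -
  interpret consistent_hy M H by (rule exch_imp_consistent[OF ex])
  show ?thesis
  proof (rule ExInHyI[OF prob_space_hy_law sets_hy_law])
    fix n :: nat and \<pi> G assume n: "1 \<le> n" and \<pi>: "\<pi> permutes {1..n}"
    have "{h \<in> InHyN. relabel_hy \<pi> (h n) = G} = {h \<in> InHyN. pull n (inv \<pi>) (h n) = G}"
      using relabel_hy_eq_pull[OF \<pi> InHy_subset_Pow] InHyN_E(1)[OF _ n] by auto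
    then show "measure (hy_law M H) {h \<in> InHyN. relabel_hy \<pi> (h n) = G} = measure (hy_law M H) {h \<in> InHyN. h n = G}"
      using exch_pull[OF ex n order_refl, of "inv \<pi>" G] permutes_inv[OF \<pi>]
      by (simp add: permutes_image permutes_inj_on)
  qed
qed

lemma ExInHyD:
  assumes "P \<in> ExInHy"
  shows "prob_space P" "sets P = sets hy_borel"
    and "\<And>n N \<iota> G. 1 \<le> n \<Longrightarrow> n \<le> N \<Longrightarrow> inj_on \<iota> {1..n} \<Longrightarrow> \<iota> ` {1..n} \<subseteq> {1..N} \<Longrightarrow>
      measure P {h \<in> InHyN. pull n \<iota> (h N) = G} = measure P {h \<in> InHyN. h n = G}"
proof -
  obtain M :: "(nat \<Rightarrow> nat set set) measure" and H where
    P: "P = hy_law M H" and ex: "exch_int_hypergraph M H"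
    using assms unfolding ExInHy_def by auto
  interpret consistent_hy M H by (rule exch_imp_consistent[OF ex])
  show "prob_space P" "sets P = sets hy_borel"
    unfolding P by (rule prob_space_hy_law, rule sets_hy_law)
  show "\<And>n N \<iota> G. 1 \<le> n \<Longrightarrow> n \<le> N \<Longrightarrow> inj_on \<iota> {1..n} \<Longrightarrow> \<iota> ` {1..n} \<subseteq> {1..N} \<Longrightarrow>
      measure P {h \<in> InHyN. pull n \<iota> (h N) = G} = measure P {h \<in> InHyN. h n = G}"
    unfolding P by (rule exch_pull[OF ex])
qed

section \<open>Boxes cut out by the sample points\<close>

text \<open>The points \<open>(x, y)\<close> whose interval has the sample points with index in \<open>L\<close> on its left, those with
index in \<open>E\<close> inside and those with index in \<open>R\<close> on its right, where the inequalities are strict for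
the indices in \<open>A\<close>. Sampling leads to \<open>A = E\<close>. The region is closed for \<open>A = {}\<close> and open if \<open>A\<close>
contains all indices; the parameter allows passing from one to the other one index at a time.\<close>

definition constraint_region :: "nat set \<Rightarrow> nat set \<Rightarrow> nat set \<Rightarrow> nat set \<Rightarrow> (nat \<Rightarrow> real) \<Rightarrow> (real \<times> real) set" where
  "constraint_region L E R A u = {(x, y).
     (\<forall>j\<in>L. if j \<in> A then u j < x else u j \<le> x) \<and>
     (\<forall>j\<in>R. if j \<in> A then y < u j else y \<le> u j) \<and>
     (\<forall>j\<in>E. if j \<in> A then x < u j \<and> u j < y else x \<le> u j \<and> u j \<le> y)}"

definition hits :: "(real \<times> real) set \<Rightarrow> nat set \<Rightarrow> nat set \<Rightarrow> nat set \<Rightarrow> nat set \<Rightarrow> (nat \<Rightarrow> real) \<Rightarrow> bool" where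
  "hits K L E R A u \<longleftrightarrow> constraint_region L E R A u \<inter> K \<noteq> {}"

lemma hits_iff: "hits K L E R A u \<longleftrightarrow> (\<exists>x y. (x, y) \<in> K \<and>
     (\<forall>j\<in>L. if j \<in> A then u j < x else u j \<le> x) \<and>
     (\<forall>j\<in>R. if j \<in> A then y < u j else y \<le> u j) \<and>
     (\<forall>j\<in>E. if j \<in> A then x < u j \<and> u j < y else x \<le> u j \<and> u j \<le> y))"
  unfolding hits_def constraint_region_def by blast

lemma constraint_region_antimono: "A \<subseteq> B \<Longrightarrow> constraint_region L E R B u \<subseteq> constraint_region L E R A u"
  unfolding constraint_region_def by (auto split: if_splits)

lemma hits_antimono: "A \<subseteq> B \<Longrightarrow> hits K L E R B u \<Longrightarrow> hits K L E R A u"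
  using constraint_region_antimono[of A B L E R u] unfolding hits_def by blast

lemma hits_cong: "(\<And>j. j \<in> L \<union> E \<union> R \<Longrightarrow> u j = v j) \<Longrightarrow> hits K L E R A u = hits K L E R A v"
  unfolding hits_iff by simp

lemma open_constraint_region:
  assumes "finite L" "finite E" "finite R"
  shows "open (constraint_region L E R (L \<union> E \<union> R) u)"
proof -
  have "constraint_region L E R (L \<union> E \<union> R) u =
      (\<Inter>j\<in>L. {p. u j < fst p}) \<inter> (\<Inter>j\<in>R. {p. snd p < u j}) \<inter> (\<Inter>j\<in>E. {p. fst p < u j} \<inter> {p. u j < snd p})"
    unfolding constraint_region_def by auto
  also have "open \<dots>"
    using assms by (intro open_Int open_INT ballI open_Collect_less continuous_intros)
  finally show ?thesis .
qed

lemma closed_constraint_region: "closed (constraint_region L E R {} u)"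
proof -
  have "constraint_region L E R {} u =
      (\<Inter>j\<in>L. {p. u j \<le> fst p}) \<inter> (\<Inter>j\<in>R. {p. snd p \<le> u j}) \<inter> (\<Inter>j\<in>E. {p. fst p \<le> u j} \<inter> {p. u j \<le> snd p})"
    unfolding constraint_region_def by auto
  also have "closed \<dots>"
    by (intro closed_Int closed_INT ballI closed_Collect_le continuous_intros)
  finally show ?thesis .
qed

text \<open>The points of \<open>K\<close> that witness membership along a convergent sequence have a convergent subsequence,
and weak inequalities survive the limit.\<close>

lemma closed_hits_margin:
  fixes K :: "(real \<times> real) set" and d :: "nat \<Rightarrow> real"
  assumes K: "compact K"
  shows "closed {u :: nat \<Rightarrow> real. \<exists>p\<in>K. (\<forall>j\<in>L. u j + d j \<le> fst p) \<and> (\<forall>j\<in>R. snd p + d j \<le> u j) \<and>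
     (\<forall>j\<in>E. fst p + d j \<le> u j \<and> u j + d j \<le> snd p)}" (is "closed ?S")
  unfolding closed_sequential_limits
proof (intro allI impI)
  fix v :: "nat \<Rightarrow> nat \<Rightarrow> real" and u assume "(\<forall>k. v k \<in> ?S) \<and> v \<longlonglongrightarrow> u"
  then have v: "\<forall>k. \<exists>p\<in>K. (\<forall>j\<in>L. v k j + d j \<le> fst p) \<and> (\<forall>j\<in>R. snd p + d j \<le> v k j) \<and>
     (\<forall>j\<in>E. fst p + d j \<le> v k j \<and> v k j + d j \<le> snd p)" and lim: "v \<longlonglongrightarrow> u" by auto
  obtain p where p: "\<And>k. p k \<in> K" "\<And>k j. j \<in> L \<Longrightarrow> v k j + d j \<le> fst (p k)"
     "\<And>k j. j \<in> R \<Longrightarrow> snd (p k) + d j \<le> v k j"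
     "\<And>k j. j \<in> E \<Longrightarrow> fst (p k) + d j \<le> v k j \<and> v k j + d j \<le> snd (p k)"
    using v by metis
  obtain q r where q: "q \<in> K" "strict_mono (r :: nat \<Rightarrow> nat)" "(p \<circ> r) \<longlonglongrightarrow> q"
    using K p(1) unfolding compact_def by metis
  have vj: "(\<lambda>k. v (r k) j) \<longlonglongrightarrow> u j" for j
  proof -
    have "continuous_on UNIV (\<lambda>x :: nat \<Rightarrow> real. x j)" by (rule continuous_on_product_coordinates)
    then have "isCont (\<lambda>x :: nat \<Rightarrow> real. x j) u"
      using continuous_on_eq_continuous_at[OF open_UNIV] by blast
    then have "(\<lambda>k. v k j) \<longlonglongrightarrow> u j" using lim by (rule isCont_tendsto_compose)
    then show ?thesis using LIMSEQ_subseq_LIMSEQ[OF _ q(2)] by (simp add: o_def)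
  qed
  have pf: "(\<lambda>k. fst (p (r k))) \<longlonglongrightarrow> fst q" and ps: "(\<lambda>k. snd (p (r k))) \<longlonglongrightarrow> snd q"
    using tendsto_fst[OF q(3)] tendsto_snd[OF q(3)] by (simp_all add: o_def)
  have "u j + d j \<le> fst q" if "j \<in> L" for j
    by (rule LIMSEQ_le[OF tendsto_add[OF vj tendsto_const] pf]) (use p(2) that in auto)
  moreover have "snd q + d j \<le> u j" if "j \<in> R" for j
    by (rule LIMSEQ_le[OF tendsto_add[OF ps tendsto_const] vj]) (use p(3) that in auto)
  moreover have "fst q + d j \<le> u j" if "j \<in> E" for j
    by (rule LIMSEQ_le[OF tendsto_add[OF pf tendsto_const] vj]) (use p(4) that in auto)
  moreover have "u j + d j \<le> snd q" if "j \<in> E" for j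
    by (rule LIMSEQ_le[OF tendsto_add[OF vj tendsto_const] ps]) (use p(4) that in auto)
  ultimately show "u \<in> ?S" using q(1) by blast
qed

text \<open>Finitely many strict inequalities hold iff they hold with a common margin \<open>1 / (m + 1)\<close>, so the set
is a countable union of closed sets.\<close>

lemma borel_hits:
  assumes K: "compact K" and fin: "finite L" "finite E" "finite R"
  shows "{u. hits K L E R A u} \<in> sets borel"
proof -
  define d where "d m j = (if j \<in> A then inverse (real (Suc m)) else 0)" for m j
  define S where "S m = {u. \<exists>p\<in>K. (\<forall>j\<in>L. u j + d m j \<le> fst p) \<and> (\<forall>j\<in>R. snd p + d m j \<le> u j) \<and>
     (\<forall>j\<in>E. fst p + d m j \<le> u j \<and> u j + d m j \<le> snd p)}" for m
  have "{u. hits K L E R A u} = (\<Union>m. S m)"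
  proof (intro equalityI subsetI)
    fix u assume "u \<in> {u. hits K L E R A u}"
    then obtain x y where xy: "(x, y) \<in> K" "\<forall>j\<in>L. if j \<in> A then u j < x else u j \<le> x"
      "\<forall>j\<in>R. if j \<in> A then y < u j else y \<le> u j"
      "\<forall>j\<in>E. if j \<in> A then x < u j \<and> u j < y else x \<le> u j \<and> u j \<le> y"
      unfolding hits_iff by blast
    have small: "\<forall>\<^sub>F m in sequentially. a + d m j \<le> b" if "if j \<in> A then a < b else a \<le> b" for a b :: real and j
    proof (cases "j \<in> A")
      case True
      have "\<forall>\<^sub>F m in sequentially. inverse (real (Suc m)) < b - a"
        by (rule order_tendstoD(2)[OF LIMSEQ_inverse_real_of_nat]) (use that True in simp)
      then show ?thesis by eventually_elim (simp add: d_def True)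
    qed (use that in \<open>simp add: d_def\<close>)
    have "\<forall>\<^sub>F m in sequentially. \<forall>j\<in>L. u j + d m j \<le> x"
      using xy(2) by (intro eventually_ball_finite fin ballI small) blast
    moreover have "\<forall>\<^sub>F m in sequentially. \<forall>j\<in>R. y + d m j \<le> u j"
      using xy(3) by (intro eventually_ball_finite fin ballI small) blast
    moreover have "\<forall>\<^sub>F m in sequentially. \<forall>j\<in>E. x + d m j \<le> u j"
      using xy(4) by (intro eventually_ball_finite fin ballI small) (metis (full_types))
    moreover have "\<forall>\<^sub>F m in sequentially. \<forall>j\<in>E. u j + d m j \<le> y"
      using xy(4) by (intro eventually_ball_finite fin ballI small) (metis (full_types))
    ultimately have "\<forall>\<^sub>F m in sequentially. u \<in> S m"
    proof eventually_elim
      case (elim m)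
      then show "u \<in> S m"
        unfolding S_def using xy(1) by (intro CollectI bexI[of _ "(x, y)"]) auto
    qed
    then show "u \<in> (\<Union>m. S m)" unfolding eventually_sequentially by blast
  next
    fix u assume "u \<in> (\<Union>m. S m)"
    then obtain m x y where m: "(x, y) \<in> K" "\<forall>j\<in>L. u j + d m j \<le> x" "\<forall>j\<in>R. y + d m j \<le> u j"
      "\<forall>j\<in>E. x + d m j \<le> u j \<and> u j + d m j \<le> y" unfolding S_def by force
    have less: "if j \<in> A then a < b else a \<le> b" if "a + d m j \<le> b" for a b :: real and j
    proof (cases "j \<in> A")
      case True
      have "inverse (real (Suc m)) > 0" by simp
      then show ?thesis using that True by (simp only: d_def if_True)
    qed (use that in \<open>simp add: d_def\<close>)
    have "hits K L E R A u"
      unfolding hits_iff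
    proof (intro exI conjI ballI)
      show "(x, y) \<in> K" by fact
      fix j
      show "if j \<in> A then u j < x else u j \<le> x" if "j \<in> L" using less m(2) that by blast
      show "if j \<in> A then y < u j else y \<le> u j" if "j \<in> R" using less m(3) that by blast
      show "if j \<in> A then x < u j \<and> u j < y else x \<le> u j \<and> u j \<le> y" if "j \<in> E"
        using less[of x j "u j"] less[of "u j" j y] m(4) that by (auto split: if_splits)
    qed
    then show "u \<in> {u. hits K L E R A u}" by simp
  qed
  moreover have "S m \<in> sets borel" for m
    unfolding S_def by (rule borel_closed[OF closed_hits_margin[OF K]])
  ultimately show ?thesis by simp
qed

lemma measurable_hits:
  assumes K: "compact K" and fin: "finite L" "finite E" "finite R"
    and U: "\<And>j. j \<in> L \<union> E \<union> R \<Longrightarrow> (\<lambda>\<omega>. U j \<omega>) \<in> borel_measurable M"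
  shows "{\<omega> \<in> space M. hits K L E R A (\<lambda>j. U j \<omega>)} \<in> sets M"
proof -
  let ?V = "\<lambda>\<omega> j. if j \<in> L \<union> E \<union> R then U j \<omega> else 0"
  have "(\<lambda>\<omega>. ?V \<omega> j) \<in> borel_measurable M" for j
    using U by (cases "j \<in> L \<union> E \<union> R") simp_all
  then have V: "?V \<in> borel_measurable M" by (rule measurable_coordinatewise_then_product)
  have "{\<omega> \<in> space M. hits K L E R A (\<lambda>j. U j \<omega>)} = ?V -` {u. hits K L E R A u} \<inter> space M"
  proof -
    have "hits K L E R A (\<lambda>j. U j \<omega>) = hits K L E R A (?V \<omega>)" for \<omega>
      by (rule hits_cong) simp
    then show ?thesis by blast
  qed
  also have "\<dots> \<in> sets M" by (rule measurable_sets[OF V borel_hits[OF K fin]])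
  finally show ?thesis .
qed

text \<open>An index outside the edge has its sample point weakly to the left or weakly to the right of the
open interval; \<open>L\<close> collects the former.\<close>

lemma sample_hy_iff_hits:
  "e \<in> sample_hy K n u \<longleftrightarrow> e = {} \<or> (\<exists>j\<in>{1..n}. e = {j}) \<or>
     (e \<subseteq> {1..n} \<and> (\<exists>L. L \<subseteq> {1..n} - e \<and> hits K L e ({1..n} - e - L) e u))"
proof -
  have "(\<exists>x y. e = {j \<in> {1..n}. x < u j \<and> u j < y} \<and> (x, y) \<in> K) \<longleftrightarrow>
     (e \<subseteq> {1..n} \<and> (\<exists>L. L \<subseteq> {1..n} - e \<and> hits K L e ({1..n} - e - L) e u))" (is "?P \<longleftrightarrow> ?Q")
  proof
    assume ?P
    then obtain x y where e: "e = {j \<in> {1..n}. x < u j \<and> u j < y}" and "(x, y) \<in> K" by blast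
    then have "hits K {j \<in> {1..n} - e. u j \<le> x} e ({1..n} - e - {j \<in> {1..n} - e. u j \<le> x}) e u"
      unfolding hits_iff by (intro exI[of _ x] exI[of _ y]) auto
    moreover have "e \<subseteq> {1..n}" "{j \<in> {1..n} - e. u j \<le> x} \<subseteq> {1..n} - e" using e by auto
    ultimately show ?Q by blast
  next
    assume ?Q
    then obtain L where e: "e \<subseteq> {1..n}" and L: "L \<subseteq> {1..n} - e" and
      h: "hits K L e ({1..n} - e - L) e u" by blast
    obtain x y where xy: "(x, y) \<in> K" "\<forall>j\<in>L. if j \<in> e then u j < x else u j \<le> x"
      "\<forall>j\<in>{1..n} - e - L. if j \<in> e then y < u j else y \<le> u j"
      "\<forall>j\<in>e. if j \<in> e then x < u j \<and> u j < y else x \<le> u j \<and> u j \<le> y"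
      using h unfolding hits_iff by blast
    have "j \<in> e \<longleftrightarrow> x < u j \<and> u j < y" if "j \<in> {1..n}" for j
    proof
      assume "j \<in> e" then show "x < u j \<and> u j < y" using bspec[OF xy(4), of j] by simp
    next
      assume *: "x < u j \<and> u j < y"
      show "j \<in> e"
      proof (rule ccontr)
        assume j: "j \<notin> e"
        then have "u j \<le> x \<or> y \<le> u j"
          using bspec[OF xy(2), of j] bspec[OF xy(3), of j] that by (cases "j \<in> L") auto
        then show False using * by linarith
      qed
    qed
    then have "e = {j \<in> {1..n}. x < u j \<and> u j < y}" using e by blast
    then show ?P using xy(1) by blast
  qed
  then show ?thesis unfolding sample_hy_def by blast
qed

lemma measurable_sample_hy:
  assumes K: "compact K" and U: "\<And>j. j \<in> {1..n} \<Longrightarrow> (\<lambda>\<omega>. U j \<omega>) \<in> borel_measurable M"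
  shows "(\<lambda>\<omega>. sample_hy K n (\<lambda>j. U j \<omega>)) \<in> M \<rightarrow>\<^sub>M count_space (InHy n)"
proof -
  have mem: "{\<omega> \<in> space M. e \<in> sample_hy K n (\<lambda>j. U j \<omega>)} \<in> sets M" for e
  proof (cases "e = {} \<or> (\<exists>j\<in>{1..n}. e = {j})")
    case True
    then have "{\<omega> \<in> space M. e \<in> sample_hy K n (\<lambda>j. U j \<omega>)} = space M"
      unfolding sample_hy_iff_hits by blast
    then show ?thesis by simp
  next
    case False
    show ?thesis
    proof (cases "e \<subseteq> {1..n}")
      case sub: True
      then have "{\<omega> \<in> space M. e \<in> sample_hy K n (\<lambda>j. U j \<omega>)} =
        (\<Union>L\<in>Pow ({1..n} - e). {\<omega> \<in> space M. hits K L e ({1..n} - e - L) e (\<lambda>j. U j \<omega>)})"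
        unfolding sample_hy_iff_hits using False by blast
      also have "\<dots> \<in> sets M"
      proof (rule sets.finite_UN)
        fix L assume L: "L \<in> Pow ({1..n} - e)"
        then have "L \<union> e \<union> ({1..n} - e - L) \<subseteq> {1..n}" using sub by blast
        then show "{\<omega> \<in> space M. hits K L e ({1..n} - e - L) e (\<lambda>j. U j \<omega>)} \<in> sets M"
          using L sub by (intro measurable_hits[OF K] U) (auto intro: finite_subset)
      qed simp
      finally show ?thesis .
    next
      case sub: False
      then have eq: "{\<omega> \<in> space M. e \<in> sample_hy K n (\<lambda>j. U j \<omega>)} = {}"
        unfolding sample_hy_iff_hits using False by blast
      show ?thesis unfolding eq by (rule sets.empty_sets)
    qed
  qed
  have "(\<lambda>\<omega>. sample_hy K n (\<lambda>j. U j \<omega>)) -` {G} \<inter> space M \<in> sets M" if G: "G \<in> InHy n" for G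
  proof -
    have sub: "sample_hy K n u \<subseteq> Pow {1..n}" for u by (rule InHy_subset_Pow[OF sample_hy_InHy])
    have "(\<lambda>\<omega>. sample_hy K n (\<lambda>j. U j \<omega>)) -` {G} \<inter> space M =
      {\<omega> \<in> space M. \<forall>e\<in>Pow {1..n}. e \<in> sample_hy K n (\<lambda>j. U j \<omega>) \<longleftrightarrow> e \<in> G}"
    proof -
      have "sample_hy K n u = G \<longleftrightarrow> (\<forall>e\<in>Pow {1..n}. e \<in> sample_hy K n u \<longleftrightarrow> e \<in> G)" for u
        using sub[of u] InHy_subset_Pow[OF G] by blast
      then show ?thesis by (simp add: vimage_def Int_def conj_commute)
    qed
    also have "\<dots> \<in> sets M"
    proof (rule sets.sets_Collect_finite_All)
      show "{\<omega> \<in> space M. (e \<in> sample_hy K n (\<lambda>j. U j \<omega>)) = (e \<in> G)} \<in> sets M" for e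
      proof (cases "e \<in> G")
        case True then show ?thesis using mem[of e] by simp
      next
        case False then show ?thesis using sets.sets_Collect_neg[OF mem[of e]] by simp
      qed
    qed simp
    finally show ?thesis .
  qed
  then show ?thesis
    by (subst measurable_count_space_eq2[OF finite_InHy]) (simp add: sample_hy_InHy)
qed

abbreviation unif :: "real measure" where
  "unif \<equiv> uniform_measure lborel {0..1}"

abbreviation unif_seq :: "(nat \<Rightarrow> real) measure" where
  "unif_seq \<equiv> \<Pi>\<^sub>M i\<in>{1..}. unif"

lemma prob_space_unif: "prob_space unif"
  by (rule prob_space_uniform_measure) simp_all

lemma prob_space_unif_seq: "prob_space unif_seq"
  by (rule prob_space_PiM) (rule prob_space_unif)

lemma measurable_coord: "i \<in> {1..} \<Longrightarrow> (\<lambda>u. u i) \<in> borel_measurable unif_seq"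
  using measurable_component_singleton[of i "{1..}" "\<lambda>_. unif"]
  by (simp cong: measurable_cong_sets)

lemma unif_countable: "countable C \<Longrightarrow> emeasure unif C = 0"
proof -
  assume C: "countable C"
  then have null: "C \<in> null_sets lborel" by (rule countable_imp_null_set_lborel)
  then have "emeasure unif C = emeasure lborel ({0..1} \<inter> C) / emeasure lborel {0..1::real}"
    by (intro emeasure_uniform_measure) auto
  moreover have "{0..1} \<inter> C \<in> null_sets lborel"
    using C by (intro countable_imp_null_set_lborel) simp
  then have "emeasure lborel ({0..1} \<inter> C) = 0" by (rule null_setsD1)
  ultimately show ?thesis by simp
qed

text \<open>By Fubini's theorem, since the uniform distribution does not charge countable sets.\<close>

lemma unif_seq_null:
  assumes i: "i \<in> {1..}" and D: "D \<in> sets unif_seq"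
    and sec: "\<And>u. countable {t. u(i := t) \<in> D}"
  shows "D \<in> null_sets unif_seq"
proof -
  let ?N = "\<Pi>\<^sub>M j\<in>{1..} - {i}. unif" and ?f = "\<lambda>(x, X). X(i := x)"
  interpret U: prob_space unif by (rule prob_space_unif)
  interpret N: prob_space ?N by (rule prob_space_PiM) (rule prob_space_unif)
  interpret UN: pair_sigma_finite unif ?N ..
  have ins: "insert i ({1..} - {i}) = {1..}" using i by blast
  have f: "?f \<in> unif \<Otimes>\<^sub>M ?N \<rightarrow>\<^sub>M unif_seq"
    using measurable_add_dim[of i "{1..} - {i}" "\<lambda>_. unif"]
    by (subst ins[symmetric]) (simp add: split_def measurable_fun_upd[of _ "{1..} - {i}"])
  have eq: "distr (unif \<Otimes>\<^sub>M ?N) unif_seq ?f = unif_seq"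
    using distr_pair_PiM_eq_PiM[of "{1..} - {i}" "\<lambda>_. unif" i, unfolded ins] prob_space_unif by blast
  have "emeasure unif_seq D = emeasure (distr (unif \<Otimes>\<^sub>M ?N) unif_seq ?f) D" by (simp only: eq)
  also have "\<dots> = emeasure (unif \<Otimes>\<^sub>M ?N) (?f -` D \<inter> space (unif \<Otimes>\<^sub>M ?N))"
    by (rule emeasure_distr[OF f D])
  also have "\<dots> = (\<integral>\<^sup>+X. emeasure unif ((\<lambda>x. (x, X)) -` (?f -` D \<inter> space (unif \<Otimes>\<^sub>M ?N))) \<partial>?N)"
    by (rule UN.emeasure_pair_measure_alt2[OF measurable_sets[OF f D]])
  also have "\<dots> = (\<integral>\<^sup>+X. 0 \<partial>?N)"
  proof (rule nn_integral_cong)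
    fix X
    have "(\<lambda>x. (x, X)) -` (?f -` D \<inter> space (unif \<Otimes>\<^sub>M ?N)) \<subseteq> {t. X(i := t) \<in> D}" by auto
    then show "emeasure unif ((\<lambda>x. (x, X)) -` (?f -` D \<inter> space (unif \<Otimes>\<^sub>M ?N))) = 0"
      by (intro unif_countable countable_subset[OF _ sec])
  qed
  finally have "emeasure unif_seq D = 0" by simp
  then show ?thesis using D by blast
qed

lemma finite_no_increasing_pair:
  fixes B :: "real set"
  assumes "\<And>s t. s \<in> B \<Longrightarrow> t \<in> B \<Longrightarrow> s < t \<Longrightarrow> False"
  shows "finite B"
proof (cases "B = {}")
  case False
  then obtain b where "b \<in> B" by blast
  then have "B \<subseteq> {b}" using assms by (metis linorder_neqE singletonI subsetI)
  then show ?thesis by (rule finite_subset) simp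
qed simp

text \<open>Fix all sample points except the one with index \<open>i\<close>, and call a value of the latter exceptional if
requiring strict inequalities for \<open>i\<close> makes a difference. For \<open>i\<close> in \<open>L\<close> or \<open>R\<close> there cannot be
two exceptional values: the point of \<open>K\<close> that witnesses the weak inequality for one of them witnesses
the strict inequality for the other. For \<open>i\<close> in \<open>E\<close>, a second index \<open>k\<close> in \<open>E\<close> pins all intervals
under consideration to the value \<open>u k\<close>, and the same argument works on either side of \<open>u k\<close>. The second index
matters: if \<open>E = {i}\<close> and \<open>K\<close> is the diagonal, every value can be exceptional.\<close>

lemma hits_section_finite:
  assumes i: "i \<notin> A" and k: "i \<in> E \<Longrightarrow> \<exists>k\<in>E. k \<noteq> i" and disj: "L \<inter> E = {}" "R \<inter> E = {}" "L \<inter> R = {}"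
  shows "finite {t. hits K L E R A (u(i := t)) \<and> \<not> hits K L E R (insert i A) (u(i := t))}" (is "finite ?B")
proof -
  \<comment> \<open>\<open>C\<close> below consists of the points of \<open>K\<close> that satisfy the constraints of all indices other than \<open>i\<close>.\<close>
  define PL where "PL x \<longleftrightarrow> (\<forall>j\<in>L - {i}. if j \<in> A then u j < x else u j \<le> x)" for x
  define PR where "PR y \<longleftrightarrow> (\<forall>j\<in>R - {i}. if j \<in> A then y < u j else y \<le> u j)" for y
  define PE where "PE x y \<longleftrightarrow> (\<forall>j\<in>E - {i}. if j \<in> A then x < u j \<and> u j < y else x \<le> u j \<and> u j \<le> y)" for x y
  define C where "C = {(x, y) \<in> K. PL x \<and> PR y \<and> PE x y}"
  have split: "(\<forall>j\<in>S. Q j) \<longleftrightarrow> (\<forall>j\<in>S - {i}. Q' j) \<and> (i \<in> S \<longrightarrow> q)"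
    if "\<And>j. j \<noteq> i \<Longrightarrow> Q j = Q' j" "Q i = q" for S Q Q' q
  proof -
    have "(\<forall>j\<in>S. Q j) \<longleftrightarrow> (\<forall>j\<in>S - {i}. Q j) \<and> (i \<in> S \<longrightarrow> Q i)" by blast
    then show ?thesis using that by simp
  qed
  have *: "(\<forall>j\<in>L. if j \<in> A then (u(i := t)) j < x else (u(i := t)) j \<le> x) \<longleftrightarrow>
      PL x \<and> (i \<in> L \<longrightarrow> t \<le> x)"
    "(\<forall>j\<in>R. if j \<in> A then y < (u(i := t)) j else y \<le> (u(i := t)) j) \<longleftrightarrow>
      PR y \<and> (i \<in> R \<longrightarrow> y \<le> t)"
    "(\<forall>j\<in>E. if j \<in> A then x < (u(i := t)) j \<and> (u(i := t)) j < y else x \<le> (u(i := t)) j \<and> (u(i := t)) j \<le> y) \<longleftrightarrow>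
      PE x y \<and> (i \<in> E \<longrightarrow> x \<le> t \<and> t \<le> y)"
    for t x y
    unfolding PL_def PR_def PE_def by (rule split; simp add: i)+
  have weak: "hits K L E R A (u(i := t)) \<longleftrightarrow>
      (\<exists>(x, y)\<in>C. (i \<in> L \<longrightarrow> t \<le> x) \<and> (i \<in> R \<longrightarrow> y \<le> t) \<and> (i \<in> E \<longrightarrow> x \<le> t \<and> t \<le> y))" for t
    unfolding hits_iff * by (auto simp: C_def)
  have **: "(\<forall>j\<in>L. if j \<in> insert i A then (u(i := t)) j < x else (u(i := t)) j \<le> x) \<longleftrightarrow>
      PL x \<and> (i \<in> L \<longrightarrow> t < x)"
    "(\<forall>j\<in>R. if j \<in> insert i A then y < (u(i := t)) j else y \<le> (u(i := t)) j) \<longleftrightarrow>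
      PR y \<and> (i \<in> R \<longrightarrow> y < t)"
    "(\<forall>j\<in>E. if j \<in> insert i A then x < (u(i := t)) j \<and> (u(i := t)) j < y else x \<le> (u(i := t)) j \<and> (u(i := t)) j \<le> y) \<longleftrightarrow>
      PE x y \<and> (i \<in> E \<longrightarrow> x < t \<and> t < y)"
    for t x y
    unfolding PL_def PR_def PE_def by (rule split; simp)+
  have strict: "hits K L E R (insert i A) (u(i := t)) \<longleftrightarrow>
      (\<exists>(x, y)\<in>C. (i \<in> L \<longrightarrow> t < x) \<and> (i \<in> R \<longrightarrow> y < t) \<and> (i \<in> E \<longrightarrow> x < t \<and> t < y))" for t
    unfolding hits_iff ** by (auto simp: C_def)
  consider "i \<in> L" "i \<notin> R" "i \<notin> E" | "i \<in> R" "i \<notin> L" "i \<notin> E" | "i \<in> E" "i \<notin> L" "i \<notin> R" | "i \<notin> L" "i \<notin> R" "i \<notin> E"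
    using disj by blast
  then show ?thesis
  proof cases
    case 1
    have B: "t \<in> ?B \<longleftrightarrow> (\<exists>(x, y)\<in>C. t \<le> x) \<and> \<not> (\<exists>(x, y)\<in>C. t < x)" for t
      using 1 by (simp add: weak strict)
    show ?thesis
    proof (rule finite_no_increasing_pair)
      fix s t assume st: "s \<in> ?B" "t \<in> ?B" "s < t"
      then obtain x y where "(x, y) \<in> C" "t \<le> x" using B by blast
      then have "\<exists>(x, y)\<in>C. s < x" using \<open>s < t\<close> by (intro bexI[of _ "(x, y)"]) auto
      then show False using st(1) B by blast
    qed
  next
    case 2
    have B: "t \<in> ?B \<longleftrightarrow> (\<exists>(x, y)\<in>C. y \<le> t) \<and> \<not> (\<exists>(x, y)\<in>C. y < t)" for t
      using 2 by (simp add: weak strict)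
    show ?thesis
    proof (rule finite_no_increasing_pair)
      fix s t assume st: "s \<in> ?B" "t \<in> ?B" "s < t"
      then obtain x y where "(x, y) \<in> C" "y \<le> s" using B by blast
      then have "\<exists>(x, y)\<in>C. y < t" using \<open>s < t\<close> by (intro bexI[of _ "(x, y)"]) auto
      then show False using st(2) B by blast
    qed
  next
    case 3
    obtain k where k: "k \<in> E" "k \<noteq> i" using k 3(1) by blast
    have Ck: "x \<le> u k \<and> u k \<le> y" if "(x, y) \<in> C" for x y
    proof -
      have "\<forall>j\<in>E - {i}. if j \<in> A then x < u j \<and> u j < y else x \<le> u j \<and> u j \<le> y"
        using that unfolding C_def PE_def by blast
      then have "if k \<in> A then x < u k \<and> u k < y else x \<le> u k \<and> u k \<le> y"
        using k by blast
      then show ?thesis by (auto split: if_splits)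
    qed
    have B: "t \<in> ?B \<longleftrightarrow> (\<exists>(x, y)\<in>C. x \<le> t \<and> t \<le> y) \<and> \<not> (\<exists>(x, y)\<in>C. x < t \<and> t < y)" for t
      using 3 by (simp add: weak strict)
    have "finite (?B \<inter> {..<u k})"
    proof (rule finite_no_increasing_pair)
      fix s t assume st: "s \<in> ?B \<inter> {..<u k}" "t \<in> ?B \<inter> {..<u k}" "s < t"
      then obtain x y where "(x, y) \<in> C" "x \<le> s" using B by blast
      moreover have "t < u k" "u k \<le> y" using st Ck calculation by auto
      ultimately have "\<exists>(x, y)\<in>C. x < t \<and> t < y" using \<open>s < t\<close> by (intro bexI[of _ "(x, y)"]) auto
      then show False using st(2) B by blast
    qed
    moreover have "finite (?B \<inter> {u k<..})"
    proof (rule finite_no_increasing_pair)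
      fix s t assume st: "s \<in> ?B \<inter> {u k<..}" "t \<in> ?B \<inter> {u k<..}" "s < t"
      then obtain x y where "(x, y) \<in> C" "t \<le> y" using B by blast
      moreover have "u k < s" "x \<le> u k" using st Ck calculation by auto
      ultimately have "\<exists>(x, y)\<in>C. x < s \<and> s < y" using \<open>s < t\<close> by (intro bexI[of _ "(x, y)"]) auto
      then show False using st(1) B by blast
    qed
    moreover have "?B \<subseteq> (?B \<inter> {..<u k}) \<union> (?B \<inter> {u k<..}) \<union> {u k}" by auto
    ultimately show ?thesis by (meson finite.emptyI finite.insertI finite_UnI finite_subset)
  next
    case 4
    then have "?B = {}" unfolding weak strict by blast
    then show ?thesis by (simp only: finite.emptyI)
  qed
qed

text \<open>Strictness is imposed one index after the other; by \<open>hits_section_finite\<close> each step changes the event by a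
set with finite sections in the coordinate concerned.\<close>

lemma AE_hits_open:
  assumes K: "compact K" and fin: "finite L" "finite E" "finite R" and sub: "L \<union> E \<union> R \<subseteq> {1..}"
    and disj: "L \<inter> E = {}" "R \<inter> E = {}" "L \<inter> R = {}" and two: "\<And>i. i \<in> E \<Longrightarrow> \<exists>k\<in>E. k \<noteq> i"
  shows "AE u in unif_seq. hits K L E R {} u \<longrightarrow> hits K L E R (L \<union> E \<union> R) u"
proof -
  have "AE u in unif_seq. hits K L E R {} u \<longrightarrow> hits K L E R A u" if "finite A" "A \<subseteq> L \<union> E \<union> R" for A
    using that
  proof (induction A)
    case (insert i A)
    let ?D = "{u \<in> space unif_seq. hits K L E R A u \<and> \<not> hits K L E R (insert i A) u}"
    have m: "{u \<in> space unif_seq. hits K L E R B u} \<in> sets unif_seq" for B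
      using measurable_hits[OF K fin, of "\<lambda>j u. u j" unif_seq B] measurable_coord sub by blast
    have "?D = {u \<in> space unif_seq. hits K L E R A u} - {u \<in> space unif_seq. hits K L E R (insert i A) u}"
      by blast
    also have "\<dots> \<in> sets unif_seq" using m by (rule sets.Diff) (rule m)
    finally have D: "?D \<in> sets unif_seq" .
    have "?D \<in> null_sets unif_seq"
    proof (rule unif_seq_null[OF _ D])
      show "i \<in> {1..}" using insert.prems sub by blast
      fix u
      have "{t. u(i := t) \<in> ?D} \<subseteq> {t. hits K L E R A (u(i := t)) \<and> \<not> hits K L E R (insert i A) (u(i := t))}"
        by blast
      moreover have "finite {t. hits K L E R A (u(i := t)) \<and> \<not> hits K L E R (insert i A) (u(i := t))}"
        by (rule hits_section_finite[OF insert.hyps(2) two disj])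
      ultimately show "countable {t. u(i := t) \<in> ?D}" by (intro countable_finite) (rule finite_subset)
    qed
    then have "AE u in unif_seq. u \<notin> ?D" by (rule AE_not_in)
    moreover have "AE u in unif_seq. hits K L E R {} u \<longrightarrow> hits K L E R A u" using insert by blast
    ultimately show ?case using AE_space by eventually_elim blast
  qed simp
  then show ?thesis using fin by simp
qed

section \<open>Hit-or-miss convergence of interval systems\<close>

text \<open>Convergence in the Fell topology. Its two halves are exactly what the behaviour of the open and the closed
constraint regions requires, and for compact sets it follows from convergence in the Hausdorff
distance.\<close>

definition fell_conv :: "(nat \<Rightarrow> (real \<times> real) set) \<Rightarrow> (real \<times> real) set \<Rightarrow> bool" where
  "fell_conv Ks K \<longleftrightarrow>
     (\<forall>S. open S \<longrightarrow> S \<inter> K \<noteq> {} \<longrightarrow> (\<forall>\<^sub>F k in sequentially. S \<inter> Ks k \<noteq> {})) \<and>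
     (\<forall>S. closed S \<longrightarrow> S \<inter> K = {} \<longrightarrow> (\<forall>\<^sub>F k in sequentially. S \<inter> Ks k = {}))"

text \<open>If an edge is sampled from \<open>K\<close>, then almost surely \<open>K\<close> meets an open constraint region of this edge,
and so does \<open>Ks k\<close> eventually. If it is not sampled, then almost surely \<open>K\<close> misses the closed
constraint regions, and so does \<open>Ks k\<close> eventually. Edges with fewer than two elements, to which
\<open>AE_hits_open\<close> does not apply, are always present.\<close>

lemma AE_sample_hy_fell_conv:
  assumes K: "compact K" and conv: "fell_conv Ks K"
  shows "AE u in unif_seq. \<forall>n. \<forall>\<^sub>F k in sequentially. sample_hy (Ks k) n u = sample_hy K n u"
  unfolding AE_all_countable
proof
  have miss: "\<forall>\<^sub>F k in sequentially. S \<inter> Ks k = {}" if "closed S" "S \<inter> K = {}" for S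
    using conv that unfolding fell_conv_def by blast
  fix n :: nat
  let ?I = "{(L, e). e \<subseteq> {1..n} \<and> L \<subseteq> {1..n} - e \<and> \<not> (e = {} \<or> (\<exists>j\<in>{1..n}. e = {j}))}"
  have finI: "finite ?I" by (rule finite_subset[of _ "Pow {1..n} \<times> Pow {1..n}"]) auto
  have "AE u in unif_seq. \<forall>p\<in>?I. hits K (fst p) (snd p) ({1..n} - snd p - fst p) {} u \<longrightarrow>
      hits K (fst p) (snd p) ({1..n} - snd p - fst p) (fst p \<union> snd p \<union> ({1..n} - snd p - fst p)) u"
  proof (rule AE_finite_allI[OF finI])
    fix p assume "p \<in> ?I"
    then obtain L e where p: "p = (L, e)" and e: "e \<subseteq> {1..n}" and L: "L \<subseteq> {1..n} - e"
      and ne: "\<not> (e = {} \<or> (\<exists>j\<in>{1..n}. e = {j}))" by blast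
    have "\<exists>k\<in>e. k \<noteq> i" if "i \<in> e" for i
    proof (rule ccontr)
      assume "\<not> ?thesis" then have "e = {i}" using that by blast
      then show False using ne that e by blast
    qed
    moreover have "finite L" "finite e" using e L by (auto intro: finite_subset)
    moreover have "L \<union> e \<union> ({1..n} - e - L) \<subseteq> {1..}" using e L by auto
    ultimately show "AE u in unif_seq. hits K (fst p) (snd p) ({1..n} - snd p - fst p) {} u \<longrightarrow>
      hits K (fst p) (snd p) ({1..n} - snd p - fst p) (fst p \<union> snd p \<union> ({1..n} - snd p - fst p)) u"
      unfolding p fst_conv snd_conv using L by (intro AE_hits_open[OF K]) auto
  qed
  then show "AE u in unif_seq. \<forall>\<^sub>F k in sequentially. sample_hy (Ks k) n u = sample_hy K n u"
  proof (rule AE_mp, intro AE_I2 impI)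
    fix u assume good': "\<forall>p\<in>?I. hits K (fst p) (snd p) ({1..n} - snd p - fst p) {} u \<longrightarrow>
      hits K (fst p) (snd p) ({1..n} - snd p - fst p) (fst p \<union> snd p \<union> ({1..n} - snd p - fst p)) u"
    have good: "hits K L e ({1..n} - e - L) {} u \<Longrightarrow>
      hits K L e ({1..n} - e - L) (L \<union> e \<union> ({1..n} - e - L)) u" if "(L, e) \<in> ?I" for L e
      using bspec[OF good' that] unfolding fst_conv snd_conv by (rule mp)
    have ev: "\<forall>\<^sub>F k in sequentially. hits (Ks k) L e ({1..n} - e - L) e u = hits K L e ({1..n} - e - L) e u"
      if Le: "(L, e) \<in> ?I" for L e
    proof (cases "hits K L e ({1..n} - e - L) e u")
      case True
      let ?O = "constraint_region L e ({1..n} - e - L) (L \<union> e \<union> ({1..n} - e - L)) u"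
      have "hits K L e ({1..n} - e - L) {} u" using True by (rule hits_antimono[rotated]) simp
      then have "?O \<inter> K \<noteq> {}" using good[OF Le] unfolding hits_def by blast
      moreover have "finite L" "finite e" using Le by (auto intro: finite_subset)
      then have "open ?O" by (intro open_constraint_region) auto
      ultimately have "\<forall>\<^sub>F k in sequentially. ?O \<inter> Ks k \<noteq> {}" using conv unfolding fell_conv_def by blast
      then show ?thesis
      proof eventually_elim
        case (elim k)
        then have "hits (Ks k) L e ({1..n} - e - L) (L \<union> e \<union> ({1..n} - e - L)) u" unfolding hits_def .
        then have "hits (Ks k) L e ({1..n} - e - L) e u" by (rule hits_antimono[rotated]) blast
        then show ?case using True by simp
      qed
    next
      case False
      let ?C = "constraint_region L e ({1..n} - e - L) {} u"
      have "\<not> hits K L e ({1..n} - e - L) {} u"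
      proof
        assume "hits K L e ({1..n} - e - L) {} u"
        then have "hits K L e ({1..n} - e - L) (L \<union> e \<union> ({1..n} - e - L)) u" by (rule good[OF Le])
        then have "hits K L e ({1..n} - e - L) e u" by (rule hits_antimono[rotated]) blast
        then show False using False by blast
      qed
      then have "?C \<inter> K = {}" unfolding hits_def by blast
      then have "\<forall>\<^sub>F k in sequentially. ?C \<inter> Ks k = {}"
        by (rule miss[OF closed_constraint_region])
      then show ?thesis
      proof eventually_elim
        case (elim k)
        then have "\<not> hits (Ks k) L e ({1..n} - e - L) {} u" unfolding hits_def by blast
        then have "\<not> hits (Ks k) L e ({1..n} - e - L) e u" using hits_antimono[of "{}" e] by blast
        then show ?case using False by simp
      qed
    qed
    have "\<forall>\<^sub>F k in sequentially. \<forall>p\<in>?I. hits (Ks k) (fst p) (snd p) ({1..n} - snd p - fst p) (snd p) u =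
        hits K (fst p) (snd p) ({1..n} - snd p - fst p) (snd p) u"
      by (rule eventually_ball_finite[OF finI]) (use ev in auto)
    then show "\<forall>\<^sub>F k in sequentially. sample_hy (Ks k) n u = sample_hy K n u"
    proof eventually_elim
      case (elim k)
      have "e \<in> sample_hy (Ks k) n u \<longleftrightarrow> e \<in> sample_hy K n u" for e
      proof (cases "e = {} \<or> (\<exists>j\<in>{1..n}. e = {j})")
        case True then show ?thesis unfolding sample_hy_iff_hits by blast
      next
        case False
        have "hits (Ks k) L e ({1..n} - e - L) e u = hits K L e ({1..n} - e - L) e u"
          if "e \<subseteq> {1..n}" "L \<subseteq> {1..n} - e" for L
        proof -
          have "(L, e) \<in> ?I" using that False by blast
          from bspec[OF elim this] show ?thesis unfolding fst_conv snd_conv .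
        qed
        then show ?thesis unfolding sample_hy_iff_hits using False by blast
      qed
      then show ?case by blast
    qed
  qed
qed

lemma dist_le_l1_dist: "dist p q \<le> l1_dist p q"
proof -
  have "dist p q = sqrt ((dist (fst p) (fst q))\<^sup>2 + (dist (snd p) (snd q))\<^sup>2)"
    by (simp add: dist_prod_def)
  also have "\<dots> \<le> \<bar>dist (fst p) (fst q)\<bar> + \<bar>dist (snd p) (snd q)\<bar>" by (rule sqrt_sum_squares_le_sum_abs)
  finally show ?thesis by (simp add: l1_dist_def dist_real_def)
qed

lemma hausdorff_imp_fell_conv:
  assumes Ks: "\<And>k. Ks k \<in> InSy" and K: "K \<in> InSy"
    and lim: "(\<lambda>k. hausdorff_l1 (Ks k) K) \<longlonglongrightarrow> 0"
  shows "fell_conv Ks K"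
proof -
  have near: "(\<forall>a\<in>Ks k. \<exists>b\<in>K. l1_dist a b \<le> hausdorff_l1 (Ks k) K) \<and>
      (\<forall>b\<in>K. \<exists>a\<in>Ks k. l1_dist a b \<le> hausdorff_l1 (Ks k) K)" for k
    using hausdorff_l1_le_iff[OF InSy_D[OF Ks[of k]] InSy_D[OF K], of "hausdorff_l1 (Ks k) K"] by simp
  show ?thesis
    unfolding fell_conv_def
  proof (intro conjI allI impI)
    fix S :: "(real \<times> real) set" assume S: "open S" "S \<inter> K \<noteq> {}"
    then obtain p where p: "p \<in> S" "p \<in> K" by blast
    obtain e where e: "e > 0" "ball p e \<subseteq> S" using S(1) p(1) openE by blast
    have "\<forall>\<^sub>F k in sequentially. hausdorff_l1 (Ks k) K < e" by (rule order_tendstoD(2)[OF lim e(1)])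
    then show "\<forall>\<^sub>F k in sequentially. S \<inter> Ks k \<noteq> {}"
    proof eventually_elim
      case (elim k)
      obtain a where a: "a \<in> Ks k" "l1_dist a p \<le> hausdorff_l1 (Ks k) K" using near[of k] p(2) by blast
      then have "dist p a < e" using dist_le_l1_dist[of a p] elim by (simp add: dist_commute)
      then have "a \<in> S" using e(2) by auto
      then show ?case using a(1) by blast
    qed
  next
    fix S :: "(real \<times> real) set" assume S: "closed S" "S \<inter> K = {}"
    then obtain d where d: "d > 0" "\<And>x y. x \<in> K \<Longrightarrow> y \<in> S \<Longrightarrow> d \<le> dist x y"
      using separate_compact_closed[OF InSy_D(1)[OF K] S(1)] by blast
    have "\<forall>\<^sub>F k in sequentially. hausdorff_l1 (Ks k) K < d" by (rule order_tendstoD(2)[OF lim d(1)])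
    then show "\<forall>\<^sub>F k in sequentially. S \<inter> Ks k = {}"
    proof eventually_elim
      case (elim k)
      have False if aS: "a \<in> S" and aK: "a \<in> Ks k" for a
      proof -
        obtain b where b: "b \<in> K" "l1_dist a b \<le> hausdorff_l1 (Ks k) K" using near[of k] aK by blast
        then show False
          using d(2)[OF b(1) aS] dist_le_l1_dist[of a b] elim by (simp add: dist_commute)
      qed
      then show ?case by blast
    qed
  qed
qed

lemma closed_triangle: "closed {(x, y). 0 \<le> x \<and> x \<le> y \<and> y \<le> (1::real)}"
proof -
  have "{(x, y). 0 \<le> x \<and> x \<le> y \<and> y \<le> (1::real)} = {p. 0 \<le> fst p} \<inter> {p. fst p \<le> snd p} \<inter> {p. snd p \<le> 1}"
    by auto
  also have "closed \<dots>" by (intro closed_Int closed_Collect_le continuous_intros)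
  finally show ?thesis .
qed

lemma compact_triangle: "compact {(x, y). 0 \<le> x \<and> x \<le> y \<and> y \<le> (1::real)}"
proof -
  have "bounded ({0..1::real} \<times> {0..1::real})" by (intro bounded_Times bounded_closed_interval)
  moreover have "{(x, y). 0 \<le> x \<and> x \<le> y \<and> y \<le> (1::real)} \<subseteq> {0..1} \<times> {0..1}" by auto
  ultimately show ?thesis using closed_triangle bounded_subset compact_eq_bounded_closed by blast
qed

text \<open>A diagonal subsequence has the property that each set of a countable base is hit either eventually always or
eventually never. The limit consists of the points all of whose basic neighbourhoods are eventually hit.\<close>

lemma InSy_fell_compact:
  assumes Ks: "\<And>k. Ks k \<in> InSy"
  obtains r K where "strict_mono (r :: nat \<Rightarrow> nat)" "K \<in> InSy" "fell_conv (Ks \<circ> r) K"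
proof -
  let ?T = "{(x, y). 0 \<le> x \<and> x \<le> y \<and> y \<le> (1::real)}"
  have KT: "Ks k \<subseteq> ?T" and diag: "x \<in> {0..1} \<Longrightarrow> (x, x) \<in> Ks k" for k x
    using Ks[of k] by (auto simp: InSy_def)
  obtain \<B> :: "(real \<times> real) set set" where \<B>: "countable \<B>" "topological_basis \<B>"
    using ex_countable_basis by blast
  define B where "B = from_nat_into \<B>"
  have nbhd: "\<exists>i. p \<in> B i \<and> B i \<subseteq> S" if S: "open S" "p \<in> S" for p S
  proof -
    obtain b where b: "b \<in> \<B>" "p \<in> b" "b \<subseteq> S" by (rule topological_basisE[OF \<B>(2) S])
    then obtain i where "B i = b" unfolding B_def using from_nat_into_surj[OF \<B>(1) b(1)] by blast
    then show ?thesis using b by blast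
  qed
  have B_open: "open (B i)" for i
  proof -
    have "\<B> \<noteq> {}" using \<B>(2) nbhd[of UNIV] topological_basisE[OF \<B>(2) open_UNIV, of 0] by blast
    then have "B i \<in> \<B>" unfolding B_def by (rule from_nat_into)
    then show ?thesis using topological_basis_open[OF \<B>(2)] by blast
  qed
  define P where "P i s \<longleftrightarrow> (\<forall>\<^sub>F k in sequentially. B i \<inter> Ks (s k) \<noteq> {}) \<or> (\<forall>\<^sub>F k in sequentially. B i \<inter> Ks (s k) = {})" for i s
  interpret subseqs P
  proof
    fix i and s :: "nat \<Rightarrow> nat" assume "strict_mono s"
    show "\<exists>r'. strict_mono r' \<and> P i (s \<circ> r')"
    proof (cases "infinite {k. B i \<inter> Ks (s k) = {}}")
      case True
      then obtain r' :: "nat \<Rightarrow> nat" where "strict_mono r'" "\<And>n. r' n \<in> {k. B i \<inter> Ks (s k) = {}}"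
        using infinite_enumerate by blast
      then show ?thesis by (intro exI[of _ r']) (simp add: P_def)
    next
      case False
      then have "\<forall>\<^sub>F k in sequentially. B i \<inter> Ks (s k) \<noteq> {}"
        by (simp add: cofinite_eq_sequentially[symmetric] eventually_cofinite)
      then show ?thesis by (intro exI[of _ id]) (simp add: P_def strict_mono_id)
    qed
  qed
  define r where "r = diagseq"
  have r: "strict_mono r" unfolding r_def by (rule subseq_diagseq)
  have dich: "(\<forall>\<^sub>F k in sequentially. B i \<inter> Ks (r k) \<noteq> {}) \<or> (\<forall>\<^sub>F k in sequentially. B i \<inter> Ks (r k) = {})" for i
  proof -
    have "P i (diagseq \<circ> ((+) (Suc i)))"
    proof (rule diagseq_holds)
      fix q s :: "nat \<Rightarrow> nat" and i assume q: "strict_mono q" and "P i s"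
      then show "P i (s \<circ> q)"
        using eventually_subseq[OF q, of "\<lambda>k. B i \<inter> Ks (s k) \<noteq> {}"]
          eventually_subseq[OF q, of "\<lambda>k. B i \<inter> Ks (s k) = {}"] unfolding P_def o_def by blast
    qed
    then have "(\<forall>\<^sub>F k in sequentially. B i \<inter> Ks (r (k + Suc i)) \<noteq> {}) \<or>
        (\<forall>\<^sub>F k in sequentially. B i \<inter> Ks (r (k + Suc i)) = {})"
      unfolding P_def o_def r_def by (simp only: add.commute)
    then show ?thesis
      using eventually_sequentially_seg[of "\<lambda>k. B i \<inter> Ks (r k) \<noteq> {}" "Suc i"]
        eventually_sequentially_seg[of "\<lambda>k. B i \<inter> Ks (r k) = {}" "Suc i"] by blast
  qed
  define K where "K = {p. \<forall>i. p \<in> B i \<longrightarrow> (\<forall>\<^sub>F k in sequentially. B i \<inter> Ks (r k) \<noteq> {})}"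
  have outside: "\<exists>i. p \<in> B i \<and> B i \<inter> K = {}" if "p \<notin> K" for p
    using that unfolding K_def by blast
  have "K \<in> InSy"
    unfolding InSy_def
  proof (intro CollectI conjI ballI)
    have "open (- K)"
    proof (subst open_subopen, intro ballI)
      fix p assume "p \<in> - K"
      then obtain i where i: "p \<in> B i" "B i \<inter> K = {}" using outside by blast
      then show "\<exists>T. open T \<and> p \<in> T \<and> T \<subseteq> - K" using B_open by blast
    qed
    then have "closed K" by (simp add: closed_def)
    show sub: "K \<subseteq> ?T"
    proof
      fix p assume p: "p \<in> K"
      show "p \<in> ?T"
      proof (rule ccontr)
        assume "p \<notin> ?T"
        then obtain i where i: "p \<in> B i" "B i \<subseteq> - ?T" using nbhd[of "- ?T" p] closed_triangle by blast
        then have "\<forall>\<^sub>F k in sequentially. B i \<inter> Ks (r k) \<noteq> {}" using p unfolding K_def by blast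
        moreover have "B i \<inter> Ks (r k) = {}" for k using KT[of "r k"] i(2) by blast
        ultimately show False by simp
      qed
    qed
    show "compact K" using compact_Int_closed[OF compact_triangle \<open>closed K\<close>] unfolding Int_absorb1[OF sub] .
    fix x :: real assume "x \<in> {0..1}"
    then have "(x, x) \<in> Ks (r k)" for k by (rule diag)
    then have "B i \<inter> Ks (r k) \<noteq> {}" if "(x, x) \<in> B i" for i k using that by blast
    then show "(x, x) \<in> K" unfolding K_def by simp
  qed
  moreover have "fell_conv (Ks \<circ> r) K"
    unfolding fell_conv_def o_def
  proof (intro conjI allI impI)
    fix S :: "(real \<times> real) set" assume S: "open S" "S \<inter> K \<noteq> {}"
    then obtain p where p: "p \<in> S" "p \<in> K" by blast
    obtain i where i: "p \<in> B i" "B i \<subseteq> S" using nbhd[OF S(1) p(1)] by blast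
    have "\<forall>\<^sub>F k in sequentially. B i \<inter> Ks (r k) \<noteq> {}" using p(2) i(1) unfolding K_def by blast
    then show "\<forall>\<^sub>F k in sequentially. S \<inter> Ks (r k) \<noteq> {}"
      by eventually_elim (use i(2) in blast)
  next
    fix S :: "(real \<times> real) set" assume S: "closed S" "S \<inter> K = {}"
    show "\<forall>\<^sub>F k in sequentially. S \<inter> Ks (r k) = {}"
    proof (rule ccontr)
      assume "\<not> ?thesis"
      then have "infinite {k. S \<inter> Ks (r k) \<noteq> {}}"
        by (simp add: cofinite_eq_sequentially[symmetric] eventually_cofinite)
      then obtain q :: "nat \<Rightarrow> nat" where q: "strict_mono q" "\<And>n. q n \<in> {k. S \<inter> Ks (r k) \<noteq> {}}"
        using infinite_enumerate by blast
      then have "\<forall>n. \<exists>a. a \<in> S \<and> a \<in> Ks (r (q n))" by blast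
      then obtain a where a: "\<And>n. a n \<in> S" "\<And>n. a n \<in> Ks (r (q n))" by metis
      have aT: "\<And>n. a n \<in> ?T" by (rule subsetD[OF KT a(2)])
      obtain l t where l: "strict_mono (t :: nat \<Rightarrow> nat)" "(a \<circ> t) \<longlonglongrightarrow> l"
      proof -
        have "(\<forall>n. a n \<in> ?T) \<longrightarrow> (\<exists>l\<in>?T. \<exists>t. strict_mono (t :: nat \<Rightarrow> nat) \<and> (a \<circ> t) \<longlonglongrightarrow> l)"
          using compact_triangle unfolding compact_def by (rule spec)
        moreover have "\<forall>n. a n \<in> ?T" using aT by (rule allI)
        ultimately have "\<exists>l\<in>?T. \<exists>t. strict_mono (t :: nat \<Rightarrow> nat) \<and> (a \<circ> t) \<longlonglongrightarrow> l" by (rule mp)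
        then show thesis using that by (elim bexE exE conjE)
      qed
      have "l \<in> S" by (rule closed_sequentially[OF S(1) _ l(2)]) (simp add: a(1))
      moreover have "l \<in> K"
        unfolding K_def
      proof (intro CollectI allI impI)
        fix i assume i: "l \<in> B i"
        have "\<forall>\<^sub>F n in sequentially. (a \<circ> t) n \<in> B i" by (rule topological_tendstoD[OF l(2) B_open i])
        then have hit: "\<forall>\<^sub>F n in sequentially. B i \<inter> Ks (r (q (t n))) \<noteq> {}"
          by eventually_elim (use a(2) in force)
        have "\<not> (\<forall>\<^sub>F k in sequentially. B i \<inter> Ks (r k) = {})"
        proof
          assume "\<forall>\<^sub>F k in sequentially. B i \<inter> Ks (r k) = {}"
          then have "\<forall>\<^sub>F n in sequentially. B i \<inter> Ks (r ((q \<circ> t) n)) = {}"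
            by (rule eventually_subseq[OF strict_mono_o[OF q(1) l(1)]])
          then have "\<forall>\<^sub>F n :: nat in sequentially. False" using hit by eventually_elim simp
          then show False by simp
        qed
        then show "\<forall>\<^sub>F k in sequentially. B i \<inter> Ks (r k) \<noteq> {}" using dich[of i] by blast
      qed
      ultimately show False using S(2) by blast
    qed
  qed
  ultimately show thesis using that r by blast
qed

section \<open>Laws of sampled hypergraphs\<close>

definition sample_prob :: "(real \<times> real) set \<Rightarrow> nat \<Rightarrow> nat set set \<Rightarrow> real" where
  "sample_prob K n G = measure unif_seq {u \<in> space unif_seq. sample_hy K n u = G}"

lemma sample_level_set:
  assumes "compact K"
  shows "{u \<in> space unif_seq. Q (sample_hy K n u)} \<in> sets unif_seq"
proof -
  have m: "(\<lambda>u. sample_hy K n (\<lambda>j. u j)) \<in> unif_seq \<rightarrow>\<^sub>M count_space (InHy n)"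
    by (rule measurable_sample_hy[OF assms]) (rule measurable_coord, simp)
  have "{u \<in> space unif_seq. Q (sample_hy K n u)} = (\<lambda>u. sample_hy K n (\<lambda>j. u j)) -` {G \<in> InHy n. Q G} \<inter> space unif_seq"
    using sample_hy_InHy by auto
  also have "\<dots> \<in> sets unif_seq" by (rule measurable_sets[OF m]) simp
  finally show ?thesis .
qed

text \<open>Reindexing i.i.d. sample points along an injection does not change their joint distribution.\<close>

lemma sample_prob_reindex:
  assumes K: "compact K" and inj: "inj_on \<iota> {1..n}" and sub: "\<iota> ` {1..n} \<subseteq> {1..}"
  shows "measure unif_seq {u \<in> space unif_seq. sample_hy K n (u \<circ> \<iota>) = G} = sample_prob K n G"
proof -
  let ?P = "\<Pi>\<^sub>M j\<in>{1..n}. unif"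
  let ?S = "{v \<in> space ?P. sample_hy K n v = G}"
  have S: "?S \<in> sets ?P"
  proof -
    have "(\<lambda>v. v j) \<in> borel_measurable ?P" if "j \<in> {1..n}" for j
      using measurable_component_singleton[of j "{1..n}" "\<lambda>_. unif"] that by (simp cong: measurable_cong_sets)
    then have m: "(\<lambda>v. sample_hy K n (\<lambda>j. v j)) \<in> ?P \<rightarrow>\<^sub>M count_space (InHy n)"
      by (rule measurable_sample_hy[OF K])
    have "?S = (\<lambda>v. sample_hy K n (\<lambda>j. v j)) -` ({G} \<inter> InHy n) \<inter> space ?P"
      using sample_hy_InHy by auto
    also have "\<dots> \<in> sets ?P" by (rule measurable_sets[OF m]) simp
    finally show ?thesis .
  qed
  have main: "measure unif_seq {u \<in> space unif_seq. sample_hy K n (u \<circ> \<kappa>) = G} = measure ?P ?S"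
    if inj: "inj_on \<kappa> {1..n}" and sub: "\<kappa> ` {1..n} \<subseteq> {1..}" for \<kappa>
  proof -
    let ?t = "\<lambda>u. \<lambda>j\<in>{1..n}. u (\<kappa> j)"
    have \<kappa>: "\<kappa> \<in> {1..n} \<rightarrow> {1..}" using sub by blast
    have t: "?t \<in> unif_seq \<rightarrow>\<^sub>M ?P"
      by (rule measurable_restrict) (rule measurable_component_singleton, use \<kappa> in blast)
    have d: "distr unif_seq ?P ?t = ?P"
      using distr_PiM_reindex[of "{1..}" "\<lambda>_. unif" \<kappa> "{1..n}", OF prob_space_unif inj \<kappa>] .
    have eq: "sample_hy K n (?t u) = sample_hy K n (u \<circ> \<kappa>)" for u
      by (rule sample_hy_cong) simp
    have "measure ?P ?S = measure (distr unif_seq ?P ?t) ?S" by (simp only: d)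
    also have "\<dots> = measure unif_seq (?t -` ?S \<inter> space unif_seq)" by (rule measure_distr[OF t S])
    also have "?t -` ?S \<inter> space unif_seq = {u \<in> space unif_seq. sample_hy K n (u \<circ> \<kappa>) = G}"
    proof -
      have "?t u \<in> space ?P" if "u \<in> space unif_seq" for u by (rule measurable_space[OF t that])
      then show ?thesis unfolding vimage_def mem_Collect_eq eq by blast
    qed
    finally show ?thesis by (rule sym)
  qed
  have "inj_on id {1..n}" "id ` {1..n} \<subseteq> {1..}" by auto
  from main[OF this] have "sample_prob K n G = measure ?P ?S"
    unfolding sample_prob_def comp_id .
  then show ?thesis using main[OF inj sub] by simp
qed

text \<open>Every i.i.d. uniform sequence has the distribution of the coordinates of \<open>unif_seq\<close>, so that sampling
probabilities can be computed there.\<close>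

lemma iid_uniform_transfer:
  assumes iid: "iid_uniform M U"
  shows "(\<lambda>\<omega>. \<lambda>i\<in>{1..}. U i \<omega>) \<in> M \<rightarrow>\<^sub>M unif_seq"
    and "distr M unif_seq (\<lambda>\<omega>. \<lambda>i\<in>{1..}. U i \<omega>) = unif_seq"
    and "\<And>i. i \<in> {1..} \<Longrightarrow> U i \<in> borel_measurable M"
proof -
  interpret prob_space M using iid by (simp add: iid_uniform_def)
  have ind: "indep_vars (\<lambda>_. borel) U {1..}" and dU: "\<And>i. i \<in> {1..} \<Longrightarrow> distr M borel (U i) = unif"
    using iid by (simp_all add: iid_uniform_def)
  show rv: "\<And>i. i \<in> {1..} \<Longrightarrow> U i \<in> borel_measurable M"
    using ind unfolding indep_vars_def2 by blast
  have s: "sets unif_seq = sets (\<Pi>\<^sub>M i\<in>{1..}. (borel :: real measure))"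
    by (rule sets_PiM_cong) simp_all
  have "(\<lambda>\<omega>. \<lambda>i\<in>{1..}. U i \<omega>) \<in> M \<rightarrow>\<^sub>M (\<Pi>\<^sub>M i\<in>{1..}. borel)"
    by (rule measurable_restrict) (rule rv)
  then show "(\<lambda>\<omega>. \<lambda>i\<in>{1..}. U i \<omega>) \<in> M \<rightarrow>\<^sub>M unif_seq"
    using measurable_cong_sets[OF refl s] by blast
  have "distr M (\<Pi>\<^sub>M i\<in>{1..}. borel) (\<lambda>\<omega>. \<lambda>i\<in>{1..}. U i \<omega>) = (\<Pi>\<^sub>M i\<in>{1..}. distr M borel (U i))"
    using ind by (subst (asm) indep_vars_iff_distr_eq_PiM') (use rv in auto)
  also have "\<dots> = unif_seq" by (rule PiM_cong[OF refl dU])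
  finally show "distr M unif_seq (\<lambda>\<omega>. \<lambda>i\<in>{1..}. U i \<omega>) = unif_seq"
    using distr_cong[OF refl s, of M] by (metis (no_types, lifting) s distr_cong refl)
qed

lemma measure_sample_iid:
  assumes K: "compact K" and iid: "iid_uniform M U"
    and inj: "inj_on \<iota> {1..n}" and sub: "\<iota> ` {1..n} \<subseteq> {1..}"
  shows "measure M {\<omega> \<in> space M. sample_hy K n ((\<lambda>j. U j \<omega>) \<circ> \<iota>) = G} = sample_prob K n G"
proof -
  let ?V = "\<lambda>\<omega>. \<lambda>i\<in>{1..}. U i \<omega>" and ?S = "{u \<in> space unif_seq. sample_hy K n (u \<circ> \<iota>) = G}"
  note V = iid_uniform_transfer[OF iid]
  have S: "?S \<in> sets unif_seq"
  proof -
    have m: "(\<lambda>u. sample_hy K n (\<lambda>j. u (\<iota> j))) \<in> unif_seq \<rightarrow>\<^sub>M count_space (InHy n)"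
      by (rule measurable_sample_hy[OF K]) (rule measurable_coord, use sub in blast)
    have "?S = (\<lambda>u. sample_hy K n (\<lambda>j. u (\<iota> j))) -` ({G} \<inter> InHy n) \<inter> space unif_seq"
      using sample_hy_InHy by (auto simp: o_def)
    also have "\<dots> \<in> sets unif_seq" by (rule measurable_sets[OF m]) simp
    finally show ?thesis .
  qed
  have "sample_hy K n (?V \<omega> \<circ> \<iota>) = sample_hy K n ((\<lambda>j. U j \<omega>) \<circ> \<iota>)" for \<omega>
  proof (rule sample_hy_cong)
    fix j assume "j \<in> {1..n}"
    then have "\<iota> j \<in> {1..}" using sub by blast
    then show "(?V \<omega> \<circ> \<iota>) j = ((\<lambda>j. U j \<omega>) \<circ> \<iota>) j" by (simp only: o_apply restrict_apply if_True)
  qed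
  then have eq: "{\<omega> \<in> space M. sample_hy K n ((\<lambda>j. U j \<omega>) \<circ> \<iota>) = G} = ?V -` ?S \<inter> space M"
    using measurable_space[OF V(1)] by auto
  have "measure M (?V -` ?S \<inter> space M) = measure (distr M unif_seq ?V) ?S"
    by (rule measure_distr[OF V(1) S, symmetric])
  also have "\<dots> = sample_prob K n G"
    unfolding V(2) by (rule sample_prob_reindex[OF K inj sub])
  finally show ?thesis unfolding eq .
qed

lemma iid_uniform_coords: "iid_uniform unif_seq (\<lambda>i u. u i)"
proof -
  interpret prob_space unif_seq by (rule prob_space_unif_seq)
  have coord: "distr unif_seq borel (\<lambda>u. u i) = unif" if "i \<in> {1..}" for i
  proof -
    have "distr unif_seq borel (\<lambda>u. u i) = distr unif_seq unif (\<lambda>u. u i)" by (rule distr_cong) simp_all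
    also have "\<dots> = unif" by (rule distr_PiM_component[OF prob_space_unif that])
    finally show ?thesis .
  qed
  have s: "sets (\<Pi>\<^sub>M i\<in>{1..}. (borel :: real measure)) = sets unif_seq"
    by (rule sets_PiM_cong) simp_all
  have "distr unif_seq (\<Pi>\<^sub>M i\<in>{1..}. borel) (\<lambda>u. \<lambda>i\<in>{1..}. u i) = distr unif_seq unif_seq (\<lambda>u. u)"
    by (rule distr_cong[OF refl s]) (auto simp: space_PiM PiE_iff extensional_restrict)
  also have "\<dots> = unif_seq" by (rule distr_id)
  also have "\<dots> = (\<Pi>\<^sub>M i\<in>{1..}. distr unif_seq borel (\<lambda>u. u i))" by (rule PiM_cong[OF refl coord[symmetric]])
  finally have "indep_vars (\<lambda>_. borel) (\<lambda>i u. u i) {1..}"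
    by (subst indep_vars_iff_distr_eq_PiM') (use measurable_coord in auto)
  then show ?thesis unfolding iid_uniform_def using prob_space_unif_seq coord by blast
qed

lemma exch_sample:
  assumes K: "compact K" and iid: "iid_uniform M U"
  shows "exch_int_hypergraph M (\<lambda>n \<omega>. sample_hy K n (\<lambda>j. U j \<omega>))"
proof -
  interpret prob_space M using iid by (simp add: iid_uniform_def)
  have meas: "(\<lambda>\<omega>. sample_hy K n (\<lambda>j. U j \<omega>)) \<in> M \<rightarrow>\<^sub>M count_space (InHy n)" for n
    by (rule measurable_sample_hy[OF K iid_uniform_transfer(3)[OF iid]]) simp
  show ?thesis
    unfolding exch_int_hypergraph_def
  proof (intro conjI ballI allI impI meas)
    show "prob_space M" by (rule prob_space_axioms)
    fix n :: nat
    show "AE \<omega> in M. sample_hy K n (\<lambda>j. U j \<omega>) = restrict_hy n (sample_hy K (Suc n) (\<lambda>j. U j \<omega>))"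
      by (rule AE_I2) (rule sample_hy_restrict)
    fix \<pi> assume \<pi>: "\<pi> permutes {1..n}"
    have rel: "relabel_hy \<pi> (sample_hy K n u) = sample_hy K n (u \<circ> inv \<pi>)" for u
      unfolding relabel_hy_eq_pull[OF \<pi> InHy_subset_Pow[OF sample_hy_InHy]]
      by (rule pull_sample_hy) (use permutes_inv[OF \<pi>] in \<open>simp_all add: permutes_inj_on permutes_image\<close>)
    have inv_sub: "inv \<pi> ` {1..n} \<subseteq> {1..}"
      using permutes_image[OF permutes_inv[OF \<pi>]] by auto
    have inv_in: "inv \<pi> j \<in> {1..}" if "j \<in> {1..n}" for j using inv_sub that by blast
    have meas_rel: "(\<lambda>\<omega>. sample_hy K n ((\<lambda>j. U j \<omega>) \<circ> inv \<pi>)) \<in> M \<rightarrow>\<^sub>M count_space (InHy n)"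
      unfolding o_def by (rule measurable_sample_hy[OF K iid_uniform_transfer(3)[OF iid inv_in]])
    show "distr M (count_space (InHy n)) (\<lambda>\<omega>. relabel_hy \<pi> (sample_hy K n (\<lambda>j. U j \<omega>))) =
        distr M (count_space (InHy n)) (\<lambda>\<omega>. sample_hy K n (\<lambda>j. U j \<omega>))"
      unfolding rel
    proof (rule measure_eqI_countable[of _ "InHy n"])
      fix G assume G: "G \<in> InHy n"
      have 1: "(\<lambda>\<omega>. sample_hy K n ((\<lambda>j. U j \<omega>) \<circ> inv \<pi>)) -` {G} \<inter> space M =
          {\<omega> \<in> space M. sample_hy K n ((\<lambda>j. U j \<omega>) \<circ> inv \<pi>) = G}"
        and 2: "(\<lambda>\<omega>. sample_hy K n (\<lambda>j. U j \<omega>)) -` {G} \<inter> space M =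
          {\<omega> \<in> space M. sample_hy K n ((\<lambda>j. U j \<omega>) \<circ> id) = G}" by auto
      have "inj_on id {1..n}" "id ` {1..n} \<subseteq> {1..}" by auto
      note m2 = measure_sample_iid[OF K iid this]
      note m1 = measure_sample_iid[OF K iid permutes_inj_on[OF permutes_inv[OF \<pi>]] inv_sub]
      show "emeasure (distr M (count_space (InHy n)) (\<lambda>\<omega>. sample_hy K n ((\<lambda>j. U j \<omega>) \<circ> inv \<pi>))) {G} =
          emeasure (distr M (count_space (InHy n)) (\<lambda>\<omega>. sample_hy K n (\<lambda>j. U j \<omega>))) {G}"
        using G by (simp only: emeasure_distr[OF meas_rel] emeasure_distr[OF meas] 1 2
            emeasure_eq_measure m1 m2 sets_count_space Pow_iff insert_subset empty_subsetI simp_thms)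
    qed (auto intro: countable_finite finite_InHy)
  qed
qed

lemma consistent_sample:
  assumes "compact K" "iid_uniform M U"
  shows "consistent_hy M (\<lambda>n \<omega>. sample_hy K n (\<lambda>j. U j \<omega>))"
  by (rule exch_imp_consistent[OF exch_sample[OF assms]])

lemma measure_law_sample:
  assumes K: "compact K" and iid: "iid_uniform M U" and n: "1 \<le> n"
  shows "measure (hy_law M (\<lambda>n \<omega>. sample_hy K n (\<lambda>j. U j \<omega>))) (cyl n G) = sample_prob K n G"
proof -
  interpret consistent_hy M "\<lambda>n \<omega>. sample_hy K n (\<lambda>j. U j \<omega>)" by (rule consistent_sample[OF K iid])
  have "inj_on id {1..n}" "id ` {1..n} \<subseteq> {1..}" by auto
  from measure_sample_iid[OF K iid this, of G]
  have "measure M {\<omega> \<in> space M. sample_hy K n (\<lambda>j. U j \<omega>) = G} = sample_prob K n G"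
    unfolding comp_id .
  then show ?thesis using measure_hy_law_level(1)[OF n, of "\<lambda>G'. G' = G"] unfolding cyl_def by simp
qed

lemma Law_ih_altdef: "Law_ih K = hy_law unif_seq (\<lambda>n u. sample_hy K n (\<lambda>j. u j))"
  unfolding Law_ih_def by (rule refl)

lemma prob_space_Law_ih: "compact K \<Longrightarrow> prob_space (Law_ih K)"
  unfolding Law_ih_altdef
  using consistent_hy.prob_space_hy_law[OF consistent_sample[OF _ iid_uniform_coords]] .

lemma sets_Law_ih: "sets (Law_ih K) = sets hy_borel"
  unfolding Law_ih_def by (rule sets_hy_law)

lemma Law_ih_in_ExInHy: "compact K \<Longrightarrow> Law_ih K \<in> ExInHy"
  unfolding Law_ih_altdef by (rule hy_law_in_ExInHy[OF exch_sample[OF _ iid_uniform_coords]])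

lemma measure_Law_ih_cyl: "compact K \<Longrightarrow> 1 \<le> n \<Longrightarrow> measure (Law_ih K) (cyl n G) = sample_prob K n G"
  unfolding Law_ih_altdef by (rule measure_law_sample[OF _ iid_uniform_coords])

lemma hy_law_sample_eq_Law_ih:
  assumes K: "compact K" and iid: "iid_uniform M U"
  shows "hy_law M (\<lambda>n \<omega>. sample_hy K n (\<lambda>j. U j \<omega>)) = Law_ih K"
proof (rule law_eqI)
  show "prob_space (hy_law M (\<lambda>n \<omega>. sample_hy K n (\<lambda>j. U j \<omega>)))"
    by (rule consistent_hy.prob_space_hy_law[OF consistent_sample[OF K iid]])
qed (simp_all add: prob_space_Law_ih K sets_Law_ih sets_hy_law measure_Law_ih_cyl measure_law_sample[OF K iid])

text \<open>Paths of the sampled process are consistent everywhere, so the law is an image measure on \<open>InHyN\<close>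
itself.\<close>

lemma Law_ih_distr:
  assumes K: "compact K"
  shows "hy_path (sample_hy K) \<in> unif_seq \<rightarrow>\<^sub>M hy_borel"
    and "Law_ih K = distr unif_seq hy_borel (hy_path (sample_hy K))"
proof -
  have meas: "sample_hy K n \<in> unif_seq \<rightarrow>\<^sub>M count_space (InHy n)" if "1 \<le> n" for n
    using measurable_sample_hy[OF K, of n "\<lambda>j u. u j" unif_seq] measurable_coord by simp
  show p: "hy_path (sample_hy K) \<in> unif_seq \<rightarrow>\<^sub>M hy_borel"
  proof (rule measurableI)
    show "hy_path (sample_hy K) u \<in> space hy_borel" for u
      using sample_path_InHyN unfolding hy_path_def space_hy_borel by blast
    fix E assume "E \<in> sets hy_borel"
    then have "{u \<in> space unif_seq. hy_path (sample_hy K) u \<in> E} \<in> sets unif_seq"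
      by (intro emeasure_hy_law(2) meas)
    moreover have "hy_path (sample_hy K) -` E \<inter> space unif_seq = {u \<in> space unif_seq. hy_path (sample_hy K) u \<in> E}"
      by blast
    ultimately show "hy_path (sample_hy K) -` E \<inter> space unif_seq \<in> sets unif_seq" by simp
  qed
  show "Law_ih K = distr unif_seq hy_borel (hy_path (sample_hy K))"
  proof (rule measure_eqI)
    fix E assume "E \<in> sets (Law_ih K)"
    then have E: "E \<in> sets hy_borel" by (simp add: sets_Law_ih)
    have "hy_path (sample_hy K) -` E \<inter> space unif_seq = {u \<in> space unif_seq. hy_path (sample_hy K) u \<in> E}"
      by blast
    then show "emeasure (Law_ih K) E = emeasure (distr unif_seq hy_borel (hy_path (sample_hy K))) E"
      unfolding Law_ih_def by (simp only: emeasure_hy_law(1)[OF meas E] emeasure_distr[OF p E])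
  qed (simp add: sets_Law_ih)
qed

lemma borel_measurable_continuous_map:
  assumes "continuous_map X euclideanreal f"
  shows "f \<in> borel_measurable (borel_of X)"
proof (rule borel_measurableI)
  fix S :: "real set" assume "open S"
  then have "openin X {x \<in> topspace X. f x \<in> S}"
    using assms openin_continuous_map_preimage[of X euclideanreal f S] by simp
  moreover have "f -` S \<inter> space (borel_of X) = {x \<in> topspace X. f x \<in> S}"
    by (auto simp: space_borel_of)
  ultimately show "f -` S \<inter> space (borel_of X) \<in> sets (borel_of X)"
    by (simp add: sets_borel_of sigma_sets.Basic)
qed

text \<open>All laws are realised with the same sample points. Almost surely each coordinate of the sampled path is
eventually constant, so the paths converge, and dominated convergence applies.\<close>

lemma integral_Law_ih_tendsto:
  assumes Ks: "\<And>k. compact (Ks k)" and K: "compact K" and conv: "fell_conv Ks K"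
    and f: "continuous_map InHyN_topology euclideanreal f" and bdd: "bounded (f ` InHyN)"
  shows "(\<lambda>k. integral\<^sup>L (Law_ih (Ks k)) f) \<longlonglongrightarrow> integral\<^sup>L (Law_ih K) f"
proof -
  interpret prob_space unif_seq by (rule prob_space_unif_seq)
  have fm: "f \<in> borel_measurable hy_borel" by (rule borel_measurable_continuous_map[OF f])
  have int: "integral\<^sup>L (Law_ih C) f = (\<integral>u. f (hy_path (sample_hy C) u) \<partial>unif_seq)" if "compact C" for C
    unfolding Law_ih_distr(2)[OF that] by (rule integral_distr[OF Law_ih_distr(1)[OF that] fm])
  have path_in: "hy_path (sample_hy C) u \<in> InHyN" for C u
    using sample_path_InHyN unfolding hy_path_def by blast
  obtain b where b: "\<And>h. h \<in> InHyN \<Longrightarrow> norm (f h) \<le> b" using bdd unfolding bounded_iff by blast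
  have "(\<lambda>k. \<integral>u. f (hy_path (sample_hy (Ks k)) u) \<partial>unif_seq) \<longlonglongrightarrow> (\<integral>u. f (hy_path (sample_hy K) u) \<partial>unif_seq)"
  proof (rule integral_dominated_convergence[where w = "\<lambda>_. b"])
    show "(\<lambda>u. f (hy_path (sample_hy K) u)) \<in> borel_measurable unif_seq"
      by (rule measurable_compose[OF Law_ih_distr(1)[OF K] fm])
    show "(\<lambda>u. f (hy_path (sample_hy (Ks k)) u)) \<in> borel_measurable unif_seq" for k
      by (rule measurable_compose[OF Law_ih_distr(1)[OF Ks] fm])
    show "integrable unif_seq (\<lambda>_. b)" by (rule integrable_const)
    show "AE u in unif_seq. norm (f (hy_path (sample_hy (Ks k)) u)) \<le> b" for k
      using b path_in by simp
    show "AE u in unif_seq. (\<lambda>k. f (hy_path (sample_hy (Ks k)) u)) \<longlonglongrightarrow> f (hy_path (sample_hy K) u)"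
      using AE_sample_hy_fell_conv[OF K conv]
    proof eventually_elim
      case (elim u)
      show ?case
      proof (rule topological_tendstoI)
        fix S :: "real set" assume S: "open S" "f (hy_path (sample_hy K) u) \<in> S"
        have "openin InHyN_topology {h \<in> topspace InHyN_topology. f h \<in> S}"
          using f S(1) openin_continuous_map_preimage[of InHyN_topology euclideanreal f S] by simp
        moreover have "hy_path (sample_hy K) u \<in> {h \<in> topspace InHyN_topology. f h \<in> S}"
          using S(2) path_in by (simp add: topspace_InHyN)
        ultimately obtain n where n: "n \<ge> 1" "cyl n (hy_path (sample_hy K) u n) \<subseteq> {h \<in> topspace InHyN_topology. f h \<in> S}"
          unfolding openin_InHyN_iff by blast
        have "\<forall>\<^sub>F k in sequentially. sample_hy (Ks k) n u = sample_hy K n u" using elim by blast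
        then show "\<forall>\<^sub>F k in sequentially. f (hy_path (sample_hy (Ks k)) u) \<in> S"
        proof eventually_elim
          case (elim k)
          then have "hy_path (sample_hy (Ks k)) u \<in> cyl n (hy_path (sample_hy K) u n)"
            using path_in n(1) by (simp add: cyl_def hy_path_apply)
          then show ?case using n(2) by blast
        qed
      qed
    qed
  qed
  then show ?thesis by (simp add: int Ks K)
qed

lemma sample_prob_tendsto:
  assumes Ks: "\<And>k. compact (Ks k)" and K: "compact K" and conv: "fell_conv Ks K"
  shows "(\<lambda>k. sample_prob (Ks k) n G) \<longlonglongrightarrow> sample_prob K n G"
proof -
  interpret prob_space unif_seq by (rule prob_space_unif_seq)
  let ?S = "\<lambda>C. {u \<in> space unif_seq. sample_hy C n u = G}"
  have prob: "sample_prob C n G = (\<integral>u. indicator (?S C) u \<partial>unif_seq)" if "compact C" for C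
    unfolding sample_prob_def using sample_level_set[OF that, of "\<lambda>H. H = G" n] by simp
  have "(\<lambda>k. \<integral>u. indicator (?S (Ks k)) u \<partial>unif_seq) \<longlonglongrightarrow> (\<integral>u. indicator (?S K) u \<partial>unif_seq :: real)"
  proof (rule integral_dominated_convergence[where w = "\<lambda>_. 1"])
    show "AE u in unif_seq. (\<lambda>k. indicator (?S (Ks k)) u :: real) \<longlonglongrightarrow> indicator (?S K) u"
      using AE_sample_hy_fell_conv[OF K conv]
    proof eventually_elim
      case (elim u)
      then have "\<forall>\<^sub>F k in sequentially. sample_hy (Ks k) n u = sample_hy K n u" by blast
      then have "\<forall>\<^sub>F k in sequentially. (indicator (?S (Ks k)) u :: real) = indicator (?S K) u"
        by eventually_elim (simp add: indicator_def)
      then show ?case by (rule tendsto_eventually)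
    qed
    show "(\<lambda>u. indicator (?S K) u :: real) \<in> borel_measurable unif_seq"
      by (rule borel_measurable_indicator[OF sample_level_set[OF K]])
    show "(\<lambda>u. indicator (?S (Ks k)) u :: real) \<in> borel_measurable unif_seq" for k
      by (rule borel_measurable_indicator[OF sample_level_set[OF Ks]])
    show "integrable unif_seq (\<lambda>_. 1 :: real)" by (rule integrable_const)
    show "AE u in unif_seq. norm (indicator (?S (Ks k)) u :: real) \<le> 1" for k
      by (rule AE_I2) (simp add: indicator_def)
  qed
  then show ?thesis by (simp only: prob Ks K)
qed

section \<open>Mixing and the zero-one law\<close>

text \<open>The two hypergraphs are functions of sample points with disjoint sets of indices.\<close>

lemma sample_hy_indep:
  assumes K: "compact K" and inj: "inj_on \<kappa> {1..n}" and sub: "\<kappa> ` {1..n} \<subseteq> {1..} - {1..k}"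
  shows "measure unif_seq {u \<in> space unif_seq. sample_hy K k u = G' \<and> sample_hy K n (u \<circ> \<kappa>) = G} =
    sample_prob K k G' * sample_prob K n G"
proof -
  interpret prob_space unif_seq by (rule prob_space_unif_seq)
  let ?B = "\<lambda>S. \<Pi>\<^sub>M j\<in>S. (borel :: real measure)"
  let ?X = "\<lambda>u :: nat \<Rightarrow> real. restrict (\<lambda>i. u i) {1..k}" and ?Y = "\<lambda>u :: nat \<Rightarrow> real. restrict (\<lambda>i. u i) (\<kappa> ` {1..n})"
  let ?f = "\<lambda>v. sample_hy K k (\<lambda>j. v j)" and ?g = "\<lambda>v. sample_hy K n (\<lambda>j. v (\<kappa> j))"
  have "indep_vars (\<lambda>_. borel) (\<lambda>i u. u i) {1..}" using iid_uniform_coords by (simp add: iid_uniform_def)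
  then have ind: "indep_var (?B {1..k}) ?X (?B (\<kappa> ` {1..n})) ?Y"
    by (rule indep_var_restrict) (use sub in auto)
  have f: "?f \<in> ?B {1..k} \<rightarrow>\<^sub>M count_space (InHy k)"
    by (rule measurable_sample_hy[OF K]) (rule measurable_component_singleton)
  have g: "?g \<in> ?B (\<kappa> ` {1..n}) \<rightarrow>\<^sub>M count_space (InHy n)"
    by (rule measurable_sample_hy[OF K]) (rule measurable_component_singleton, rule imageI)
  have fX: "(?f \<circ> ?X) u = sample_hy K k u" for u
    unfolding o_apply by (rule sample_hy_cong) simp
  have gY: "(?g \<circ> ?Y) u = sample_hy K n (u \<circ> \<kappa>)" for u
    unfolding o_apply by (rule sample_hy_cong) simp
  have sub1: "\<kappa> ` {1..n} \<subseteq> {1..}" using sub by blast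
  show ?thesis
  proof (cases "G' \<in> InHy k \<and> G \<in> InHy n")
    case True
    have "prob ((\<lambda>u. ((?f \<circ> ?X) u, (?g \<circ> ?Y) u)) -` ({G'} \<times> {G}) \<inter> space unif_seq) =
        prob ((?f \<circ> ?X) -` {G'} \<inter> space unif_seq) * prob ((?g \<circ> ?Y) -` {G} \<inter> space unif_seq)"
      by (rule indep_varD[OF indep_var_compose[OF ind f g]]) (use True in simp_all)
    moreover have "(\<lambda>u. ((?f \<circ> ?X) u, (?g \<circ> ?Y) u)) -` ({G'} \<times> {G}) \<inter> space unif_seq =
        {u \<in> space unif_seq. sample_hy K k u = G' \<and> sample_hy K n (u \<circ> \<kappa>) = G}"
      unfolding fX gY by blast
    moreover have "(?f \<circ> ?X) -` {G'} \<inter> space unif_seq = {u \<in> space unif_seq. sample_hy K k u = G'}"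
      unfolding vimage_def fX by blast
    moreover have "(?g \<circ> ?Y) -` {G} \<inter> space unif_seq = {u \<in> space unif_seq. sample_hy K n (u \<circ> \<kappa>) = G}"
      unfolding vimage_def gY by blast
    ultimately show ?thesis
      using sample_prob_reindex[OF K inj sub1, of G] unfolding sample_prob_def by simp
  next
    case False
    then have 1: "{u \<in> space unif_seq. sample_hy K k u = G' \<and> sample_hy K n (u \<circ> \<kappa>) = G} = {}"
      using sample_hy_InHy by blast
    have 2: "{u \<in> space unif_seq. sample_hy K k u = G'} = {} \<or> {u \<in> space unif_seq. sample_hy K n u = G} = {}"
      using False sample_hy_InHy by blast
    show ?thesis unfolding 1 sample_prob_def using 2 by (elim disjE) (simp_all only: measure_empty mult_zero_left mult_zero_right)
  qed
qed

lemma measure_Law_ih: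
  assumes K: "compact K" and E: "E \<in> sets hy_borel"
  shows "measure (Law_ih K) E = measure unif_seq {u \<in> space unif_seq. hy_path (sample_hy K) u \<in> E}"
proof -
  have "hy_path (sample_hy K) -` E \<inter> space unif_seq = {u \<in> space unif_seq. hy_path (sample_hy K) u \<in> E}" by blast
  then show ?thesis unfolding Law_ih_distr(2)[OF K] measure_distr[OF Law_ih_distr(1)[OF K] E] by simp
qed

text \<open>For a cylinder of level \<open>k\<close> the product formula holds as soon as \<open>m\<close> is at least \<open>k\<close>, by
independence. The events with the limit property form a Dynkin system; for disjoint unions the limit and the series
are interchanged by Tannery's theorem, the probabilities of the single events being the summable bound.\<close>

lemma Law_ih_mixing:
  assumes K: "compact K" and n: "1 \<le> n" and E: "E \<in> sets hy_borel"
  shows "(\<lambda>m. measure (Law_ih K) (E \<inter> {h \<in> InHyN. pull n (\<lambda>j. j + m) (h (m + n)) = G}))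
    \<longlonglongrightarrow> measure (Law_ih K) E * measure (Law_ih K) (cyl n G)"
proof -
  let ?P = "Law_ih K" and ?B = "\<lambda>m. {h \<in> InHyN. pull n (\<lambda>j. j + m) (h (m + n)) = G}"
  interpret P: prob_space ?P by (rule prob_space_Law_ih[OF K])
  have inj: "inj_on (\<lambda>j. j + m) {1..n}" for m :: nat by (auto simp: inj_on_def)
  have shift_sub: "(\<lambda>j. j + m) ` {1..n} \<subseteq> {1..m + n}" for m :: nat by auto
  have B_sets: "?B m \<in> sets hy_borel" for m
    by (rule level_set_in_sets[OF refl]) (use n in simp)
  have B_P: "measure ?P (?B m) = measure ?P (cyl n G)" for m
    unfolding cyl_def by (rule ExInHyD(3)[OF Law_ih_in_ExInHy[OF K] n _ inj shift_sub]) simp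
  have "E \<in> sigma_sets InHyN cylinders" using E by (simp add: sets_hy_borel)
  with Int_stable_cylinders cylinders_Pow show ?thesis
  proof (induction rule: sigma_sets_induct_disjoint)
    case (basic A)
    then consider "A = {}" | k G' where "1 \<le> k" "A = cyl k G'" unfolding cylinders_def by auto
    then show ?case
    proof cases
      case 2
      have A_sets: "cyl k G' \<in> sets hy_borel"
        unfolding cyl_def by (rule level_set_in_sets[OF refl 2(1)])
      have eq: "measure ?P (A \<inter> ?B m) = measure ?P A * measure ?P (cyl n G)" if "k \<le> m" for m
      proof -
        have "measure ?P (A \<inter> ?B m) = measure unif_seq {u \<in> space unif_seq. hy_path (sample_hy K) u \<in> A \<inter> ?B m}"
          unfolding 2(2) by (rule measure_Law_ih[OF K sets.Int[OF A_sets B_sets]])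
        also have "{u \<in> space unif_seq. hy_path (sample_hy K) u \<in> A \<inter> ?B m} =
            {u \<in> space unif_seq. sample_hy K k u = G' \<and> sample_hy K n (u \<circ> (\<lambda>j. j + m)) = G}"
        proof -
          have "1 \<le> m + n" using n by simp
          then have "hy_path (sample_hy K) u \<in> A \<inter> ?B m \<longleftrightarrow> sample_hy K k u = G' \<and> pull n (\<lambda>j. j + m) (sample_hy K (m + n) u) = G" for u
            using sample_path_InHyN[of K u] hy_path_apply[OF 2(1), of "sample_hy K" u] hy_path_apply[of "m + n" "sample_hy K" u]
            unfolding 2(2) cyl_def hy_path_def[symmetric] by auto
          then show ?thesis unfolding pull_sample_hy[OF inj shift_sub] by blast
        qed
        also have "measure unif_seq \<dots> = sample_prob K k G' * sample_prob K n G"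
          by (rule sample_hy_indep[OF K inj]) (use that in auto)
        finally show ?thesis
          unfolding 2(2) measure_Law_ih_cyl[OF K 2(1)] measure_Law_ih_cyl[OF K n] .
      qed
      have "\<forall>\<^sub>F m in sequentially. measure ?P (A \<inter> ?B m) = measure ?P A * measure ?P (cyl n G)"
        using eventually_ge_at_top[of k] by eventually_elim (rule eq)
      then show ?thesis by (rule tendsto_eventually)
    qed simp
  next
    case empty
    show ?case by simp
  next
    case (compl A)
    have A: "A \<in> sets ?P" using compl(1) by (simp add: sets_Law_ih sets_hy_borel)
    have "measure ?P ((InHyN - A) \<inter> ?B m) = measure ?P (cyl n G) - measure ?P (A \<inter> ?B m)" for m
    proof -
      have "(InHyN - A) \<inter> ?B m = ?B m - A \<inter> ?B m" by blast
      then show ?thesis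
        using P.finite_measure_Diff[of "?B m" "A \<inter> ?B m"] A B_sets[of m] B_P[of m]
        by (simp only: sets_Law_ih Int_lower2 sets.Int)
    qed
    moreover have "measure ?P (InHyN - A) = 1 - measure ?P A"
    proof -
      have "space ?P = InHyN" using sets_eq_imp_space_eq[OF sets_Law_ih, of K] by (simp add: space_hy_borel)
      then show ?thesis using P.prob_compl[OF A] by simp
    qed
    moreover have "(\<lambda>m. measure ?P (cyl n G) - measure ?P (A \<inter> ?B m)) \<longlonglongrightarrow>
        measure ?P (cyl n G) - measure ?P A * measure ?P (cyl n G)"
      by (intro tendsto_diff tendsto_const compl(2))
    ultimately show ?case by (simp only: left_diff_distrib mult_1)
  next
    case (union A)
    have A: "A i \<in> sets ?P" for i using union(2) by (auto simp: sets_Law_ih sets_hy_borel)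
    have AB: "A i \<inter> ?B m \<in> sets ?P" for i m
      by (rule sets.Int[OF A]) (simp only: sets_Law_ih B_sets)
    have sums: "(\<lambda>i. measure ?P (A i \<inter> ?B m)) sums measure ?P ((\<Union>i. A i) \<inter> ?B m)" for m
    proof -
      have "disjoint_family (\<lambda>i. A i \<inter> ?B m)"
        using union(1) unfolding disjoint_family_on_def by blast
      then have "(\<lambda>i. measure ?P (A i \<inter> ?B m)) sums measure ?P (\<Union>i. A i \<inter> ?B m)"
        by (intro P.finite_measure_UNION) (use AB in blast)
      then show ?thesis by (simp only: Int_UN_distrib2[symmetric] UN_extend_simps)
    qed
    have sumsA: "(\<lambda>i. measure ?P (A i)) sums measure ?P (\<Union>i. A i)"
      by (intro P.finite_measure_UNION union(1)) (use A in blast)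
    have "(\<lambda>m. \<Sum>i. measure ?P (A i \<inter> ?B m)) \<longlonglongrightarrow> (\<Sum>i. measure ?P (A i) * measure ?P (cyl n G))"
    proof (rule tannerys_theorem[THEN conjunct2, THEN conjunct2])
      show "(\<lambda>m. measure ?P (A i \<inter> ?B m)) \<longlonglongrightarrow> measure ?P (A i) * measure ?P (cyl n G)" for i
        by (rule union(3))
      show "summable (\<lambda>i. measure ?P (A i))" using sumsA by (rule sums_summable)
      have "norm (measure ?P (A i \<inter> ?B m)) \<le> measure ?P (A i)" for i m
        using P.finite_measure_mono[OF Int_lower1[of "A i" "?B m"] A] by simp
      then show "\<forall>\<^sub>F (i, m) in at_top \<times>\<^sub>F sequentially. norm (measure ?P (A i \<inter> ?B m)) \<le> measure ?P (A i)"
        by (intro always_eventually) auto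
    qed simp
    moreover have "(\<Sum>i. measure ?P (A i \<inter> ?B m)) = measure ?P ((\<Union>i. A i) \<inter> ?B m)" for m
      using sums by (rule sums_unique[symmetric])
    moreover have "(\<Sum>i. measure ?P (A i) * measure ?P (cyl n G)) = measure ?P (\<Union>i. A i) * measure ?P (cyl n G)"
      using sums_mult2[OF sumsA, of "measure ?P (cyl n G)"] by (rule sums_unique[symmetric])
    ultimately show ?case by (simp only:)
  qed
qed

lemma S_infinity_act_InHyN:
  assumes pi: "\<pi> \<in> S_infinity" and h: "h \<in> InHyN"
  shows "S_infinity_act \<pi> h \<in> InHyN"
proof -
  obtain m where m: "1 \<le> m" "\<pi> permutes {1..m}"
    and act: "\<And>h n N. h \<in> InHyN \<Longrightarrow> 1 \<le> n \<Longrightarrow> n \<le> N \<Longrightarrow> m \<le> N \<Longrightarrow> S_infinity_act \<pi> h n = pull n (inv \<pi>) (h N)"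
    using S_infinity_act_eq_pull[OF pi] by blast
  have perm: "inv \<pi> permutes {1..N}" if "m \<le> N" for N
    by (rule permutes_subset[OF permutes_inv[OF m(2)]]) (use that in auto)
  have levels: "S_infinity_act \<pi> h n \<in> InHy n" if n: "1 \<le> n" for n
  proof -
    let ?N = "max n m"
    have N: "1 \<le> ?N" "n \<le> ?N" "m \<le> ?N" using n by auto
    have "inv \<pi> ` {1..n} \<subseteq> inv \<pi> ` {1..?N}" by (intro image_mono) simp
    then have "inv \<pi> ` {1..n} \<subseteq> {1..?N}" unfolding permutes_image[OF perm[OF N(3)]] .
    then have "pull n (inv \<pi>) (h ?N) \<in> InHy n"
      by (rule pull_InHy[OF InHyN_E(1)[OF h N(1)] permutes_inj_on[OF perm[OF N(3)]]])
    then show ?thesis unfolding act[OF h n N(2,3)] .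
  qed
  have restr: "S_infinity_act \<pi> h n = restrict_hy n (S_infinity_act \<pi> h (Suc n))" if n: "1 \<le> n" for n
  proof -
    let ?N = "max (Suc n) m"
    have N: "n \<le> ?N" "Suc n \<le> ?N" "m \<le> ?N" "1 \<le> Suc n" using n by auto
    have "id ` {1..n} \<subseteq> {1..Suc n}" by auto
    then show ?thesis
      unfolding act[OF h n N(1,3)] act[OF h N(4,2,3)] restrict_hy_eq_pull by (simp only: pull_pull comp_id)
  qed
  have "S_infinity_act \<pi> h n = undefined" if "n \<notin> {1..}" for n
    using that unfolding S_infinity_act_def Let_def by (simp only: restrict_apply if_False)
  then have "S_infinity_act \<pi> h \<in> (\<Pi>\<^sub>E n\<in>{1..}. InHy n)"
    using levels by (intro PiE_I) (simp_all only: atLeast_iff)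
  moreover have "\<forall>n\<in>{1..}. S_infinity_act \<pi> h n = restrict_hy n (S_infinity_act \<pi> h (Suc n))"
  proof
    fix n :: nat assume "n \<in> {1..}"
    then have "1 \<le> n" by simp
    then show "S_infinity_act \<pi> h n = restrict_hy n (S_infinity_act \<pi> h (Suc n))" by (rule restr)
  qed
  ultimately show ?thesis unfolding InHyN_def by (intro CollectI conjI)
qed

lemma inj_on_S_infinity_act:
  assumes pi: "\<pi> \<in> S_infinity"
  shows "inj_on (S_infinity_act \<pi>) InHyN"
proof (rule inj_onI)
  fix g h assume g: "g \<in> InHyN" and h: "h \<in> InHyN" and eq: "S_infinity_act \<pi> g = S_infinity_act \<pi> h"
  obtain m where m: "1 \<le> m" "\<pi> permutes {1..m}"
    and act: "\<And>h n N. h \<in> InHyN \<Longrightarrow> 1 \<le> n \<Longrightarrow> n \<le> N \<Longrightarrow> m \<le> N \<Longrightarrow> S_infinity_act \<pi> h n = pull n (inv \<pi>) (h N)"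
    using S_infinity_act_eq_pull[OF pi] by blast
  have undo: "f N = pull N \<pi> (S_infinity_act \<pi> f N)" if f: "f \<in> InHyN" and N: "m \<le> N" for f N
  proof -
    have N1: "1 \<le> N" using m(1) N by simp
    have perm: "\<pi> permutes {1..N}" by (rule permutes_subset[OF m(2)]) (use N in auto)
    have "pull N \<pi> (pull N (inv \<pi>) (f N)) = pull N (inv \<pi> \<circ> \<pi>) (f N)"
      by (rule pull_pull) (rule equalityD1[OF permutes_image[OF perm]])
    also have "inv \<pi> \<circ> \<pi> = id" by (rule permutes_inv_o(2)[OF perm])
    finally show ?thesis
      unfolding act[OF f N1 order_refl N] pull_id[OF InHyN_E(1)[OF f N1]] by (rule sym)
  qed
  show "g = h"
  proof (rule InHyN_eqI[OF g h])
    fix n :: nat assume n: "1 \<le> n"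
    have "g (max n m) = h (max n m)"
      using undo[OF g, of "max n m"] undo[OF h, of "max n m"] eq by simp
    then show "g n = h n" by (rule InHyN_eq_below[OF g h n max.cobounded1])
  qed
qed

lemma invariant_iff:
  assumes pi: "\<pi> \<in> S_infinity" and E: "E \<subseteq> InHyN" "S_infinity_act \<pi> ` E = E" and h: "h \<in> InHyN"
  shows "S_infinity_act \<pi> h \<in> E \<longleftrightarrow> h \<in> E"
  using E inj_on_image_mem_iff[OF inj_on_S_infinity_act[OF pi] h E(1)] by simp

text \<open>It suffices to compare the probabilities of cylinders, and the preimage of a cylinder under the action
is described by a pull-back along an injection.\<close>

lemma S_infinity_act_preserves:
  assumes P: "P \<in> ExInHy" and pi: "\<pi> \<in> S_infinity" and E: "E \<in> sets hy_borel"
  shows "measure P {h \<in> InHyN. S_infinity_act \<pi> h \<in> E} = measure P E"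
proof -
  note PD = ExInHyD[OF P]
  interpret P: prob_space P by (rule PD(1))
  have sp: "space P = InHyN" using sets_eq_imp_space_eq[OF PD(2)] by (simp add: space_hy_borel)
  obtain m where m: "1 \<le> m" "\<pi> permutes {1..m}"
    and act: "\<And>h n N. h \<in> InHyN \<Longrightarrow> 1 \<le> n \<Longrightarrow> n \<le> N \<Longrightarrow> m \<le> N \<Longrightarrow> S_infinity_act \<pi> h n = pull n (inv \<pi>) (h N)"
    using S_infinity_act_eq_pull[OF pi] by blast
  have lev: "{h \<in> InHyN. S_infinity_act \<pi> h \<in> cyl n G} = {h \<in> InHyN. pull n (inv \<pi>) (h (max n m)) = G}"
    if n: "1 \<le> n" for n G
    using S_infinity_act_InHyN[OF pi] act[OF _ n max.cobounded1 max.cobounded2] unfolding cyl_def by auto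
  have vim: "S_infinity_act \<pi> -` A \<inter> space P = {h \<in> InHyN. S_infinity_act \<pi> h \<in> A}" for A
    unfolding sp by blast
  have meas: "S_infinity_act \<pi> \<in> P \<rightarrow>\<^sub>M hy_borel"
  proof (rule measurable_sigma_sets[OF sets_hy_borel cylinders_Pow])
    show "S_infinity_act \<pi> \<in> space P \<rightarrow> InHyN" using S_infinity_act_InHyN[OF pi] sp by blast
    fix A assume "A \<in> cylinders"
    then consider "A = {}" | n G where "1 \<le> n" "A = cyl n G" unfolding cylinders_def by auto
    then show "S_infinity_act \<pi> -` A \<inter> space P \<in> sets P"
    proof cases
      case 2
      have "1 \<le> max n m" using 2 by simp
      then show ?thesis unfolding vim 2(2) lev[OF 2(1)] by (rule level_set_in_sets[OF PD(2)])
    qed simp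
  qed
  have "distr P hy_borel (S_infinity_act \<pi>) = P"
  proof (rule law_eqI)
    show "prob_space (distr P hy_borel (S_infinity_act \<pi>))" by (rule P.prob_space_distr[OF meas])
    fix n G assume n: "1 \<le> (n :: nat)"
    have N: "n \<le> max n m" "m \<le> max n m" by auto
    have perm: "inv \<pi> permutes {1..max n m}"
      by (rule permutes_subset[OF permutes_inv[OF m(2)]]) auto
    have "inv \<pi> ` {1..n} \<subseteq> inv \<pi> ` {1..max n m}" by (intro image_mono) simp
    then have sub: "inv \<pi> ` {1..n} \<subseteq> {1..max n m}" unfolding permutes_image[OF perm] .
    have "cyl n G \<in> sets hy_borel" unfolding cyl_def by (rule level_set_in_sets[OF refl n])
    then have "measure (distr P hy_borel (S_infinity_act \<pi>)) (cyl n G) = measure P {h \<in> InHyN. S_infinity_act \<pi> h \<in> cyl n G}"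
      unfolding vim[symmetric] by (rule measure_distr[OF meas])
    also have "\<dots> = measure P (cyl n G)"
      unfolding lev[OF n] unfolding cyl_def by (rule PD(3)[OF n N(1) permutes_inj_on[OF perm] sub])
    finally show "measure (distr P hy_borel (S_infinity_act \<pi>)) (cyl n G) = measure P (cyl n G)" .
  qed (simp_all only: PD sets_distr)
  then have "measure P E = measure (distr P hy_borel (S_infinity_act \<pi>)) E" by simp
  also have "\<dots> = measure P (S_infinity_act \<pi> -` E \<inter> space P)" by (rule measure_distr[OF meas E])
  finally show ?thesis unfolding vim by (rule sym)
qed

lemma permutes_imp_S_infinity: "\<pi> permutes {1..n} \<Longrightarrow> \<pi> \<in> S_infinity"
proof -
  assume p: "\<pi> permutes {1..n}"
  have "\<pi> permutes {1..}" by (rule permutes_subset[OF p]) auto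
  moreover have "finite {i. \<pi> i \<noteq> i}"
    by (rule finite_subset[of _ "{1..n}"]) (use permutes_not_in[OF p] in blast, simp)
  ultimately show ?thesis unfolding S_infinity_def by blast
qed

text \<open>A permutation that moves \<open>[n]\<close> to \<open>m + [n]\<close> preserves the law and the event \<open>E\<close>, so the sequence
in \<open>Law_ih_mixing\<close> is constant and \<open>E\<close> is independent of every cylinder. If \<open>E\<close> has positive
probability, conditioning on \<open>E\<close> therefore leaves the law unchanged, and so \<open>E\<close> has probability one.\<close>

lemma Law_ih_zero_one:
  assumes K: "compact K" and E: "E \<in> sets hy_borel"
    and inv_E: "\<And>\<pi>. \<pi> \<in> S_infinity \<Longrightarrow> S_infinity_act \<pi> ` E = E"
  shows "measure (Law_ih K) E \<in> {0, 1}"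
proof -
  let ?P = "Law_ih K"
  interpret P: prob_space ?P by (rule prob_space_Law_ih[OF K])
  have EI: "E \<subseteq> InHyN" using sets.sets_into_space[OF E] by (simp add: space_hy_borel)
  have EP: "E \<in> sets ?P" using E by (simp add: sets_Law_ih)
  have indep: "measure ?P (E \<inter> cyl n G) = measure ?P E * measure ?P (cyl n G)" if n: "1 \<le> n" for n G
  proof -
    have "measure ?P (E \<inter> {h \<in> InHyN. pull n (\<lambda>j. j + m) (h (m + n)) = G}) = measure ?P (E \<inter> cyl n G)" for m
    proof -
      have inj: "inj_on (\<lambda>j. j + m) {1..n}" by (auto simp: inj_on_def)
      have sub: "(\<lambda>j. j + m) ` {1..n} \<subseteq> {1..m + n}" by auto
      obtain \<kappa> where \<kappa>: "\<kappa> permutes {1..m + n}" "\<And>j. j \<in> {1..n} \<Longrightarrow> \<kappa> j = j + m"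
        using extend_injection[OF inj sub] by auto
      define \<pi> where "\<pi> = inv \<kappa>"
      have pi: "\<pi> \<in> S_infinity" "inv \<pi> = \<kappa>"
        using permutes_imp_S_infinity[OF permutes_inv[OF \<kappa>(1)]] permutes_inv_inv[OF \<kappa>(1)] by (simp_all add: \<pi>_def)
      obtain M where M: "1 \<le> M" "\<pi> permutes {1..M}"
        and act: "\<And>h n N. h \<in> InHyN \<Longrightarrow> 1 \<le> n \<Longrightarrow> n \<le> N \<Longrightarrow> M \<le> N \<Longrightarrow> S_infinity_act \<pi> h n = pull n (inv \<pi>) (h N)"
        using S_infinity_act_eq_pull[OF pi(1)] by blast
      have act_n: "S_infinity_act \<pi> h n = pull n (\<lambda>j. j + m) (h (m + n))" if h: "h \<in> InHyN" for h
      proof -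
        let ?N = "max M (m + n)"
        have "S_infinity_act \<pi> h n = pull n \<kappa> (h ?N)"
          unfolding pi(2)[symmetric] by (rule act[OF h n]) auto
        also have "\<dots> = pull n (\<lambda>j. j + m) (h ?N)" by (rule pull_cong[OF \<kappa>(2)])
        also have "\<dots> = pull n (\<lambda>j. j + m) (h (m + n))"
          by (rule InHyN_pull[OF h _ max.cobounded2 sub]) (use n in simp)
        finally show ?thesis .
      qed
      have iff: "S_infinity_act \<pi> h \<in> E \<inter> cyl n G \<longleftrightarrow> h \<in> E \<and> pull n (\<lambda>j. j + m) (h (m + n)) = G"
        if h: "h \<in> InHyN" for h
        unfolding Int_iff invariant_iff[OF pi(1) EI inv_E[OF pi(1)] h] cyl_def mem_Collect_eq act_n[OF h]
        using S_infinity_act_InHyN[OF pi(1) h] by simp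
      have eq: "{h \<in> InHyN. S_infinity_act \<pi> h \<in> E \<inter> cyl n G} = E \<inter> {h \<in> InHyN. pull n (\<lambda>j. j + m) (h (m + n)) = G}"
        using iff EI by blast
      have "cyl n G \<in> sets hy_borel" unfolding cyl_def by (rule level_set_in_sets[OF refl n])
      then show ?thesis
        unfolding eq[symmetric]
        by (intro S_infinity_act_preserves[OF Law_ih_in_ExInHy[OF K] pi(1)] sets.Int[OF E])
    qed
    then have "(\<lambda>m::nat. measure ?P (E \<inter> cyl n G)) \<longlonglongrightarrow> measure ?P E * measure ?P (cyl n G)"
      using Law_ih_mixing[OF K n E, of G] by (simp only:)
    then show ?thesis by (simp only: tendsto_const_iff[OF sequentially_bot])
  qed
  show ?thesis
  proof (cases "measure ?P E = 0")
    case False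
    let ?Q = "uniform_measure ?P E"
    have E0: "emeasure ?P E \<noteq> 0" "emeasure ?P E \<noteq> \<infinity>"
      using False by (simp_all add: P.emeasure_eq_measure)
    have "?Q = ?P"
    proof (rule law_eqI)
      show "prob_space ?Q" by (rule prob_space_uniform_measure[OF E0])
      fix n G assume n: "1 \<le> (n :: nat)"
      have "cyl n G \<in> sets ?P" unfolding cyl_def by (rule level_set_in_sets[OF sets_Law_ih n])
      then have "measure ?Q (cyl n G) = measure ?P (E \<inter> cyl n G) / measure ?P E"
        by (rule measure_uniform_measure[OF E0])
      then show "measure ?Q (cyl n G) = measure ?P (cyl n G)" using indep[OF n] False by simp
    qed (simp_all add: sets_Law_ih P.prob_space_axioms)
    moreover have "measure ?Q E = 1"
      using measure_uniform_measure[OF E0 EP] False by simp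
    ultimately show ?thesis by simp
  qed simp
qed

lemma Law_ih_in_erg: "compact K \<Longrightarrow> Law_ih K \<in> erg_ExInHy"
  unfolding erg_ExInHy_def
  by (intro CollectI conjI ballI impI Law_ih_in_ExInHy Law_ih_zero_one) (assumption | erule bspec)+

section \<open>Collisions of random maps\<close>

text \<open>A collision \<open>\<iota> a = \<iota> b\<close> determines \<open>\<iota> a\<close> by the remaining values of \<open>\<iota>\<close>, as does a prescribed
value \<open>\<iota> a = c\<close>. So each single collision costs a factor \<open>N\<close> in the number of maps.\<close>

lemma card_determined_maps:
  assumes a: "a \<in> {1..n}" and S: "S \<subseteq> {1..n} \<rightarrow>\<^sub>E {1..N}" and inj: "inj_on (\<lambda>\<iota>. \<iota>(a := undefined)) S"
  shows "card S \<le> N ^ (n - 1)"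
proof -
  have "(\<lambda>\<iota>. \<iota>(a := undefined)) ` S \<subseteq> ({1..n} - {a}) \<rightarrow>\<^sub>E {1..N}"
  proof (rule image_subsetI)
    fix \<iota> assume "\<iota> \<in> S"
    then have "\<iota> \<in> {1..n} \<rightarrow>\<^sub>E {1..N}" using S by blast
    then show "\<iota>(a := undefined) \<in> ({1..n} - {a}) \<rightarrow>\<^sub>E {1..N}"
      using a by (auto simp: PiE_iff extensional_def)
  qed
  then have "card ((\<lambda>\<iota>. \<iota>(a := undefined)) ` S) \<le> card (({1..n} - {a}) \<rightarrow>\<^sub>E {1..N})"
    by (intro card_mono finite_PiE) auto
  also have "\<dots> = N ^ (n - 1)" using a by (simp add: card_PiE)
  finally show ?thesis using card_image[OF inj] by simp
qed

lemma card_noninjective_maps: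
  "card {\<iota> \<in> {1..n} \<rightarrow>\<^sub>E {1..N}. \<not> inj_on \<iota> {1..n}} \<le> n ^ 2 * N ^ (n - 1)"
proof -
  let ?T = "{1..n} \<rightarrow>\<^sub>E {1..N}"
  let ?S = "\<lambda>p. {\<iota> \<in> ?T. fst p \<noteq> snd p \<and> \<iota> (fst p) = \<iota> (snd p)}"
  have fin: "finite ?T" by (intro finite_PiE) auto
  have S: "card (?S p) \<le> N ^ (n - 1)" if p: "p \<in> {1..n} \<times> {1..n}" for p
  proof (cases "fst p = snd p")
    case False
    show ?thesis
    proof (rule card_determined_maps)
      show "fst p \<in> {1..n}" using p by auto
      show "inj_on (\<lambda>\<iota>. \<iota>(fst p := undefined)) (?S p)"
      proof (rule inj_onI)
        fix \<iota> \<kappa> assume *: "\<iota> \<in> ?S p" "\<kappa> \<in> ?S p" "\<iota>(fst p := undefined) = \<kappa>(fst p := undefined)"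
        have other: "\<iota> x = \<kappa> x" if "x \<noteq> fst p" for x using fun_cong[OF *(3), of x] that by simp
        have "\<iota> (fst p) = \<kappa> (fst p)" using *(1,2) other[of "snd p"] False by auto
        then show "\<iota> = \<kappa>" using other by (metis ext)
      qed
    qed blast
  qed simp
  have "{\<iota> \<in> ?T. \<not> inj_on \<iota> {1..n}} \<subseteq> (\<Union>p\<in>{1..n} \<times> {1..n}. ?S p)"
    unfolding inj_on_def by fastforce
  then have "card {\<iota> \<in> ?T. \<not> inj_on \<iota> {1..n}} \<le> card (\<Union>p\<in>{1..n} \<times> {1..n}. ?S p)"
  proof (intro card_mono finite_UN_I)
    show "finite (?S p)" for p using fin by (rule rev_finite_subset) blast
  qed simp_all
  also have "\<dots> \<le> (\<Sum>p\<in>{1..n} \<times> {1..n}. card (?S p))" by (rule card_UN_le) simp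
  also have "\<dots> \<le> (\<Sum>p\<in>{1..n} \<times> {1..n}. N ^ (n - 1))" by (rule sum_mono) (rule S)
  also have "\<dots> = n ^ 2 * N ^ (n - 1)" by (simp add: card_cartesian_product power2_eq_square)
  finally show ?thesis .
qed

lemma card_colliding_pairs:
  "card {p \<in> ({1..n} \<rightarrow>\<^sub>E {1..N}) \<times> ({1..n} \<rightarrow>\<^sub>E {1..M}). fst p ` {1..n} \<inter> snd p ` {1..n} \<noteq> {}}
    \<le> n ^ 2 * N ^ (n - 1) * M ^ n"
proof -
  let ?T = "{1..n} \<rightarrow>\<^sub>E {1..N}" and ?T' = "{1..n} \<rightarrow>\<^sub>E {1..M}"
  let ?S = "\<lambda>q. {\<iota> \<in> ?T. \<iota> (fst (fst q)) = snd q (snd (fst q))} \<times> {snd q}"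
  let ?I = "({1..n} \<times> {1..n}) \<times> ?T'"
  have fin: "finite ?T" "finite ?T'" by (auto intro!: finite_PiE)
  have S: "card (?S q) \<le> N ^ (n - 1)" if q: "q \<in> ?I" for q
  proof -
    have "card {\<iota> \<in> ?T. \<iota> (fst (fst q)) = snd q (snd (fst q))} \<le> N ^ (n - 1)"
    proof (rule card_determined_maps)
      show "fst (fst q) \<in> {1..n}" using q by auto
      show "inj_on (\<lambda>\<iota>. \<iota>(fst (fst q) := undefined)) {\<iota> \<in> ?T. \<iota> (fst (fst q)) = snd q (snd (fst q))}"
      proof (rule inj_onI)
        fix \<iota> \<kappa> assume *: "\<iota> \<in> {\<iota> \<in> ?T. \<iota> (fst (fst q)) = snd q (snd (fst q))}"
          "\<kappa> \<in> {\<iota> \<in> ?T. \<iota> (fst (fst q)) = snd q (snd (fst q))}"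
          "\<iota>(fst (fst q) := undefined) = \<kappa>(fst (fst q) := undefined)"
        have "\<iota> x = \<kappa> x" for x using fun_cong[OF *(3), of x] *(1,2) by (cases "x = fst (fst q)") auto
        then show "\<iota> = \<kappa>" by (rule ext)
      qed
    qed blast
    then show ?thesis by (simp add: card_cartesian_product)
  qed
  have "{p \<in> ?T \<times> ?T'. fst p ` {1..n} \<inter> snd p ` {1..n} \<noteq> {}} \<subseteq> (\<Union>q\<in>?I. ?S q)"
  proof
    fix p assume p: "p \<in> {p \<in> ?T \<times> ?T'. fst p ` {1..n} \<inter> snd p ` {1..n} \<noteq> {}}"
    then obtain a b where ab: "a \<in> {1..n}" "b \<in> {1..n}" "fst p a = snd p b" by blast
    have "((a, b), snd p) \<in> ?I" using p ab by auto
    moreover have "p \<in> ?S ((a, b), snd p)" using p ab(3) by (cases p) auto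
    ultimately show "p \<in> (\<Union>q\<in>?I. ?S q)" by (rule UN_I)
  qed
  moreover have finI: "finite ?I" using fin by simp
  moreover have "finite (?S q)" for q using fin(1) by simp
  ultimately have "card {p \<in> ?T \<times> ?T'. fst p ` {1..n} \<inter> snd p ` {1..n} \<noteq> {}} \<le> card (\<Union>q\<in>?I. ?S q)"
    by (intro card_mono finite_UN_I)
  also have "\<dots> \<le> (\<Sum>q\<in>?I. card (?S q))" by (rule card_UN_le[OF finI])
  also have "\<dots> \<le> (\<Sum>q\<in>?I. N ^ (n - 1))" by (rule sum_mono) (rule S)
  also have "\<dots> = n ^ 2 * N ^ (n - 1) * M ^ n"
    by (simp add: card_cartesian_product card_PiE power2_eq_square)
  finally show ?thesis .
qed

text \<open>This is applied to averages over random maps, with \<open>B\<close> the maps that have collisions.\<close>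

lemma average_close_to_constant:
  fixes q :: "'a \<Rightarrow> real"
  assumes fin: "finite A" and ne: "A \<noteq> {}" and q: "\<And>a. a \<in> A \<Longrightarrow> 0 \<le> q a \<and> q a \<le> 1" and c: "0 \<le> c" "c \<le> 1"
    and good: "\<And>a. a \<in> A \<Longrightarrow> a \<notin> B \<Longrightarrow> q a = c"
  shows "\<bar>(\<Sum>a\<in>A. q a) / card A - c\<bar> \<le> card (A \<inter> B) / card A"
proof -
  have pos: "card A > 0" using fin ne by (simp add: card_gt_0_iff)
  have "(\<Sum>a\<in>A. q a) - c * card A = (\<Sum>a\<in>A. q a - c)" by (simp add: sum_subtractf)
  also have "\<bar>\<dots>\<bar> \<le> (\<Sum>a\<in>A. \<bar>q a - c\<bar>)" by (rule sum_abs)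
  also have "\<dots> \<le> (\<Sum>a\<in>A. if a \<in> B then 1 else 0)"
  proof (rule sum_mono)
    fix a assume a: "a \<in> A"
    show "\<bar>q a - c\<bar> \<le> (if a \<in> B then 1 else 0)" using q[OF a] c good[OF a] by auto
  qed
  also have "\<dots> = card (A \<inter> B)" by (simp add: sum.If_cases fin)
  finally have "\<bar>(\<Sum>a\<in>A. q a) - c * card A\<bar> \<le> card (A \<inter> B)" .
  moreover have "(\<Sum>a\<in>A. q a) / card A - c = ((\<Sum>a\<in>A. q a) - c * card A) / card A"
    using pos by (simp add: field_simps)
  ultimately show ?thesis using pos by (simp add: divide_right_mono)
qed

section \<open>The interval system of a finite hypergraph\<close>

text \<open>The probability that \<open>n\<close> vertices drawn with replacement from the vertices \<open>1, \<dots>, N\<close> of \<open>H\<close>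
induce the hypergraph \<open>G\<close>.\<close>

definition pull_freq :: "nat \<Rightarrow> nat set set \<Rightarrow> nat \<Rightarrow> nat set set \<Rightarrow> real" where
  "pull_freq n G N H = card {\<iota> \<in> {1..n} \<rightarrow>\<^sub>E {1..N}. pull n \<iota> H = G} / real N ^ n"

lemma finite_maps: "finite ({1..n::nat} \<rightarrow>\<^sub>E {1..N::nat})"
  by (intro finite_PiE) auto

lemma card_maps: "card ({1..n::nat} \<rightarrow>\<^sub>E {1..N::nat}) = N ^ n"
  by (simp add: card_PiE)

lemma pull_freq_sum: "pull_freq n G N H = (\<Sum>\<iota>\<in>{1..n} \<rightarrow>\<^sub>E {1..N}. of_bool (pull n \<iota> H = G)) / real N ^ n"
proof -
  have "(\<Sum>\<iota>\<in>{1..n} \<rightarrow>\<^sub>E {1..N}. of_bool (pull n \<iota> H = G) :: real) = card {\<iota> \<in> {1..n} \<rightarrow>\<^sub>E {1..N}. pull n \<iota> H = G}"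
  proof -
    have "real (card {\<iota> \<in> {1..n} \<rightarrow>\<^sub>E {1..N}. pull n \<iota> H = G}) = (\<Sum>\<iota>\<in>{\<iota> \<in> {1..n} \<rightarrow>\<^sub>E {1..N}. pull n \<iota> H = G}. 1)"
      by simp
    also have "\<dots> = (\<Sum>\<iota>\<in>{1..n} \<rightarrow>\<^sub>E {1..N}. if pull n \<iota> H = G then 1 else 0)"
      by (rule sum.inter_filter[OF finite_maps])
    finally show ?thesis unfolding of_bool_def by (rule sym)
  qed
  then show ?thesis unfolding pull_freq_def by simp
qed

text \<open>The position of a vertex is the number of vertices that do not come after it.\<close>

lemma linear_order_position:
  assumes l: "linear_order_on {1..N::nat} l"
  obtains pos where "bij_betw pos {1..N} {1..N::nat}"
    "\<And>a b. a \<in> {1..N} \<Longrightarrow> b \<in> {1..N} \<Longrightarrow> (a, b) \<in> l \<longleftrightarrow> pos a \<le> pos b"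
proof -
  define D where "D a = {c \<in> {1..N}. (c, a) \<in> l}" for a
  define pos where "pos a = card (D a)" for a
  have fin: "finite (D a)" for a unfolding D_def by simp
  have trans: "trans l" and anti: "antisym l"
    and refl: "\<And>a. a \<in> {1..N} \<Longrightarrow> (a, a) \<in> l"
    and tot: "\<And>a b. a \<in> {1..N} \<Longrightarrow> b \<in> {1..N} \<Longrightarrow> a \<noteq> b \<Longrightarrow> (a, b) \<in> l \<or> (b, a) \<in> l"
    using l unfolding linear_order_on_def partial_order_on_def preorder_on_def refl_on_def total_on_def by blast+
  have mono: "pos a \<le> pos b" if "(a, b) \<in> l" for a b
    unfolding pos_def by (intro card_mono fin) (use that transD[OF trans] in \<open>auto simp: D_def\<close>)
  have smono: "pos a < pos b" if "(a, b) \<in> l" "a \<noteq> b" "b \<in> {1..N}" for a b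
  proof -
    have "D a \<subseteq> D b" using that(1) transD[OF trans] by (auto simp: D_def)
    moreover have "b \<in> D b" using refl[OF that(3)] that(3) by (simp add: D_def)
    moreover have "b \<notin> D a" using antisymD[OF anti] that(1,2) by (auto simp: D_def)
    ultimately have "D a \<subset> D b" by blast
    then show ?thesis unfolding pos_def by (rule psubset_card_mono[OF fin])
  qed
  have iff: "(a, b) \<in> l \<longleftrightarrow> pos a \<le> pos b" if ab: "a \<in> {1..N}" "b \<in> {1..N}" for a b
  proof
    assume le: "pos a \<le> pos b"
    show "(a, b) \<in> l"
    proof (rule ccontr)
      assume nl: "(a, b) \<notin> l"
      then have "a \<noteq> b" using refl[OF ab(1)] by blast
      then have "(b, a) \<in> l" using tot[OF ab] nl by blast
      then have "pos b < pos a" using smono \<open>a \<noteq> b\<close> ab(1) by blast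
      then show False using le by simp
    qed
  qed (rule mono)
  have inj: "inj_on pos {1..N}"
  proof (rule inj_onI)
    fix a b assume ab: "a \<in> {1..N}" "b \<in> {1..N}" "pos a = pos b"
    then have "(a, b) \<in> l" "(b, a) \<in> l" using iff by simp_all
    then show "a = b" using antisymD[OF anti] by blast
  qed
  have "pos a \<in> {1..N}" if a: "a \<in> {1..N}" for a
  proof -
    have "a \<in> D a" using a refl[OF a] by (simp add: D_def)
    then have "pos a > 0" unfolding pos_def using fin by (auto simp: card_gt_0_iff)
    moreover have "pos a \<le> card {1..N}" unfolding pos_def by (intro card_mono) (auto simp: D_def)
    ultimately show ?thesis by simp
  qed
  then have "pos ` {1..N} = {1..N}" using inj by (intro endo_inj_surj) auto
  then have "bij_betw pos {1..N} {1..N}" using inj by (simp add: bij_betw_def)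
  then show thesis using that iff by blast
qed

text \<open>The vertex at position \<open>i\<close> is represented by the cell between \<open>(i - 1) / N\<close> and \<open>i / N\<close>, and a
nonempty edge by the smallest interval that contains the cells of its vertices.\<close>

definition interval_system :: "nat \<Rightarrow> (nat \<Rightarrow> nat) \<Rightarrow> nat set set \<Rightarrow> (real \<times> real) set" where
  "interval_system N pos H = (\<lambda>x. (x, x)) ` {0..1} \<union>
     (\<lambda>e. ((real (Min (pos ` e)) - 1) / N, real (Max (pos ` e)) / N)) ` (H - {{}})"

lemma interval_system_InSy:
  assumes H: "H \<in> InHy N" and N: "1 \<le> N" and pos: "bij_betw pos {1..N} {1..N}"
  shows "interval_system N pos H \<in> InSy"
proof -
  have "finite H" using finite_subset[OF InHy_subset_Pow[OF H]] by simp
  then have "compact ((\<lambda>e. ((real (Min (pos ` e)) - 1) / N, real (Max (pos ` e)) / N)) ` (H - {{}}))"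
    by (intro finite_imp_compact) simp
  moreover have "compact ((\<lambda>x::real. (x, x)) ` {0..1})"
    by (intro compact_continuous_image continuous_intros) simp
  ultimately have "compact (interval_system N pos H)" unfolding interval_system_def by (intro compact_Un)
  moreover have "interval_system N pos H \<subseteq> {(x, y). 0 \<le> x \<and> x \<le> y \<and> y \<le> 1}"
  proof -
    have "0 \<le> (real (Min (pos ` e)) - 1) / N \<and> (real (Min (pos ` e)) - 1) / N \<le> real (Max (pos ` e)) / N \<and> real (Max (pos ` e)) / N \<le> 1"
      if e: "e \<in> H - {{}}" for e
    proof -
      have sub: "e \<subseteq> {1..N}" and ne: "e \<noteq> {}" using e InHy_subset_Pow[OF H] by auto
      have fin: "finite (pos ` e)" "pos ` e \<noteq> {}" using finite_subset[OF sub] ne by auto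
      have rng: "pos ` e \<subseteq> {1..N}" using sub pos unfolding bij_betw_def by blast
      have "Min (pos ` e) \<in> {1..N}" "Max (pos ` e) \<in> {1..N}" "Min (pos ` e) \<le> Max (pos ` e)"
        using Min_in[OF fin] Max_in[OF fin] rng Min_le[OF fin(1) Max_in[OF fin]] by blast+
      then have "1 \<le> real (Min (pos ` e))" "real (Min (pos ` e)) \<le> real (Max (pos ` e))" "real (Max (pos ` e)) \<le> real N"
        by simp_all
      then show ?thesis using N by (auto intro!: divide_right_mono)
    qed
    then show ?thesis unfolding interval_system_def by auto
  qed
  moreover have "\<forall>x\<in>{0..1}. (x, x) \<in> interval_system N pos H" unfolding interval_system_def by blast
  ultimately show ?thesis unfolding InSy_def by blast
qed

text \<open>The interval of an edge is a union of cells, since the edge is an interval for the linear order. So a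
sample point inside the cell of the vertex \<open>\<iota> j\<close> belongs to the interval iff \<open>\<iota> j\<close> belongs to the edge.\<close>

lemma sample_interval_system:
  assumes H: "H \<in> InHy N" and N: "1 \<le> N" and pos: "bij_betw pos {1..N} {1..N}"
    and l: "\<And>a b. a \<in> {1..N} \<Longrightarrow> b \<in> {1..N} \<Longrightarrow> (a, b) \<in> l \<longleftrightarrow> pos a \<le> pos b"
    and iv: "\<And>e. e \<in> H \<Longrightarrow> interval_wrt N l e"
    and \<iota>: "\<iota> ` {1..n} \<subseteq> {1..N}" "inj_on \<iota> {1..n}"
    and u: "\<And>j. j \<in> {1..n} \<Longrightarrow> (real (pos (\<iota> j)) - 1) / N < u j \<and> u j < real (pos (\<iota> j)) / N"
  shows "sample_hy (interval_system N pos H) n u = pull n \<iota> H"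
proof -
  have Npos: "real N > 0" using N by simp
  have edge: "{j \<in> {1..n}. (real (Min (pos ` e)) - 1) / N < u j \<and> u j < real (Max (pos ` e)) / N} = {j \<in> {1..n}. \<iota> j \<in> e}"
    if e: "e \<in> H - {{}}" for e
  proof -
    let ?a = "Min (pos ` e)" and ?b = "Max (pos ` e)"
    have sub: "e \<subseteq> {1..N}" and ne: "e \<noteq> {}" using e InHy_subset_Pow[OF H] by auto
    have fin: "finite (pos ` e)" "pos ` e \<noteq> {}" using finite_subset[OF sub] ne by auto
    obtain a where a: "a \<in> e" "pos a = ?a" using Min_in[OF fin] by force
    obtain b where b: "b \<in> e" "pos b = ?b" using Max_in[OF fin] by force
    have mem: "c \<in> e \<longleftrightarrow> ?a \<le> pos c \<and> pos c \<le> ?b" if c: "c \<in> {1..N}" for c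
    proof
      assume "c \<in> e"
      then show "?a \<le> pos c \<and> pos c \<le> ?b" using fin by (intro conjI Min_le Max_ge) auto
    next
      assume *: "?a \<le> pos c \<and> pos c \<le> ?b"
      have "a \<in> {1..N}" "b \<in> {1..N}" using a(1) b(1) sub by blast+
      then have "(a, c) \<in> l" "(c, b) \<in> l" using l c * a(2) b(2) by simp_all
      moreover have "interval_wrt N l e" using iv e by blast
      ultimately show "c \<in> e" using a(1) b(1) c unfolding interval_wrt_def by blast
    qed
    have "(real ?a - 1) / N < u j \<and> u j < real ?b / N \<longleftrightarrow> \<iota> j \<in> e" if j: "j \<in> {1..n}" for j
    proof -
      have "\<iota> j \<in> {1..N}" using \<iota>(1) j by blast
      note m = mem[OF this]
      let ?p = "pos (\<iota> j)"
      have 1: "(real ?a - 1) / N < u j \<longleftrightarrow> ?a \<le> ?p"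
      proof (cases "?a \<le> ?p")
        case True
        then have "(real ?a - 1) / N \<le> (real ?p - 1) / N" using Npos by (intro divide_right_mono) simp_all
        then show ?thesis using True u[OF j] by linarith
      next
        case False
        then have "real ?p \<le> real ?a - 1" by linarith
        then have "real ?p / N \<le> (real ?a - 1) / N" using Npos by (intro divide_right_mono) simp_all
        then show ?thesis using False u[OF j] by linarith
      qed
      have 2: "u j < real ?b / N \<longleftrightarrow> ?p \<le> ?b"
      proof (cases "?p \<le> ?b")
        case True
        then have "real ?p / N \<le> real ?b / N" using Npos by (intro divide_right_mono) simp_all
        then show ?thesis using True u[OF j] by linarith
      next
        case False
        then have "real ?b \<le> real ?p - 1" by linarith
        then have "real ?b / N \<le> (real ?p - 1) / N" using Npos by (intro divide_right_mono) simp_all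
        then show ?thesis using False u[OF j] by linarith
      qed
      show ?thesis unfolding m using 1 2 by blast
    qed
    then show ?thesis by blast
  qed
  let ?f = "\<lambda>p. {j \<in> {1..n}. fst p < u j \<and> u j < snd p}" and ?g = "\<lambda>e. {j \<in> {1..n}. \<iota> j \<in> e}"
  have G: "pull n \<iota> H \<in> InHy n" by (rule pull_InHy[OF H \<iota>(2,1)])
  have "{{j \<in> {1..n}. x < u j \<and> u j < y} | x y. (x, y) \<in> interval_system N pos H} = ?f ` interval_system N pos H"
    by force
  also have "\<dots> = {{}} \<union> ?g ` (H - {{}})"
  proof -
    have "?f ` (\<lambda>x. (x, x)) ` {0..1} = {{}}"
    proof
      show "?f ` (\<lambda>x. (x, x)) ` {0..1} \<subseteq> {{}}" by auto
      have "?f (0, 0) = {}" by auto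
      moreover have "(0, 0) \<in> (\<lambda>x::real. (x, x)) ` {0..1}" by simp
      ultimately have mem: "{} \<in> ?f ` (\<lambda>x. (x, x)) ` {0..1}" by (intro image_eqI[of _ ?f "(0, 0)"]) simp_all
      show "{{}} \<subseteq> ?f ` (\<lambda>x. (x, x)) ` {0..1}"
        by (rule subsetI, drule singletonD, erule ssubst) (rule mem)
    qed
    moreover have "?f ` (\<lambda>e. ((real (Min (pos ` e)) - 1) / N, real (Max (pos ` e)) / N)) ` (H - {{}}) = ?g ` (H - {{}})"
      unfolding image_image fst_conv snd_conv by (rule image_cong[OF refl edge])
    ultimately show ?thesis unfolding interval_system_def image_Un by (simp only:)
  qed
  finally have "sample_hy (interval_system N pos H) n u = {{}} \<union> ?g ` (H - {{}}) \<union> {{j} | j. j \<in> {1..n}} \<union> {{}}"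
    unfolding sample_hy_def by (simp only:)
  also have "\<dots> = ?g ` H"
  proof -
    have "{} \<in> ?g ` H" "{{j} | j. j \<in> {1..n}} \<subseteq> ?g ` H"
      using G unfolding pull_def InHy_def by blast+
    moreover have "?g ` H \<subseteq> {{}} \<union> ?g ` (H - {{}})" by auto
    moreover have "?g ` (H - {{}}) \<subseteq> ?g ` H" by (rule image_mono) blast
    ultimately show ?thesis by blast
  qed
  finally show ?thesis unfolding pull_def .
qed

lemma measure_unif_interval:
  assumes "0 \<le> a" "a \<le> b" "b \<le> (1::real)"
  shows "emeasure unif {a<..<b} = ennreal (b - a)"
proof -
  have "{0..1} \<inter> {a<..<b} = {a<..<b}" using assms by auto
  then show ?thesis using assms by (subst emeasure_uniform_measure) (auto simp: divide_ennreal_def)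
qed

text \<open>Almost surely each sample point lies in the interior of a cell, and the cells visited by the points
are independent and uniformly distributed. If they are distinct, the sampled hypergraph is the pull-back of
\<open>H\<close> along the map from indices to vertices that they define. The error is at most the probability
that they are not distinct.\<close>

lemma interval_system_sample_prob:
  assumes H: "H \<in> InHy N" and N: "1 \<le> N"
  obtains K where "K \<in> InSy" "\<And>n G. \<bar>sample_prob K n G - pull_freq n G N H\<bar> \<le> real n ^ 2 * real N ^ (n - 1) / real N ^ n"
proof -
  obtain l where lin: "linear_order_on {1..N} l" and iv: "\<And>e. e \<in> H \<Longrightarrow> interval_wrt N l e"
    using H unfolding InHy_def by blast
  obtain pos where pos: "bij_betw pos {1..N} {1..N}"
    and l: "\<And>a b. a \<in> {1..N} \<Longrightarrow> b \<in> {1..N} \<Longrightarrow> (a, b) \<in> l \<longleftrightarrow> pos a \<le> pos b"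
    using linear_order_position[OF lin] by blast
  define K where "K = interval_system N pos H"
  have K: "K \<in> InSy" unfolding K_def by (rule interval_system_InSy[OF H N pos])
  interpret U: prob_space unif_seq by (rule prob_space_unif_seq)
  have Npos: "real N > 0" using N by simp
  have bound: "\<bar>sample_prob K n G - pull_freq n G N H\<bar> \<le> real n ^ 2 * real N ^ (n - 1) / real N ^ n" for n G
  proof -
    let ?T = "{1..n} \<rightarrow>\<^sub>E {1..N}"
    define J where "J i = {(real i - 1) / N <..< real i / N}" for i :: nat
    define C where "C \<iota> = prod_emb {1..} (\<lambda>_. unif) {1..n} (\<Pi>\<^sub>E j\<in>{1..n}. J (pos (\<iota> j)))" for \<iota>
    have C_iff: "u \<in> C \<iota> \<longleftrightarrow> u \<in> space unif_seq \<and> (\<forall>j\<in>{1..n}. u j \<in> J (pos (\<iota> j)))" for u \<iota>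
      unfolding C_def prod_emb_def space_PiM by (auto simp: PiE_iff)
    have C_sets: "C \<iota> \<in> sets unif_seq" for \<iota>
      unfolding C_def by (rule sets_PiM_I) (auto simp: J_def)
    have pos_in: "pos i \<in> {1..N}" if "i \<in> {1..N}" for i using pos that unfolding bij_betw_def by blast
    have C_prob: "measure unif_seq (C \<iota>) = 1 / real N ^ n" if \<iota>: "\<iota> \<in> ?T" for \<iota>
    proof -
      have "emeasure unif_seq (C \<iota>) = (\<Prod>j\<in>{1..n}. emeasure unif (J (pos (\<iota> j))))"
        unfolding C_def by (rule emeasure_PiM_emb[OF prob_space_unif]) (auto simp: J_def)
      also have "\<dots> = (\<Prod>j\<in>{1..n}. ennreal (1 / N))"
      proof (rule prod.cong[OF refl])
        fix j assume "j \<in> {1..n}"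
        then have p: "1 \<le> pos (\<iota> j)" "pos (\<iota> j) \<le> N" using pos_in[OF PiE_mem[OF \<iota>]] by auto
        then have "emeasure unif (J (pos (\<iota> j))) = ennreal (real (pos (\<iota> j)) / N - (real (pos (\<iota> j)) - 1) / N)"
          unfolding J_def using Npos by (intro measure_unif_interval) (auto simp: divide_simps)
        also have "real (pos (\<iota> j)) / N - (real (pos (\<iota> j)) - 1) / N = 1 / N" by (simp add: diff_divide_distrib)
        finally show "emeasure unif (J (pos (\<iota> j))) = ennreal (1 / N)" .
      qed
      also have "\<dots> = ennreal ((1 / N) ^ n)" by (simp add: ennreal_power)
      finally show ?thesis unfolding measure_def by (simp add: power_divide)
    qed
    have J_disj: "J i \<inter> J i' = {}" if "i \<noteq> i'" for i i'
    proof -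
      have "real i / N \<le> (real i' - 1) / N \<or> real i' / N \<le> (real i - 1) / N"
      proof (cases "i < i'")
        case True
        then have "real i \<le> real i' - 1" by linarith
        then have "real i / N \<le> (real i' - 1) / N" using Npos by (intro divide_right_mono) simp_all
        then show ?thesis by blast
      next
        case False
        then have "real i' \<le> real i - 1" using that by linarith
        then have "real i' / N \<le> (real i - 1) / N" using Npos by (intro divide_right_mono) simp_all
        then show ?thesis by blast
      qed
      then show ?thesis unfolding J_def by auto
    qed
    \<comment> \<open>The events \<open>C \<iota>\<close> that the points lie in the cells prescribed by \<open>\<iota>\<close> partition the sample space up to a null set.\<close>
    have disj: "disjoint_family_on C ?T"
      unfolding disjoint_family_on_def
    proof (intro ballI impI)
      fix \<iota> \<kappa> assume *: "\<iota> \<in> ?T" "\<kappa> \<in> ?T" "\<iota> \<noteq> \<kappa>"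
      then obtain j where j: "j \<in> {1..n}" "\<iota> j \<noteq> \<kappa> j" using PiE_ext[OF *(1,2)] by blast
      have "\<iota> j \<in> {1..N}" "\<kappa> j \<in> {1..N}" using PiE_mem[OF *(1) j(1)] PiE_mem[OF *(2) j(1)] .
      then have "pos (\<iota> j) \<noteq> pos (\<kappa> j)" using j(2) pos unfolding bij_betw_def inj_on_def by blast
      then show "C \<iota> \<inter> C \<kappa> = {}" using J_disj j(1) C_iff by blast
    qed
    let ?S = "{u \<in> space unif_seq. sample_hy K n u = G}"
    have S_sets: "?S \<in> sets unif_seq" by (rule sample_level_set[OF InSy_D(1)[OF K]])
    have "measure unif_seq (\<Union>\<iota>\<in>?T. C \<iota>) = (\<Sum>\<iota>\<in>?T. measure unif_seq (C \<iota>))"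
      by (rule U.finite_measure_finite_Union[OF finite_maps _ disj]) (use C_sets in blast)
    also have "\<dots> = (\<Sum>\<iota>\<in>?T. 1 / real N ^ n)" by (rule sum.cong[OF refl C_prob])
    also have "\<dots> = 1" unfolding sum_constant card_maps using Npos by simp
    finally have full: "measure unif_seq (\<Union>\<iota>\<in>?T. C \<iota>) = 1" .
    have UC: "(\<Union>\<iota>\<in>?T. C \<iota>) \<in> sets unif_seq" by (intro sets.finite_UN finite_maps C_sets)
    have "sample_prob K n G = measure unif_seq (?S \<inter> (\<Union>\<iota>\<in>?T. C \<iota>))"
    proof -
      have ae: "AE u in unif_seq. u \<in> (\<Union>\<iota>\<in>?T. C \<iota>)"
        using U.prob_eq_1[OF UC] full by (rule iffD1)
      show ?thesis
        unfolding sample_prob_def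
      proof (rule U.finite_measure_eq_AE[OF _ S_sets sets.Int[OF S_sets UC]])
        show "AE u in unif_seq. (u \<in> ?S) = (u \<in> ?S \<inter> (\<Union>\<iota>\<in>?T. C \<iota>))"
          using ae by (rule AE_mp) (rule AE_I2, rule impI, simp only: Int_iff simp_thms)
      qed
    qed
    also have "?S \<inter> (\<Union>\<iota>\<in>?T. C \<iota>) = (\<Union>\<iota>\<in>?T. ?S \<inter> C \<iota>)" by blast
    also have "measure unif_seq \<dots> = (\<Sum>\<iota>\<in>?T. measure unif_seq (?S \<inter> C \<iota>))"
    proof (rule U.finite_measure_finite_Union[OF finite_maps])
      show "disjoint_family_on (\<lambda>\<iota>. ?S \<inter> C \<iota>) ?T" using disj unfolding disjoint_family_on_def by blast
    qed (use S_sets C_sets in blast)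
    finally have sp: "sample_prob K n G = (\<Sum>\<iota>\<in>?T. measure unif_seq (?S \<inter> C \<iota>))" .
    have pf: "pull_freq n G N H = (\<Sum>\<iota>\<in>?T. of_bool (pull n \<iota> H = G) / real N ^ n)"
      unfolding pull_freq_sum by (simp add: sum_divide_distrib)
    let ?D = "{\<iota> \<in> ?T. \<not> inj_on \<iota> {1..n}}"
    have "\<bar>sample_prob K n G - pull_freq n G N H\<bar> \<le> (\<Sum>\<iota>\<in>?T. \<bar>measure unif_seq (?S \<inter> C \<iota>) - of_bool (pull n \<iota> H = G) / real N ^ n\<bar>)"
      unfolding sp pf sum_subtractf[symmetric] by (rule sum_abs)
    also have "\<dots> \<le> (\<Sum>\<iota>\<in>?T. if \<iota> \<in> ?D then 1 / real N ^ n else 0)"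
    proof (rule sum_mono)
      fix \<iota> assume \<iota>: "\<iota> \<in> ?T"
      show "\<bar>measure unif_seq (?S \<inter> C \<iota>) - of_bool (pull n \<iota> H = G) / real N ^ n\<bar> \<le> (if \<iota> \<in> ?D then 1 / real N ^ n else 0)"
      proof (cases "inj_on \<iota> {1..n}")
        case True
        have sub: "\<iota> ` {1..n} \<subseteq> {1..N}" using \<iota> by blast
        have "sample_hy K n u = pull n \<iota> H" if "u \<in> C \<iota>" for u
          unfolding K_def
        proof (rule sample_interval_system[OF H N pos l iv sub True])
          show "(real (pos (\<iota> j)) - 1) / N < u j \<and> u j < real (pos (\<iota> j)) / N" if "j \<in> {1..n}" for j
            using \<open>u \<in> C \<iota>\<close> that unfolding C_iff J_def by simp
        qed
        then have "?S \<inter> C \<iota> = (if pull n \<iota> H = G then C \<iota> else {})" using C_iff by auto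
        then show ?thesis using C_prob[OF \<iota>] True by simp
      next
        case False
        have "measure unif_seq (?S \<inter> C \<iota>) \<le> 1 / real N ^ n"
          using U.finite_measure_mono[OF Int_lower2[of ?S "C \<iota>"] C_sets] C_prob[OF \<iota>] by simp
        moreover have "0 \<le> of_bool (pull n \<iota> H = G) / real N ^ n" "of_bool (pull n \<iota> H = G) / real N ^ n \<le> 1 / real N ^ n"
          by (auto intro!: divide_right_mono)
        moreover have "0 \<le> measure unif_seq (?S \<inter> C \<iota>)" by (rule measure_nonneg)
        ultimately have "\<bar>measure unif_seq (?S \<inter> C \<iota>) - of_bool (pull n \<iota> H = G) / real N ^ n\<bar> \<le> 1 / real N ^ n"
          by linarith
        moreover have "\<iota> \<in> ?D" using False \<iota> by blast
        ultimately show ?thesis by (simp only: if_True)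
      qed
    qed
    also have "\<dots> = card ?D / real N ^ n"
    proof -
      have "(\<Sum>\<iota>\<in>?T. if \<iota> \<in> ?D then 1 / real N ^ n else 0) = (\<Sum>\<iota>\<in>{\<iota> \<in> ?T. \<iota> \<in> ?D}. 1 / real N ^ n)"
        by (subst sum.inter_filter[OF finite_maps]) simp
      also have "{\<iota> \<in> ?T. \<iota> \<in> ?D} = ?D" by blast
      finally show ?thesis by simp
    qed
    also have "\<dots> \<le> real (n ^ 2 * N ^ (n - 1)) / real N ^ n"
      using card_noninjective_maps[of n N] by (intro divide_right_mono) (simp_all only: of_nat_le_iff of_nat_0_le_iff zero_le_power)
    finally show ?thesis by simp
  qed
  show thesis using that[OF K bound] .
qed

section \<open>Frequencies in an exchangeable hypergraph\<close>

lemma (in prob_space) prob_finite_decomposition: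
  assumes "finite A" "\<And>x. x \<in> S \<Longrightarrow> f x \<in> A" "\<And>a. a \<in> A \<Longrightarrow> {x \<in> S. f x = a} \<in> sets M"
  shows "measure M {x \<in> S. Q (f x)} = (\<Sum>a\<in>{a \<in> A. Q a}. measure M {x \<in> S. f x = a})"
proof -
  have "{x \<in> S. Q (f x)} = (\<Union>a\<in>{a \<in> A. Q a}. {x \<in> S. f x = a})" using assms(2) by blast
  also have "measure M \<dots> = (\<Sum>a\<in>{a \<in> A. Q a}. measure M {x \<in> S. f x = a})"
    by (rule finite_measure_finite_Union) (use assms in \<open>auto simp: disjoint_family_on_def\<close>)
  finally show ?thesis .
qed

lemma measure_level_sum:
  assumes "prob_space P" "sets P = sets hy_borel" "1 \<le> n"
  shows "measure P {h \<in> InHyN. Q (h n)} = (\<Sum>G\<in>{G \<in> InHy n. Q G}. measure P (cyl n G))"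
proof -
  interpret prob_space P by fact
  show ?thesis
    unfolding cyl_def
    by (rule prob_finite_decomposition[OF finite_InHy InHyN_E(1)[OF _ assms(3)] level_set_in_sets[OF assms(2,3)]])
qed

text \<open>The finite range of the pull-back allows passing from its point probabilities to arbitrary
predicates.\<close>

lemma ExInHy_pull_pred:
  assumes P: "P \<in> ExInHy" and n: "1 \<le> n" "n \<le> N" and inj: "inj_on \<iota> {1..n}" and sub: "\<iota> ` {1..n} \<subseteq> {1..N}"
  shows "measure P {h \<in> InHyN. Q (pull n \<iota> (h N))} = measure P {h \<in> InHyN. Q (h n)}"
proof -
  note PD = ExInHyD[OF P]
  interpret prob_space P by (rule PD(1))
  have N: "1 \<le> N" using n by simp
  have "measure P {h \<in> InHyN. Q (pull n \<iota> (h N))} = (\<Sum>G\<in>{G \<in> InHy n. Q G}. measure P {h \<in> InHyN. pull n \<iota> (h N) = G})"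
    by (rule prob_finite_decomposition[OF finite_InHy pull_InHy[OF InHyN_E(1)[OF _ N] inj sub] level_set_in_sets[OF PD(2) N]])
  also have "\<dots> = (\<Sum>G\<in>{G \<in> InHy n. Q G}. measure P (cyl n G))"
    unfolding cyl_def by (rule sum.cong[OF refl PD(3)[OF n inj sub]])
  also have "\<dots> = measure P {h \<in> InHyN. Q (h n)}"
    by (rule measure_level_sum[OF PD(1,2) n(1), symmetric])
  finally show ?thesis .
qed

lemma pull_freq_bounds: "0 \<le> pull_freq n G N H" "pull_freq n G N H \<le> 1"
proof -
  show "0 \<le> pull_freq n G N H" unfolding pull_freq_def by simp
  have "card {\<iota> \<in> {1..n} \<rightarrow>\<^sub>E {1..N}. pull n \<iota> H = G} \<le> card ({1..n} \<rightarrow>\<^sub>E {1..N})"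
    by (rule card_mono[OF finite_maps]) blast
  then have "real (card {\<iota> \<in> {1..n} \<rightarrow>\<^sub>E {1..N}. pull n \<iota> H = G}) \<le> real (N ^ n)"
    unfolding card_maps by (simp only: of_nat_le_iff)
  then show "pull_freq n G N H \<le> 1" unfolding pull_freq_def of_nat_power
    by (cases "real N ^ n = 0") (simp_all add: divide_le_eq_1)
qed

text \<open>Composition with \<open>\<rho>\<close> permutes the maps over which the frequency is an average.\<close>

lemma pull_freq_permute:
  assumes \<rho>: "\<rho> permutes {1..N}"
  shows "pull_freq n G N (pull N \<rho> H) = pull_freq n G N H"
proof -
  let ?T = "{1..n} \<rightarrow>\<^sub>E {1..N}"
  have rho_in: "\<rho> i \<in> {1..N}" "inv \<rho> i \<in> {1..N}" if "i \<in> {1..N}" for i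
    using that permutes_in_image[OF \<rho>, of i] permutes_in_image[OF permutes_inv[OF \<rho>], of i] by simp_all
  have comp: "pull n \<iota> (pull N \<rho> H) = pull n (\<lambda>j\<in>{1..n}. \<rho> (\<iota> j)) H" if \<iota>: "\<iota> \<in> ?T" for \<iota>
  proof -
    have "\<iota> ` {1..n} \<subseteq> {1..N}" using \<iota> by blast
    from pull_pull[OF this] have "pull n \<iota> (pull N \<rho> H) = pull n (\<rho> \<circ> \<iota>) H" .
    also have "\<dots> = pull n (\<lambda>j\<in>{1..n}. \<rho> (\<iota> j)) H" by (rule pull_cong) simp
    finally show ?thesis .
  qed
  have "bij_betw (\<lambda>\<iota>. \<lambda>j\<in>{1..n}. \<rho> (\<iota> j)) {\<iota> \<in> ?T. pull n \<iota> (pull N \<rho> H) = G} {\<iota> \<in> ?T. pull n \<iota> H = G}"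
  proof (rule bij_betw_byWitness[where f' = "\<lambda>\<iota>. \<lambda>j\<in>{1..n}. inv \<rho> (\<iota> j)"])
    have fwd: "(\<lambda>j\<in>{1..n}. \<rho> (\<iota> j)) \<in> ?T" if \<iota>: "\<iota> \<in> ?T" for \<iota>
      by (intro restrict_PiE_iff[THEN iffD2] ballI rho_in(1) PiE_mem[OF \<iota>])
    have bwd: "(\<lambda>j\<in>{1..n}. inv \<rho> (\<iota> j)) \<in> ?T" if \<iota>: "\<iota> \<in> ?T" for \<iota>
      by (intro restrict_PiE_iff[THEN iffD2] ballI rho_in(2) PiE_mem[OF \<iota>])
    have undo: "(\<lambda>j\<in>{1..n}. \<sigma> ((\<lambda>j\<in>{1..n}. \<tau> (\<iota> j)) j)) = \<iota>"
      if \<iota>: "\<iota> \<in> ?T" and st: "\<And>i. \<sigma> (\<tau> i) = i" for \<iota> \<sigma> \<tau>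
    proof (rule ext)
      fix j
      show "(\<lambda>j\<in>{1..n}. \<sigma> ((\<lambda>j\<in>{1..n}. \<tau> (\<iota> j)) j)) j = \<iota> j"
      proof (cases "j \<in> {1..n}")
        case True then show ?thesis by (simp only: restrict_apply if_True st)
      next
        case False then show ?thesis by (simp only: restrict_apply if_False PiE_arb[OF \<iota> False])
      qed
    qed
    have lr: "(\<lambda>j\<in>{1..n}. inv \<rho> ((\<lambda>j\<in>{1..n}. \<rho> (\<iota> j)) j)) = \<iota>" if "\<iota> \<in> ?T" for \<iota>
      by (rule undo[OF that, of "inv \<rho>" \<rho>]) (rule permutes_inverses(2)[OF \<rho>])
    have rl: "(\<lambda>j\<in>{1..n}. \<rho> ((\<lambda>j\<in>{1..n}. inv \<rho> (\<iota> j)) j)) = \<iota>" if "\<iota> \<in> ?T" for \<iota>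
      by (rule undo[OF that, of \<rho> "inv \<rho>"]) (rule permutes_inverses(1)[OF \<rho>])
    show "\<forall>\<iota>\<in>{\<iota> \<in> ?T. pull n \<iota> (pull N \<rho> H) = G}. (\<lambda>j\<in>{1..n}. inv \<rho> ((\<lambda>j\<in>{1..n}. \<rho> (\<iota> j)) j)) = \<iota>"
      using lr by blast
    show "\<forall>\<iota>\<in>{\<iota> \<in> ?T. pull n \<iota> H = G}. (\<lambda>j\<in>{1..n}. \<rho> ((\<lambda>j\<in>{1..n}. inv \<rho> (\<iota> j)) j)) = \<iota>"
      using rl by blast
    show "(\<lambda>\<iota>. \<lambda>j\<in>{1..n}. \<rho> (\<iota> j)) ` {\<iota> \<in> ?T. pull n \<iota> (pull N \<rho> H) = G} \<subseteq> {\<iota> \<in> ?T. pull n \<iota> H = G}"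
      using fwd comp by blast
    show "(\<lambda>\<iota>. \<lambda>j\<in>{1..n}. inv \<rho> (\<iota> j)) ` {\<iota> \<in> ?T. pull n \<iota> H = G} \<subseteq> {\<iota> \<in> ?T. pull n \<iota> (pull N \<rho> H) = G}"
    proof (rule image_subsetI)
      fix \<iota> assume "\<iota> \<in> {\<iota> \<in> ?T. pull n \<iota> H = G}"
      then have \<iota>: "\<iota> \<in> ?T" "pull n \<iota> H = G" by blast+
      have "pull n (\<lambda>j\<in>{1..n}. inv \<rho> (\<iota> j)) (pull N \<rho> H) = G"
        unfolding comp[OF bwd[OF \<iota>(1)]] rl[OF \<iota>(1)] by (rule \<iota>(2))
      then show "(\<lambda>j\<in>{1..n}. inv \<rho> (\<iota> j)) \<in> {\<iota> \<in> ?T. pull n \<iota> (pull N \<rho> H) = G}" using bwd[OF \<iota>(1)] by blast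
    qed
  qed
  then show ?thesis unfolding pull_freq_def by (simp only: bij_betw_same_card)
qed

lemma power_pred_ratio: "1 \<le> n \<Longrightarrow> 1 \<le> N \<Longrightarrow> real (k * N ^ (n - 1)) / real N ^ n = real k / real N"
  by (cases n) simp_all

locale exch_law =
  fixes P :: "(nat \<Rightarrow> nat set set) measure"
  assumes ex: "P \<in> ExInHy"
begin

sublocale prob_space P by (rule ExInHyD(1)[OF ex])

lemma sets_P: "sets P = sets hy_borel" by (rule ExInHyD(2)[OF ex])

lemma space_P: "space P = InHyN"
  using sets_eq_imp_space_eq[OF sets_P] by (simp add: space_hy_borel)

lemma borel_measurable_level:
  assumes "1 \<le> n"
  shows "(\<lambda>h. g (h n) :: real) \<in> borel_measurable P"
proof -
  have "(\<lambda>h. h n) \<in> P \<rightarrow>\<^sub>M count_space (InHy n)"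
    by (rule consistent_hy.meas[OF consistent_coords(1)[OF prob_space_axioms sets_P] assms])
  then show ?thesis by (rule measurable_compose) simp
qed

lemma integrable_bounded_level:
  assumes "1 \<le> n" "\<And>H. \<bar>g H\<bar> \<le> B"
  shows "integrable P (\<lambda>h. g (h n) :: real)"
  by (rule integrable_const_bound[where B = B]) (use assms borel_measurable_level in auto)

abbreviation freq :: "nat \<Rightarrow> nat set set \<Rightarrow> nat \<Rightarrow> (nat \<Rightarrow> nat set set) \<Rightarrow> real" where
  "freq n G N h \<equiv> pull_freq n G N (h N)"

lemma integral_level_indicator:
  assumes "1 \<le> N"
  shows "(\<integral>h. of_bool (Q (h N)) \<partial>P) = measure P {h \<in> InHyN. Q (h N)}"
    and "integrable P (\<lambda>h. of_bool (Q (h N)) :: real)"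
proof -
  have s: "{h \<in> InHyN. Q (h N)} \<in> sets P" by (rule level_set_in_sets[OF sets_P assms])
  have "(\<integral>h. of_bool (Q (h N)) \<partial>P) = (\<integral>h. indicator {h \<in> InHyN. Q (h N)} h \<partial>P :: real)"
    by (rule Bochner_Integration.integral_cong) (simp_all add: space_P indicator_def)
  also have "\<dots> = measure P {h \<in> InHyN. Q (h N)}" using s by simp
  finally show "(\<integral>h. of_bool (Q (h N)) \<partial>P) = measure P {h \<in> InHyN. Q (h N)}" .
  show "integrable P (\<lambda>h. of_bool (Q (h N)) :: real)"
    by (rule integrable_bounded_level[OF assms, where B = 1]) simp
qed

text \<open>By exchangeability all injective maps contribute the same probability, and the others are rare.\<close>

lemma mean_freq:
  assumes n: "1 \<le> n" and N: "1 \<le> N"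
  shows "\<bar>(\<integral>h. freq n G N h \<partial>P) - measure P (cyl n G)\<bar> \<le> real n ^ 2 / real N"
proof -
  let ?T = "{1..n} \<rightarrow>\<^sub>E {1..N}" and ?q = "\<lambda>\<iota>. measure P {h \<in> InHyN. pull n \<iota> (h N) = G}"
  let ?D = "{\<iota>. \<not> inj_on \<iota> {1..n}}"
  have I1: "(\<integral>h. of_bool (pull n \<iota> (h N) = G) \<partial>P) = ?q \<iota>"
    and I2: "integrable P (\<lambda>h. of_bool (pull n \<iota> (h N) = G) :: real)" for \<iota>
    by (rule integral_level_indicator[OF N, of "\<lambda>H. pull n \<iota> H = G"])+
  have "(\<integral>h. freq n G N h \<partial>P) = (\<integral>h. (\<Sum>\<iota>\<in>?T. of_bool (pull n \<iota> (h N) = G)) \<partial>P) / N ^ n"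
    unfolding pull_freq_sum by simp
  also have "(\<integral>h. (\<Sum>\<iota>\<in>?T. of_bool (pull n \<iota> (h N) = G)) \<partial>P) = (\<Sum>\<iota>\<in>?T. \<integral>h. of_bool (pull n \<iota> (h N) = G) \<partial>P :: real)"
    by (rule Bochner_Integration.integral_sum) (rule I2)
  also have "\<dots> = (\<Sum>\<iota>\<in>?T. ?q \<iota>)"
    by (rule sum.cong[OF refl I1])
  finally have "(\<integral>h. freq n G N h \<partial>P) = (\<Sum>\<iota>\<in>?T. ?q \<iota>) / card ?T" by (simp only: card_maps of_nat_power)
  moreover have "\<bar>(\<Sum>\<iota>\<in>?T. ?q \<iota>) / card ?T - measure P (cyl n G)\<bar> \<le> card (?T \<inter> ?D) / card ?T"
  proof (rule average_close_to_constant[OF finite_maps])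
    have "card ?T \<noteq> 0" unfolding card_maps using N by simp
    then show "?T \<noteq> {}" by (metis card.empty)
    fix \<iota> assume \<iota>: "\<iota> \<in> ?T" "\<iota> \<notin> ?D"
    then have inj: "inj_on \<iota> {1..n}" and sub: "\<iota> ` {1..n} \<subseteq> {1..N}" by blast+
    have "n \<le> N" using card_inj_on_le[OF inj sub] by simp
    then show "?q \<iota> = measure P (cyl n G)" unfolding cyl_def by (intro ExInHyD(3)[OF ex n _ inj sub])
  qed simp_all
  moreover have "card (?T \<inter> ?D) / card ?T \<le> real n ^ 2 / real N"
  proof -
    have "card (?T \<inter> ?D) \<le> n ^ 2 * N ^ (n - 1)"
      using card_noninjective_maps[of n N] by (simp only: Int_def mem_Collect_eq)
    then have "card (?T \<inter> ?D) / card ?T \<le> real (n ^ 2 * N ^ (n - 1)) / real N ^ n"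
      unfolding card_maps of_nat_power by (intro divide_right_mono) (simp_all only: of_nat_le_iff of_nat_0_le_iff zero_le_power)
    then show ?thesis unfolding power_pred_ratio[OF n N] by simp
  qed
  ultimately show ?thesis by linarith
qed

text \<open>By exchangeability this is the probability that the hypergraphs induced on any two given disjoint lists of
\<open>n\<close> distinct indices are both \<open>G\<close>; see \<open>pair_prob_pull\<close>.\<close>

definition pair_prob :: "nat \<Rightarrow> nat set set \<Rightarrow> real" where
  "pair_prob n G = measure P {h \<in> InHyN. pull n id (h (n + n)) = G \<and> pull n (\<lambda>j. j + n) (h (n + n)) = G}"

text \<open>The two injections are glued to a single one on \<open>[n + n]\<close>.\<close>

lemma pair_prob_pull:
  assumes n: "1 \<le> n" and NM: "1 \<le> N" "N \<le> M"
    and \<iota>: "inj_on \<iota> {1..n}" "\<iota> ` {1..n} \<subseteq> {1..N}" and \<kappa>: "inj_on \<kappa> {1..n}" "\<kappa> ` {1..n} \<subseteq> {1..M}"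
    and disj: "\<iota> ` {1..n} \<inter> \<kappa> ` {1..n} = {}"
  shows "measure P {h \<in> InHyN. pull n \<iota> (h N) = G \<and> pull n \<kappa> (h M) = G} = pair_prob n G"
proof -
  define \<mu> where "\<mu> j = (if j \<le> n then \<iota> j else \<kappa> (j - n))" for j
  have low: "\<mu> j = \<iota> j" if "j \<in> {1..n}" for j using that by (simp add: \<mu>_def)
  have high: "\<mu> (j + n) = \<kappa> j" if "j \<in> {1..n}" for j using that by (simp add: \<mu>_def)
  have shift_img: "(\<lambda>j. j + n) ` {1..n} = {n + 1..n + n}"
    by (simp add: add.commute)
  have split: "{1..n + n} = {1..n} \<union> (\<lambda>j. j + n) ` {1..n}" unfolding shift_img by auto
  have img_low: "\<mu> ` {1..n} = \<iota> ` {1..n}" by (rule image_cong[OF refl low])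
  have img_high: "\<mu> ` (\<lambda>j. j + n) ` {1..n} = \<kappa> ` {1..n}" unfolding image_image by (rule image_cong[OF refl high])
  have "inj_on \<mu> {1..n}" using \<iota>(1) by (subst inj_on_cong[OF low]) 
  moreover have "inj_on \<mu> ((\<lambda>j. j + n) ` {1..n})"
  proof (rule inj_onI)
    fix x y assume "x \<in> (\<lambda>j. j + n) ` {1..n}" "y \<in> (\<lambda>j. j + n) ` {1..n}" "\<mu> x = \<mu> y"
    then obtain a b where ab: "a \<in> {1..n}" "b \<in> {1..n}" "x = a + n" "y = b + n" "\<kappa> a = \<kappa> b"
      using high by fastforce
    then show "x = y" using inj_onD[OF \<kappa>(1)] by blast
  qed
  ultimately have inj: "inj_on \<mu> {1..n + n}"
    unfolding split using disj img_low img_high by (intro inj_on_Un[THEN iffD2]) blast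
  have \<iota>M: "\<iota> ` {1..n} \<subseteq> {1..M}" by (rule subset_trans[OF \<iota>(2)]) (use NM in auto)
  have sub: "\<mu> ` {1..n + n} \<subseteq> {1..M}" unfolding split image_Un img_low img_high using \<iota>M \<kappa>(2) by (rule Un_least)
  have "n + n \<le> M" using card_inj_on_le[OF inj sub] by simp
  have low_sub: "id ` {1..n} \<subseteq> {1..n + n}" and high_sub: "(\<lambda>j. j + n) ` {1..n} \<subseteq> {1..n + n}" by auto
  have eq1: "pull n \<iota> (h N) = pull n id (pull (n + n) \<mu> (h M))" if h: "h \<in> InHyN" for h
  proof -
    have "pull n \<iota> (h N) = pull n \<iota> (h M)" by (rule InHyN_pull[OF h NM \<iota>(2), symmetric])
    also have "\<dots> = pull n (\<mu> \<circ> id) (h M)" by (rule pull_cong) (simp add: low)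
    finally show ?thesis unfolding pull_pull[OF low_sub] .
  qed
  have eq2: "pull n \<kappa> H = pull n (\<lambda>j. j + n) (pull (n + n) \<mu> H)" for H
    unfolding pull_pull[OF high_sub] by (rule pull_cong) (simp add: high)
  have "{h \<in> InHyN. pull n \<iota> (h N) = G \<and> pull n \<kappa> (h M) = G} =
    {h \<in> InHyN. pull n id (pull (n + n) \<mu> (h M)) = G \<and> pull n (\<lambda>j. j + n) (pull (n + n) \<mu> (h M)) = G}"
    using eq1 eq2 by auto
  then show ?thesis
    unfolding pair_prob_def
    using ExInHy_pull_pred[OF ex _ \<open>n + n \<le> M\<close> inj sub, of "\<lambda>H. pull n id H = G \<and> pull n (\<lambda>j. j + n) H = G"] n
    by simp
qed

text \<open>The product of two frequencies is an average over pairs of maps. A pair without collisions contributes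
\<open>pair_prob n G\<close>. The three kinds of collisions, within the first map, within the second and between them, each
have a share of at most \<open>n\<^sup>2 / N\<close>.\<close>

lemma correlation_freq:
  assumes n: "1 \<le> n" and NM: "1 \<le> N" "N \<le> M"
  shows "\<bar>(\<integral>h. freq n G N h * freq n G M h \<partial>P) - pair_prob n G\<bar> \<le> 3 * real n ^ 2 / real N"
proof -
  let ?T = "{1..n} \<rightarrow>\<^sub>E {1..N}" and ?T' = "{1..n} \<rightarrow>\<^sub>E {1..M}"
  let ?q = "\<lambda>p. measure P {h \<in> InHyN. pull n (fst p) (h N) = G \<and> pull n (snd p) (h M) = G}"
  have M: "1 \<le> M" using NM by simp
  have sM: "h N = pull N id (h M)" if "h \<in> InHyN" for h by (rule InHyN_restrict[OF that NM])
  have joint: "of_bool (pull n (fst p) (h N) = G) * of_bool (pull n (snd p) (h M) = G) =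
      (of_bool (pull n (fst p) (pull N id (h M)) = G \<and> pull n (snd p) (h M) = G) :: real)" if "h \<in> InHyN" for h p
    using sM[OF that] by simp
  have "(\<integral>h. freq n G N h * freq n G M h \<partial>P) =
     (\<integral>h. (\<Sum>p\<in>?T \<times> ?T'. of_bool (pull n (fst p) (pull N id (h M)) = G \<and> pull n (snd p) (h M) = G)) / (real N ^ n * real M ^ n) \<partial>P)"
  proof (rule Bochner_Integration.integral_cong[OF refl])
    fix h assume "h \<in> space P"
    then have h: "h \<in> InHyN" by (simp add: space_P)
    have "(\<Sum>\<iota>\<in>?T. of_bool (pull n \<iota> (h N) = G) :: real) * (\<Sum>\<kappa>\<in>?T'. of_bool (pull n \<kappa> (h M) = G)) =
        (\<Sum>p\<in>?T \<times> ?T'. of_bool (pull n (fst p) (h N) = G) * of_bool (pull n (snd p) (h M) = G))"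
      unfolding sum_product sum.cartesian_product by (simp only: split_def)
    also have "\<dots> = (\<Sum>p\<in>?T \<times> ?T'. of_bool (pull n (fst p) (pull N id (h M)) = G \<and> pull n (snd p) (h M) = G))"
      by (rule sum.cong[OF refl joint[OF h]])
    finally show "freq n G N h * freq n G M h = (\<Sum>p\<in>?T \<times> ?T'. of_bool (pull n (fst p) (pull N id (h M)) = G \<and> pull n (snd p) (h M) = G)) / (real N ^ n * real M ^ n)"
      unfolding pull_freq_sum by (simp only: times_divide_times_eq of_nat_power)
  qed
  also have "\<dots> = (\<integral>h. (\<Sum>p\<in>?T \<times> ?T'. of_bool (pull n (fst p) (pull N id (h M)) = G \<and> pull n (snd p) (h M) = G)) \<partial>P) / (real N ^ n * real M ^ n)"
    by simp
  also have "(\<integral>h. (\<Sum>p\<in>?T \<times> ?T'. of_bool (pull n (fst p) (pull N id (h M)) = G \<and> pull n (snd p) (h M) = G)) \<partial>P) =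
      (\<Sum>p\<in>?T \<times> ?T'. \<integral>h. of_bool (pull n (fst p) (pull N id (h M)) = G \<and> pull n (snd p) (h M) = G) \<partial>P :: real)"
  proof (rule Bochner_Integration.integral_sum)
    show "integrable P (\<lambda>h. of_bool (pull n (fst p) (pull N id (h M)) = G \<and> pull n (snd p) (h M) = G) :: real)" for p
      by (rule integral_level_indicator(2)[OF M, of "\<lambda>H. pull n (fst p) (pull N id H) = G \<and> pull n (snd p) H = G"])
  qed
  also have "\<dots> = (\<Sum>p\<in>?T \<times> ?T'. ?q p)"
  proof (rule sum.cong[OF refl])
    fix p
    have "{h \<in> InHyN. pull n (fst p) (pull N id (h M)) = G \<and> pull n (snd p) (h M) = G} =
        {h \<in> InHyN. pull n (fst p) (h N) = G \<and> pull n (snd p) (h M) = G}"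
      using sM by auto
    then show "(\<integral>h. of_bool (pull n (fst p) (pull N id (h M)) = G \<and> pull n (snd p) (h M) = G) \<partial>P) = ?q p"
      using integral_level_indicator(1)[OF M, of "\<lambda>H. pull n (fst p) (pull N id H) = G \<and> pull n (snd p) H = G"] by (simp only:)
  qed
  finally have int: "(\<integral>h. freq n G N h * freq n G M h \<partial>P) = (\<Sum>p\<in>?T \<times> ?T'. ?q p) / card (?T \<times> ?T')"
    by (simp only: card_cartesian_product card_maps of_nat_mult of_nat_power)
  let ?D = "{\<iota> \<in> ?T. \<not> inj_on \<iota> {1..n}}" and ?D' = "{\<iota> \<in> ?T'. \<not> inj_on \<iota> {1..n}}"
  let ?C = "{p \<in> ?T \<times> ?T'. fst p ` {1..n} \<inter> snd p ` {1..n} \<noteq> {}}"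
  let ?B = "?D \<times> ?T' \<union> ?T \<times> ?D' \<union> ?C"
  have "\<bar>(\<Sum>p\<in>?T \<times> ?T'. ?q p) / card (?T \<times> ?T') - pair_prob n G\<bar> \<le> card (?T \<times> ?T' \<inter> ?B) / card (?T \<times> ?T')"
  proof (rule average_close_to_constant)
    show "finite (?T \<times> ?T')" by (intro finite_cartesian_product finite_maps)
    have "card (?T \<times> ?T') \<noteq> 0" unfolding card_cartesian_product card_maps using NM by simp
    then show "?T \<times> ?T' \<noteq> {}" by (metis card.empty)
    show "0 \<le> pair_prob n G" "pair_prob n G \<le> 1" unfolding pair_prob_def by simp_all
    fix p assume p: "p \<in> ?T \<times> ?T'"
    show "0 \<le> ?q p \<and> ?q p \<le> 1" by simp
    assume pB: "p \<notin> ?B"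
    have "fst p \<in> ?T" "snd p \<in> ?T'" using p by auto
    then have "inj_on (fst p) {1..n}" "inj_on (snd p) {1..n}" "fst p ` {1..n} \<inter> snd p ` {1..n} = {}"
      "fst p ` {1..n} \<subseteq> {1..N}" "snd p ` {1..n} \<subseteq> {1..M}"
      using p pB by (auto simp: mem_Times_iff simp del: atLeastAtMost_iff)
    then show "?q p = pair_prob n G" by (intro pair_prob_pull[OF n NM])
  qed
  moreover have "card (?T \<times> ?T' \<inter> ?B) / card (?T \<times> ?T') \<le> 3 * real n ^ 2 / real N"
  proof -
    have fin: "finite ?T" "finite ?T'" by (rule finite_maps)+
    have "card (?T \<times> ?T' \<inter> ?B) \<le> card ?B"
      by (rule card_mono) (use fin in simp_all)
    also have "\<dots> \<le> card (?D \<times> ?T') + card (?T \<times> ?D') + card ?C"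
      by (rule order_trans[OF card_Un_le add_right_mono[OF card_Un_le]])
    also have "\<dots> \<le> n ^ 2 * N ^ (n - 1) * M ^ n + N ^ n * (n ^ 2 * M ^ (n - 1)) + n ^ 2 * N ^ (n - 1) * M ^ n"
      unfolding card_cartesian_product card_maps
      by (intro add_mono mult_mono card_noninjective_maps card_colliding_pairs) simp_all
    finally have "real (card (?T \<times> ?T' \<inter> ?B)) \<le> real (n ^ 2 * N ^ (n - 1) * M ^ n + N ^ n * (n ^ 2 * M ^ (n - 1)) + n ^ 2 * N ^ (n - 1) * M ^ n)"
      by (simp only: of_nat_le_iff)
    then have "card (?T \<times> ?T' \<inter> ?B) / card (?T \<times> ?T') \<le>
        real (n ^ 2 * N ^ (n - 1) * M ^ n + N ^ n * (n ^ 2 * M ^ (n - 1)) + n ^ 2 * N ^ (n - 1) * M ^ n) / (real N ^ n * real M ^ n)"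
      unfolding card_cartesian_product card_maps of_nat_mult of_nat_power
      by (intro divide_right_mono) (simp_all add: mult_nonneg_nonneg)
    also have "\<dots> = real (n ^ 2 * N ^ (n - 1)) / real N ^ n + real (n ^ 2 * M ^ (n - 1)) / real M ^ n + real (n ^ 2 * N ^ (n - 1)) / real N ^ n"
    proof -
      have pos: "real N ^ n > 0" "real M ^ n > 0" using NM M by simp_all
      have "(x * b + a * y + x * b) / (a * b) = x / a + y / b + x / a" if "a > 0" "b > 0" for a b x y :: real
        using that by (simp add: field_simps)
      from this[OF pos, of "real (n ^ 2 * N ^ (n - 1))" "real (n ^ 2 * M ^ (n - 1))"]
      show ?thesis by (simp only: of_nat_add of_nat_mult of_nat_power)
    qed
    also have "\<dots> = real n ^ 2 / real N + real n ^ 2 / real M + real n ^ 2 / real N"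
      unfolding power_pred_ratio[OF n NM(1)] power_pred_ratio[OF n M] of_nat_power ..
    also have "\<dots> \<le> 3 * real n ^ 2 / real N"
    proof -
      have "real n ^ 2 / real M \<le> real n ^ 2 / real N" by (rule divide_left_mono) (use NM in auto)
      then show ?thesis by (simp add: field_simps)
    qed
    finally show ?thesis .
  qed
  ultimately show ?thesis unfolding int by linarith
qed

lemma integrable_freq: "1 \<le> N \<Longrightarrow> integrable P (freq n G N)"
  using pull_freq_bounds[of n G N] by (intro integrable_bounded_level[where B = 1]) (auto simp: abs_le_iff intro: order_trans[of _ 0])

lemma measurable_freq: "1 \<le> N \<Longrightarrow> freq n G N \<in> borel_measurable P"
  by (rule borel_measurable_level)

lemma integrable_freq_mult: "1 \<le> N \<Longrightarrow> 1 \<le> M \<Longrightarrow> integrable P (\<lambda>h. freq n G N h * freq n G M h)"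
proof (rule integrable_const_bound[where B = 1])
  assume "1 \<le> N" "1 \<le> M"
  then show "(\<lambda>h. freq n G N h * freq n G M h) \<in> borel_measurable P"
    by (intro borel_measurable_times measurable_freq)
  show "AE h in P. norm (freq n G N h * freq n G M h) \<le> 1"
    by (rule AE_I2) (simp add: abs_mult mult_le_one pull_freq_bounds)
qed

text \<open>When the square is expanded, the three expectations agree up to the error in \<open>correlation_freq\<close> and
cancel.\<close>

lemma freq_cauchy:
  assumes n: "1 \<le> n" and NM: "1 \<le> N" "N \<le> M"
  shows "(\<integral>h. (freq n G M h - freq n G N h)\<^sup>2 \<partial>P) \<le> 12 * real n ^ 2 / real N"
proof -
  have M: "1 \<le> M" using NM by simp
  have "(\<integral>h. (freq n G M h - freq n G N h)\<^sup>2 \<partial>P) =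
      (\<integral>h. freq n G M h * freq n G M h + freq n G N h * freq n G N h - 2 * (freq n G N h * freq n G M h) \<partial>P)"
    by (simp add: power2_eq_square algebra_simps)
  also have "\<dots> = (\<integral>h. freq n G M h * freq n G M h \<partial>P) + (\<integral>h. freq n G N h * freq n G N h \<partial>P) - 2 * (\<integral>h. freq n G N h * freq n G M h \<partial>P)"
    using integrable_freq_mult NM M by simp
  finally have "(\<integral>h. (freq n G M h - freq n G N h)\<^sup>2 \<partial>P) = \<dots>" .
  moreover have "3 * real n ^ 2 / real M \<le> 3 * real n ^ 2 / real N" using NM by (intro divide_left_mono) auto
  ultimately show ?thesis
    using correlation_freq[OF n M order_refl, of G] correlation_freq[OF n NM(1) order_refl, of G] correlation_freq[OF n NM, of G]
    by simp
qed

text \<open>Along the powers of 4 the increments have mean absolute value of order \<open>(1 / 2) ^ k\<close>, so the sum of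
their absolute values has finite mean and is almost surely finite.\<close>

lemma AE_freq_convergent:
  assumes n: "1 \<le> n"
  shows "AE h in P. convergent (\<lambda>k. freq n G (4 ^ k) h)"
proof -
  define d where "d k h = freq n G (4 ^ Suc k) h - freq n G (4 ^ k) h" for k h
  define C where "C = (12 * real n ^ 2 + 1) / 2"
  have C: "C \<ge> 0" by (simp add: C_def)
  have one: "1 \<le> (4::nat) ^ k" for k by simp
  have d_int: "integrable P (d k)" for k
    unfolding d_def by (intro Bochner_Integration.integrable_diff integrable_freq one)
  have d2_int: "integrable P (\<lambda>h. (d k h)\<^sup>2)" for k
  proof (rule integrable_const_bound[where B = 1])
    show "(\<lambda>h. (d k h)\<^sup>2) \<in> borel_measurable P" using d_int[of k] by simp
    have "\<bar>d k h\<bar> \<le> 1" for h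
      unfolding d_def using pull_freq_bounds[of n G "4 ^ Suc k" "h (4 ^ Suc k)"] pull_freq_bounds[of n G "4 ^ k" "h (4 ^ k)"]
      by linarith
    then show "AE h in P. norm ((d k h)\<^sup>2) \<le> 1" by (intro AE_I2) (simp add: abs_square_le_1)
  qed
  have d_bound: "(\<integral>h. \<bar>d k h\<bar> \<partial>P) \<le> C * (1 / 2) ^ k" for k
  proof -
    \<comment> \<open>The weight \<open>s\<close> balances the two terms of the inequality below, as the mean square is of order \<open>1 / s\<^sup>2\<close>.\<close>
    define s :: real where "s = 2 ^ k"
    have s: "s > 0" and s2: "s * s = 4 ^ k" by (simp_all add: s_def power_mult_distrib[symmetric])
    have "\<bar>x\<bar> \<le> (s * x\<^sup>2 + 1 / s) / 2" for x :: real
    proof -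
      have "0 \<le> (s * \<bar>x\<bar> - 1)\<^sup>2 / s" using s by simp
      also have "(s * \<bar>x\<bar> - 1)\<^sup>2 / s = s * x\<^sup>2 - 2 * \<bar>x\<bar> + 1 / s"
        using s by (simp add: power2_eq_square field_simps)
      finally show ?thesis by simp
    qed
    then have "(\<integral>h. \<bar>d k h\<bar> \<partial>P) \<le> (\<integral>h. (s * (d k h)\<^sup>2 + 1 / s) / 2 \<partial>P)"
      using d_int d2_int by (intro integral_mono) auto
    also have "\<dots> = (s * (\<integral>h. (d k h)\<^sup>2 \<partial>P) + 1 / s) / 2"
      using d2_int[of k] by (simp add: prob_space)
    also have "\<dots> \<le> (s * (12 * real n ^ 2 / 4 ^ k) + 1 / s) / 2"
    proof -
      have "(\<integral>h. (d k h)\<^sup>2 \<partial>P) \<le> 12 * real n ^ 2 / 4 ^ k"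
        using freq_cauchy[OF n one[of k], of "4 ^ Suc k" G] unfolding d_def by simp
      then show ?thesis using s by (intro divide_right_mono add_right_mono mult_left_mono) simp_all
    qed
    also have "\<dots> = C * (1 / 2) ^ k"
      unfolding s2[symmetric] C_def using s by (simp add: s_def[symmetric] field_simps power_divide)
    finally show ?thesis .
  qed
  have "(\<integral>\<^sup>+h. (\<Sum>k. ennreal \<bar>d k h\<bar>) \<partial>P) = (\<Sum>k. \<integral>\<^sup>+h. ennreal \<bar>d k h\<bar> \<partial>P)"
    by (rule nn_integral_suminf) (use d_int in simp)
  also have "\<dots> \<le> (\<Sum>k. ennreal (C * (1 / 2) ^ k))"
  proof (rule suminf_le)
    fix k
    have "(\<integral>\<^sup>+h. ennreal \<bar>d k h\<bar> \<partial>P) = ennreal (\<integral>h. \<bar>d k h\<bar> \<partial>P)"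
      by (rule nn_integral_eq_integral) (use d_int in auto)
    then show "(\<integral>\<^sup>+h. ennreal \<bar>d k h\<bar> \<partial>P) \<le> ennreal (C * (1 / 2) ^ k)"
      using d_bound[of k] by (simp add: ennreal_leI)
  qed auto
  also have "\<dots> < top"
  proof -
    have "summable (\<lambda>k. C * (1 / 2) ^ k)" by (intro summable_mult summable_geometric) simp
    then have "(\<Sum>k. ennreal (C * (1 / 2) ^ k)) \<noteq> top" using C by (intro ennreal_suminf_neq_top) auto
    then show ?thesis by (simp add: less_top)
  qed
  finally have fin: "(\<integral>\<^sup>+h. (\<Sum>k. ennreal \<bar>d k h\<bar>) \<partial>P) \<noteq> \<infinity>" by simp
  have "AE h in P. (\<Sum>k. ennreal \<bar>d k h\<bar>) \<noteq> \<infinity>"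
    by (rule nn_integral_PInf_AE[OF _ fin]) (use d_int in measurable)
  then show ?thesis
  proof eventually_elim
    case (elim h)
    have "summable (\<lambda>k. \<bar>d k h\<bar>)"
      by (rule summable_suminf_not_top) (use elim in simp_all)
    then have "summable (\<lambda>k. d k h)" by (rule summable_rabs_cancel)
    then have "convergent (\<lambda>m. \<Sum>k<m. d k h)" by (simp add: summable_iff_convergent)
    moreover have "(\<Sum>k<m. d k h) = freq n G (4 ^ m) h - freq n G (4 ^ 0) h" for m
      unfolding d_def by (rule sum_lessThan_telescope)
    ultimately have "convergent (\<lambda>m. freq n G (4 ^ m) h - freq n G (4 ^ 0) h)" by simp
    then show ?case using convergent_diff_const_right_iff by blast
  qed
qed

end

section \<open>Ergodic laws are sampling laws\<close>

lemma S_infinity_act_surj: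
  assumes pi: "\<pi> \<in> S_infinity" and h: "h \<in> InHyN"
  obtains g where "g \<in> InHyN" "S_infinity_act \<pi> g = h"
proof -
  obtain m where m: "1 \<le> m" "\<pi> permutes {1..m}"
    and act: "\<And>h n N. h \<in> InHyN \<Longrightarrow> 1 \<le> n \<Longrightarrow> n \<le> N \<Longrightarrow> m \<le> N \<Longrightarrow> S_infinity_act \<pi> h n = pull n (inv \<pi>) (h N)"
    using S_infinity_act_eq_pull[OF pi] by blast
  have pi': "inv \<pi> \<in> S_infinity" by (rule permutes_imp_S_infinity[OF permutes_inv[OF m(2)]])
  obtain m' where m': "1 \<le> m'" "inv \<pi> permutes {1..m'}"
    and act': "\<And>h n N. h \<in> InHyN \<Longrightarrow> 1 \<le> n \<Longrightarrow> n \<le> N \<Longrightarrow> m' \<le> N \<Longrightarrow> S_infinity_act (inv \<pi>) h n = pull n (inv (inv \<pi>)) (h N)"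
    using S_infinity_act_eq_pull[OF pi'] by blast
  let ?g = "S_infinity_act (inv \<pi>) h"
  have g: "?g \<in> InHyN" by (rule S_infinity_act_InHyN[OF pi' h])
  have "S_infinity_act \<pi> ?g = h"
  proof (rule InHyN_eqI[OF S_infinity_act_InHyN[OF pi g] h])
    fix n :: nat assume n: "1 \<le> n"
    let ?N = "max n (max m m')"
    have N: "1 \<le> ?N" "n \<le> ?N" "m \<le> ?N" "m' \<le> ?N" using n by auto
    have perm: "inv \<pi> permutes {1..?N}" by (rule permutes_subset[OF permutes_inv[OF m(2)]]) auto
    have "inv \<pi> ` {1..n} \<subseteq> inv \<pi> ` {1..?N}" by (intro image_mono) simp
    then have sub: "inv \<pi> ` {1..n} \<subseteq> {1..?N}" unfolding permutes_image[OF perm] .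
    have "S_infinity_act \<pi> ?g n = pull n (inv \<pi>) (pull ?N \<pi> (h ?N))"
      unfolding act[OF g n N(2,3)] act'[OF h N(1) order_refl N(4)] permutes_inv_inv[OF m(2)] by (rule refl)
    also have "\<dots> = pull n (\<pi> \<circ> inv \<pi>) (h ?N)" by (rule pull_pull[OF sub])
    also have "\<pi> \<circ> inv \<pi> = id" by (rule permutes_inv_o(1)[OF m(2)])
    finally show "S_infinity_act \<pi> ?g n = h n" unfolding InHyN_restrict[OF h n N(2), symmetric] .
  qed
  then show thesis using that g by blast
qed

lemma pull_freq_S_infinity_act:
  assumes pi: "\<pi> \<in> S_infinity"
  obtains m where "\<And>h N. h \<in> InHyN \<Longrightarrow> m \<le> N \<Longrightarrow> pull_freq n G N (S_infinity_act \<pi> h N) = pull_freq n G N (h N)"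
proof -
  obtain m where m: "1 \<le> m" "\<pi> permutes {1..m}"
    and act: "\<And>h n N. h \<in> InHyN \<Longrightarrow> 1 \<le> n \<Longrightarrow> n \<le> N \<Longrightarrow> m \<le> N \<Longrightarrow> S_infinity_act \<pi> h n = pull n (inv \<pi>) (h N)"
    using S_infinity_act_eq_pull[OF pi] by blast
  have "pull_freq n G N (S_infinity_act \<pi> h N) = pull_freq n G N (h N)" if h: "h \<in> InHyN" and N: "m \<le> N" for h N
  proof -
    have N1: "1 \<le> N" using m(1) N by simp
    have "inv \<pi> permutes {1..N}" by (rule permutes_subset[OF permutes_inv[OF m(2)]]) (use N in auto)
    then show ?thesis unfolding act[OF h N1 order_refl N] by (rule pull_freq_permute)
  qed
  then show thesis by (rule that)
qed

locale erg_law = exch_law +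
  assumes erg: "P \<in> erg_ExInHy"
begin

text \<open>A frequency at level \<open>N\<close> is unchanged by permutations of \<open>[N]\<close>, so the limit \<open>g\<close> is invariant under
all of \<open>S_infinity\<close> and by ergodicity its distribution function takes only the values 0 and 1. If \<open>g\<close> were
below its mean with positive probability, it would be bounded almost surely by a constant below its mean. So \<open>g\<close>
is never below its mean and hence equal to it.\<close>

lemma freq_limit_constant:
  assumes n: "1 \<le> n"
  shows "AE h in P. (\<lambda>k. freq n G (4 ^ k) h) \<longlonglongrightarrow> measure P (cyl n G)"
proof -
  let ?F = "\<lambda>k. freq n G (4 ^ k)" and ?p = "measure P (cyl n G)"
  define g where "g h = lim (\<lambda>k. ?F k h)" for h
  have one: "1 \<le> (4::nat) ^ k" for k by simp
  have lim: "AE h in P. (\<lambda>k. ?F k h) \<longlonglongrightarrow> g h"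
    using AE_freq_convergent[OF n, of G] unfolding g_def by eventually_elim (simp add: convergent_LIMSEQ_iff)
  have g_meas: "g \<in> borel_measurable P"
    unfolding g_def by (rule borel_measurable_lim_metric) (rule measurable_freq[OF one])
  have bdd: "AE h in P. norm (?F k h) \<le> 1" for k
    by (rule AE_I2) (simp add: pull_freq_bounds)
  have g_int: "integrable P g"
    by (rule integrable_dominated_convergence[OF g_meas measurable_freq[OF one] _ lim bdd]) simp
  have int_lim: "(\<lambda>k. \<integral>h. ?F k h \<partial>P) \<longlonglongrightarrow> (\<integral>h. g h \<partial>P)"
    by (rule integral_dominated_convergence[OF g_meas measurable_freq[OF one] _ lim bdd]) simp
  have zero: "(\<lambda>k. real n ^ 2 / real (4 ^ k)) \<longlonglongrightarrow> 0" by real_asymp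
  have "(\<lambda>k. \<integral>h. ?F k h \<partial>P) \<longlonglongrightarrow> ?p"
  proof (rule Lim_transform2[OF tendsto_const])
    show "(\<lambda>k. ?p - (\<integral>h. ?F k h \<partial>P)) \<longlonglongrightarrow> 0"
    proof (rule Lim_null_comparison[OF _ zero], rule always_eventually, rule allI)
      show "norm (?p - (\<integral>h. ?F k h \<partial>P)) \<le> real n ^ 2 / real (4 ^ k)" for k
        using mean_freq[OF n one[of k], of G] by (simp add: abs_minus_commute)
    qed
  qed
  then have mean: "(\<integral>h. g h \<partial>P) = ?p" using int_lim LIMSEQ_unique by blast
  have zero_one: "measure P {h \<in> InHyN. g h \<le> a} \<in> {0, 1}" for a
  proof -
    let ?E = "{h \<in> InHyN. g h \<le> a}"
    have "{h \<in> space P. g h \<le> a} \<in> sets P" using g_meas by measurable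
    then have E: "?E \<in> sets (borel_of InHyN_topology)" unfolding space_P sets_P .
    have "S_infinity_act \<pi> ` ?E = ?E" if pi: "\<pi> \<in> S_infinity" for \<pi>
    proof -
      obtain m where m: "\<And>h N. h \<in> InHyN \<Longrightarrow> m \<le> N \<Longrightarrow> pull_freq n G N (S_infinity_act \<pi> h N) = pull_freq n G N (h N)"
        using pull_freq_S_infinity_act[OF pi] by blast
      have g_inv: "g (S_infinity_act \<pi> h) = g h" if h: "h \<in> InHyN" for h
      proof -
        have "\<forall>\<^sub>F k in sequentially. ?F k (S_infinity_act \<pi> h) = ?F k h"
        proof (rule eventually_sequentiallyI[of m])
          fix k assume "m \<le> k"
          also have "k \<le> 2 ^ k" by (rule less_imp_le[OF less_exp])
          also have "(2::nat) ^ k \<le> 4 ^ k" by (rule power_mono) simp_all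
          finally show "?F k (S_infinity_act \<pi> h) = ?F k h" by (rule m[OF h])
        qed
        then have "(\<lambda>k. ?F k (S_infinity_act \<pi> h)) \<longlonglongrightarrow> L \<longleftrightarrow> (\<lambda>k. ?F k h) \<longlonglongrightarrow> L" for L
          by (rule tendsto_cong)
        then show ?thesis unfolding g_def lim_def by simp
      qed
      show ?thesis
      proof
        show "S_infinity_act \<pi> ` ?E \<subseteq> ?E" using g_inv S_infinity_act_InHyN[OF pi] by auto
        show "?E \<subseteq> S_infinity_act \<pi> ` ?E"
        proof
          fix h assume h: "h \<in> ?E"
          then obtain h' where h': "h' \<in> InHyN" "S_infinity_act \<pi> h' = h"
            using S_infinity_act_surj[OF pi] by blast
          then have "h' \<in> ?E" using g_inv[OF h'(1)] h by simp
          then show "h \<in> S_infinity_act \<pi> ` ?E" using h'(2) by blast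
        qed
      qed
    qed
    then show ?thesis using erg E unfolding erg_ExInHy_def by blast
  qed
  have "AE h in P. \<not> g h \<le> ?p - inverse (real (Suc m))" for m
  proof (rule ccontr)
    let ?a = "?p - inverse (real (Suc m))"
    have s: "{h \<in> InHyN. g h \<le> ?a} \<in> sets P"
    proof -
      have "{h \<in> space P. g h \<le> ?a} \<in> sets P" using g_meas by measurable
      then show ?thesis unfolding space_P .
    qed
    assume "\<not> ?thesis"
    then have "measure P {h \<in> InHyN. g h \<le> ?a} \<noteq> 0"
      using AE_iff_measurable[OF s, of "\<lambda>h. \<not> g h \<le> ?a"] by (simp add: space_P emeasure_eq_measure)
    then have "measure P {h \<in> InHyN. g h \<le> ?a} = 1" using zero_one[of ?a] by blast
    then have "AE h in P. h \<in> {h \<in> InHyN. g h \<le> ?a}" using prob_eq_1[OF s] by blast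
    then have "AE h in P. g h \<le> ?a" by eventually_elim blast
    then have "(\<integral>h. g h \<partial>P) \<le> ?a" by (rule integral_le_const[OF g_int])
    then have "inverse (real (Suc m)) \<le> 0" unfolding mean by linarith
    moreover have "inverse (real (Suc m)) > 0" by (rule positive_imp_inverse_positive) simp
    ultimately show False by linarith
  qed
  then have "AE h in P. \<forall>m. \<not> g h \<le> ?p - inverse (real (Suc m))" by (simp add: AE_all_countable)
  then have ge: "AE h in P. ?p \<le> g h"
  proof eventually_elim
    case (elim h)
    show ?case
    proof (rule ccontr)
      assume "\<not> ?p \<le> g h"
      then obtain m where "inverse (real (Suc m)) < ?p - g h" using reals_Archimedean[of "?p - g h"] by auto
      then show False using spec[OF elim, of m] by linarith
    qed
  qed
  have "(\<integral>h. g h - ?p \<partial>P) = 0" using g_int mean by (simp add: prob_space)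
  moreover have "integrable P (\<lambda>h. g h - ?p)" using g_int by simp
  moreover have "AE h in P. 0 \<le> g h - ?p" using ge by eventually_elim simp
  ultimately have "AE h in P. g h - ?p = 0" using integral_nonneg_eq_0_iff_AE by blast
  then show ?thesis using lim by eventually_elim simp
qed

text \<open>The second moments of the frequencies tend to \<open>pair_prob n G\<close>, and since the frequencies converge to a
constant, this is the square of the probability of \<open>G\<close>. The quantitative estimates of first and second moments then
bound the variance.\<close>

lemma freq_variance:
  assumes n: "1 \<le> n" and N: "1 \<le> N"
  shows "(\<integral>h. (freq n G N h - measure P (cyl n G))\<^sup>2 \<partial>P) \<le> 5 * real n ^ 2 / real N"
proof -
  let ?p = "measure P (cyl n G)" and ?F = "\<lambda>k. freq n G (4 ^ k)"
  have one: "1 \<le> (4::nat) ^ k" for k by simp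
  have "(\<lambda>k. \<integral>h. ?F k h * ?F k h \<partial>P) \<longlonglongrightarrow> (\<integral>h. ?p * ?p \<partial>P)"
  proof (rule integral_dominated_convergence[where w = "\<lambda>_. 1"])
    show "(\<lambda>h. ?F k h * ?F k h) \<in> borel_measurable P" for k
      by (intro borel_measurable_times measurable_freq one)
    show "AE h in P. (\<lambda>k. ?F k h * ?F k h) \<longlonglongrightarrow> ?p * ?p"
      using freq_limit_constant[OF n, of G] by eventually_elim (intro tendsto_mult)
    show "AE h in P. norm (?F k h * ?F k h) \<le> 1" for k
      by (rule AE_I2) (simp add: abs_mult mult_le_one pull_freq_bounds)
  qed simp_all
  moreover have "(\<lambda>k. \<integral>h. ?F k h * ?F k h \<partial>P) \<longlonglongrightarrow> pair_prob n G"
  proof (rule Lim_transform2[OF tendsto_const])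
    have zero: "(\<lambda>k. 3 * real n ^ 2 / real (4 ^ k)) \<longlonglongrightarrow> 0" by real_asymp
    show "(\<lambda>k. pair_prob n G - (\<integral>h. ?F k h * ?F k h \<partial>P)) \<longlonglongrightarrow> 0"
    proof (rule Lim_null_comparison[OF _ zero], rule always_eventually, rule allI)
      show "norm (pair_prob n G - (\<integral>h. ?F k h * ?F k h \<partial>P)) \<le> 3 * real n ^ 2 / real (4 ^ k)" for k
        using correlation_freq[OF n one[of k] order_refl, of G] by (simp add: abs_minus_commute)
    qed
  qed
  ultimately have "(\<integral>h. ?p * ?p \<partial>P) = pair_prob n G" by (rule LIMSEQ_unique)
  then have pp: "pair_prob n G = ?p * ?p" by (simp add: prob_space)
  have "(\<integral>h. (freq n G N h - ?p)\<^sup>2 \<partial>P) = (\<integral>h. freq n G N h * freq n G N h - 2 * ?p * freq n G N h + ?p * ?p \<partial>P)"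
    by (simp add: power2_eq_square algebra_simps)
  also have "\<dots> = (\<integral>h. freq n G N h * freq n G N h \<partial>P) - 2 * ?p * (\<integral>h. freq n G N h \<partial>P) + ?p * ?p"
    using integrable_freq_mult[OF N N, of n G] integrable_freq[OF N, of n G] by (simp add: prob_space)
  also have "\<dots> = ((\<integral>h. freq n G N h * freq n G N h \<partial>P) - pair_prob n G) + 2 * ?p * (?p - (\<integral>h. freq n G N h \<partial>P))"
    unfolding pp by (simp add: algebra_simps)
  also have "\<dots> \<le> 3 * real n ^ 2 / real N + 2 * (real n ^ 2 / real N)"
  proof (rule add_mono)
    show "(\<integral>h. freq n G N h * freq n G N h \<partial>P) - pair_prob n G \<le> 3 * real n ^ 2 / real N"
      using correlation_freq[OF n N order_refl, of G] by linarith
    have "2 * ?p * (?p - (\<integral>h. freq n G N h \<partial>P)) \<le> 2 * ?p * (real n ^ 2 / real N)"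
      using mean_freq[OF n N, of G] by (intro mult_left_mono) (auto simp: abs_le_iff)
    also have "\<dots> \<le> 2 * 1 * (real n ^ 2 / real N)" by (intro mult_right_mono mult_left_mono) simp_all
    finally show "2 * ?p * (?p - (\<integral>h. freq n G N h \<partial>P)) \<le> 2 * (real n ^ 2 / real N)" by simp
  qed
  also have "\<dots> = 5 * real n ^ 2 / real N" by (simp add: field_simps)
  finally show ?thesis .
qed

text \<open>The variances for the finitely many \<open>G\<close> add up to a small number, so some single path \<open>h\<close> has all its
frequencies close to the probabilities under \<open>P\<close>. The interval system of \<open>h N\<close> has the required property.\<close>

lemma approximating_interval_system:
  assumes n: "1 \<le> n" and \<epsilon>: "0 < \<epsilon>"
  obtains K where "K \<in> InSy" "\<And>G. G \<in> InHy n \<Longrightarrow> \<bar>sample_prob K n G - measure P (cyl n G)\<bar> < \<epsilon>"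
proof -
  define V where "V N h = (\<Sum>G\<in>InHy n. (freq n G N h - measure P (cyl n G))\<^sup>2)" for N h
  define c where "c = real (card (InHy n)) * (5 * n ^ 2)"
  have "(\<lambda>N. c / real N) \<longlonglongrightarrow> 0" by real_asymp
  then have "\<forall>\<^sub>F N in sequentially. c / real N < (\<epsilon> / 2)\<^sup>2" by (rule order_tendstoD(2)) (use \<epsilon> in simp)
  moreover have "(\<lambda>N. real n ^ 2 / real N) \<longlonglongrightarrow> 0" by real_asymp
  then have "\<forall>\<^sub>F N in sequentially. real n ^ 2 / real N < \<epsilon> / 2" by (rule order_tendstoD(2)) (use \<epsilon> in simp)
  ultimately have "\<forall>\<^sub>F N in sequentially. 1 \<le> N \<and> c / real N < (\<epsilon> / 2)\<^sup>2 \<and> real n ^ 2 / real N < \<epsilon> / 2"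
    using eventually_ge_at_top[of 1] by eventually_elim blast
  then obtain N where N: "1 \<le> N" "c / real N < (\<epsilon> / 2)\<^sup>2" "real n ^ 2 / real N < \<epsilon> / 2"
    unfolding eventually_sequentially by blast
  have sq_int: "integrable P (\<lambda>h. (freq n G N h - measure P (cyl n G))\<^sup>2)" for G
  proof (rule integrable_bounded_level[OF N(1), where B = 1])
    fix H
    have "\<bar>pull_freq n G N H - measure P (cyl n G)\<bar> \<le> 1"
      using pull_freq_bounds[of n G N H] measure_nonneg[of P "cyl n G"] prob_le_1[of "cyl n G"] by linarith
    then show "\<bar>(pull_freq n G N H - measure P (cyl n G))\<^sup>2\<bar> \<le> 1" by (simp add: abs_square_le_1)
  qed
  have V_int: "integrable P (V N)" unfolding V_def by (rule Bochner_Integration.integrable_sum[OF sq_int])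
  have "(\<integral>h. V N h \<partial>P) = (\<Sum>G\<in>InHy n. \<integral>h. (freq n G N h - measure P (cyl n G))\<^sup>2 \<partial>P)"
    unfolding V_def by (rule Bochner_Integration.integral_sum[OF sq_int])
  also have "\<dots> \<le> (\<Sum>G\<in>InHy n. 5 * real n ^ 2 / real N)" by (rule sum_mono) (rule freq_variance[OF n N(1)])
  also have "\<dots> = c / N" by (simp add: c_def)
  also have "\<dots> < (\<epsilon> / 2)\<^sup>2" by (rule N(2))
  finally have small: "(\<integral>h. V N h \<partial>P) < (\<epsilon> / 2)\<^sup>2" .
  have "\<exists>h\<in>InHyN. V N h < (\<epsilon> / 2)\<^sup>2"
  proof (rule ccontr)
    assume "\<not> ?thesis"
    then have "AE h in P. (\<epsilon> / 2)\<^sup>2 \<le> V N h" by (intro AE_I2) (auto simp: space_P not_less)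
    then have "(\<epsilon> / 2)\<^sup>2 \<le> (\<integral>h. V N h \<partial>P)" by (rule integral_ge_const[OF V_int])
    then show False using small by simp
  qed
  then obtain h where h: "h \<in> InHyN" "V N h < (\<epsilon> / 2)\<^sup>2" by blast
  obtain K where K: "K \<in> InSy" "\<And>n G. \<bar>sample_prob K n G - pull_freq n G N (h N)\<bar> \<le> real n ^ 2 * real N ^ (n - 1) / real N ^ n"
    using interval_system_sample_prob[OF InHyN_E(1)[OF h(1) N(1)] N(1)] by blast
  have "\<bar>sample_prob K n G - measure P (cyl n G)\<bar> < \<epsilon>" if G: "G \<in> InHy n" for G
  proof -
    have "(freq n G N h - measure P (cyl n G))\<^sup>2 \<le> V N h"
      unfolding V_def by (rule member_le_sum[OF G]) (simp_all add: finite_InHy)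
    then have "(freq n G N h - measure P (cyl n G))\<^sup>2 < (\<epsilon> / 2)\<^sup>2" using h(2) by linarith
    then have 1: "\<bar>freq n G N h - measure P (cyl n G)\<bar> < \<epsilon> / 2"
      using \<epsilon> power2_less_imp_less[of "\<bar>freq n G N h - measure P (cyl n G)\<bar>" "\<epsilon> / 2"] by simp
    have eq: "real n ^ 2 * real N ^ (n - 1) / real N ^ n = real n ^ 2 / real N"
      using power_pred_ratio[OF n N(1), of "n ^ 2"] unfolding of_nat_mult of_nat_power .
    have "\<bar>sample_prob K n G - freq n G N h\<bar> < \<epsilon> / 2" using K(2)[of n G] N(3) unfolding eq by linarith
    then show ?thesis using 1 by linarith
  qed
  then show thesis using that K(1) by blast
qed

text \<open>Approximation becomes equality in the limit along a subsequence that converges in the hit-or-miss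
sense.\<close>

lemma exact_interval_system_level:
  assumes n: "1 \<le> n"
  obtains K where "K \<in> InSy" "\<And>G. G \<in> InHy n \<Longrightarrow> sample_prob K n G = measure P (cyl n G)"
proof -
  have "\<exists>K. K \<in> InSy \<and> (\<forall>G\<in>InHy n. \<bar>sample_prob K n G - measure P (cyl n G)\<bar> < inverse (real (Suc k)))" for k
  proof -
    have "0 < inverse (real (Suc k))" by (rule positive_imp_inverse_positive) simp
    then obtain K where "K \<in> InSy"
      "\<And>G. G \<in> InHy n \<Longrightarrow> \<bar>sample_prob K n G - measure P (cyl n G)\<bar> < inverse (real (Suc k))"
      using approximating_interval_system[OF n] by blast
    then have "K \<in> InSy \<and> (\<forall>G\<in>InHy n. \<bar>sample_prob K n G - measure P (cyl n G)\<bar> < inverse (real (Suc k)))" by blast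
    then show ?thesis by (rule exI)
  qed
  then have "\<exists>Ks. \<forall>k. Ks k \<in> InSy \<and> (\<forall>G\<in>InHy n. \<bar>sample_prob (Ks k) n G - measure P (cyl n G)\<bar> < inverse (real (Suc k)))"
    by (intro choice allI)
  then obtain Ks where Ks: "\<And>k. Ks k \<in> InSy"
    "\<And>k G. G \<in> InHy n \<Longrightarrow> \<bar>sample_prob (Ks k) n G - measure P (cyl n G)\<bar> < inverse (real (Suc k))" by blast
  obtain r K where r: "strict_mono r" "K \<in> InSy" "fell_conv (Ks \<circ> r) K" by (rule InSy_fell_compact[OF Ks(1)])
  have "sample_prob K n G = measure P (cyl n G)" if G: "G \<in> InHy n" for G
  proof -
    have "(\<lambda>k. sample_prob (Ks k) n G) \<longlonglongrightarrow> measure P (cyl n G)"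
    proof (rule Lim_transform2[OF tendsto_const])
      show "(\<lambda>k. measure P (cyl n G) - sample_prob (Ks k) n G) \<longlonglongrightarrow> 0"
      proof (rule Lim_null_comparison[OF _ LIMSEQ_inverse_real_of_nat], rule always_eventually, rule allI)
        show "norm (measure P (cyl n G) - sample_prob (Ks k) n G) \<le> inverse (real (Suc k))" for k
          using Ks(2)[OF G, of k] by (simp add: abs_minus_commute less_imp_le)
      qed
    qed
    then have "(\<lambda>k. sample_prob ((Ks \<circ> r) k) n G) \<longlonglongrightarrow> measure P (cyl n G)"
      using LIMSEQ_subseq_LIMSEQ[OF _ r(1)] by (fastforce simp: o_def)
    moreover have "(\<lambda>k. sample_prob ((Ks \<circ> r) k) n G) \<longlonglongrightarrow> sample_prob K n G"
      by (rule sample_prob_tendsto[OF _ InSy_D(1)[OF r(2)] r(3)]) (simp add: InSy_D(1) Ks(1))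
    ultimately show ?thesis by (rule LIMSEQ_unique[symmetric])
  qed
  then show thesis using that r(2) by blast
qed

text \<open>The system found for level \<open>k + 1\<close> also matches \<open>P\<close> at all lower levels, by consistency. A limit of these
systems therefore matches \<open>P\<close> at every level.\<close>

lemma erg_law_eq_Law_ih: "\<exists>K\<in>InSy. P = Law_ih K"
proof -
  have "\<exists>K. K \<in> InSy \<and> (\<forall>G\<in>InHy (Suc k). sample_prob K (Suc k) G = measure P (cyl (Suc k) G))" for k
  proof -
    have "1 \<le> Suc k" by simp
    from exact_interval_system_level[OF this] obtain K where "K \<in> InSy"
      "\<And>G. G \<in> InHy (Suc k) \<Longrightarrow> sample_prob K (Suc k) G = measure P (cyl (Suc k) G)" by blast
    then have "K \<in> InSy \<and> (\<forall>G\<in>InHy (Suc k). sample_prob K (Suc k) G = measure P (cyl (Suc k) G))" by blast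
    then show ?thesis by (rule exI)
  qed
  then have "\<exists>Ks. \<forall>k. Ks k \<in> InSy \<and> (\<forall>G\<in>InHy (Suc k). sample_prob (Ks k) (Suc k) G = measure P (cyl (Suc k) G))"
    by (intro choice allI)
  then obtain Ks where Ks: "\<And>k. Ks k \<in> InSy"
    "\<And>k G. G \<in> InHy (Suc k) \<Longrightarrow> sample_prob (Ks k) (Suc k) G = measure P (cyl (Suc k) G)" by blast
  obtain r K where r: "strict_mono r" "K \<in> InSy" "fell_conv (Ks \<circ> r) K" by (rule InSy_fell_compact[OF Ks(1)])
  note cK = InSy_D(1)[OF r(2)]
  have below: "sample_prob (Ks k) m G = measure P (cyl m G)" if m: "1 \<le> m" "m \<le> Suc k" for m k G
  proof -
    note c = InSy_D(1)[OF Ks(1)[of k]]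
    have lev: "cyl m G = {h \<in> InHyN. pull m id (h (Suc k)) = G}"
      using InHyN_restrict[OF _ m] unfolding cyl_def by auto
    have "sample_prob (Ks k) m G = measure (Law_ih (Ks k)) (cyl m G)"
      by (rule measure_Law_ih_cyl[OF c m(1), symmetric])
    also have "\<dots> = (\<Sum>G'\<in>{G' \<in> InHy (Suc k). pull m id G' = G}. measure (Law_ih (Ks k)) (cyl (Suc k) G'))"
      unfolding lev by (rule measure_level_sum[OF prob_space_Law_ih[OF c] sets_Law_ih]) simp
    also have "\<dots> = (\<Sum>G'\<in>{G' \<in> InHy (Suc k). pull m id G' = G}. measure P (cyl (Suc k) G'))"
      by (rule sum.cong[OF refl]) (simp add: measure_Law_ih_cyl[OF c] Ks(2))
    also have "\<dots> = measure P (cyl m G)"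
      unfolding lev by (rule measure_level_sum[OF prob_space_axioms sets_P, symmetric]) simp
    finally show ?thesis .
  qed
  have "P = Law_ih K"
  proof (rule law_eqI[OF prob_space_axioms prob_space_Law_ih[OF cK] sets_P sets_Law_ih])
    fix n G assume n: "1 \<le> (n :: nat)"
    have "(\<lambda>k. sample_prob ((Ks \<circ> r) k) n G) \<longlonglongrightarrow> sample_prob K n G"
      by (rule sample_prob_tendsto[OF _ cK r(3)]) (simp add: InSy_D(1) Ks(1))
    moreover have "(\<lambda>k. sample_prob ((Ks \<circ> r) k) n G) \<longlonglongrightarrow> measure P (cyl n G)"
    proof (rule tendsto_eventually, rule eventually_sequentiallyI[of n])
      fix k assume "n \<le> k"
      then have "n \<le> Suc (r k)" using seq_suble[OF r(1), of k] by simp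
      then show "sample_prob ((Ks \<circ> r) k) n G = measure P (cyl n G)" unfolding o_apply by (rule below[OF n])
    qed
    ultimately show "measure P (cyl n G) = measure (Law_ih K) (cyl n G)"
      unfolding measure_Law_ih_cyl[OF cK n] by (rule LIMSEQ_unique[symmetric])
  qed
  then show ?thesis using r(2) by blast
qed

end

lemma erg_ExInHy_eq_Law_ih:
  assumes "P \<in> erg_ExInHy"
  shows "\<exists>K\<in>InSy. P = Law_ih K"
proof -
  have "P \<in> ExInHy" using assms unfolding erg_ExInHy_def by blast
  then have "erg_law P" using assms by unfold_locales
  then show ?thesis by (rule erg_law.erg_law_eq_Law_ih)
qed

lemma Law_ih_image: "Law_ih ` InSy = erg_ExInHy"
proof
  show "Law_ih ` InSy \<subseteq> erg_ExInHy" using Law_ih_in_erg InSy_D(1) by blast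
  show "erg_ExInHy \<subseteq> Law_ih ` InSy" using erg_ExInHy_eq_Law_ih by blast
qed

section \<open>Continuity of the sampling law\<close>

text \<open>It is enough to look at preimages of the generators of the weak topology, and to test their openness with
sequences because \<open>InSy\<close> is a metric space.\<close>

lemma continuous_Law_ih:
  "continuous_map InSy_topology (subtopology (weak_topology InHyN_topology) erg_ExInHy) Law_ih"
proof -
  interpret M: Metric_space InSy hausdorff_l1 by (rule Metric_space_InSy)
  have top: "topspace InSy_topology = InSy" unfolding InSy_topology_def by (rule M.topspace_mtopology)
  have in_borel: "Law_ih K \<in> borel_prob_measures InHyN_topology" if "K \<in> InSy" for K
    unfolding borel_prob_measures_def using prob_space_Law_ih[OF InSy_D(1)[OF that]] sets_Law_ih by blast
  have "continuous_map InSy_topology (weak_topology InHyN_topology) Law_ih"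
    unfolding weak_topology_def
  proof (rule continuous_on_generated_topo)
    fix U :: "(nat \<Rightarrow> nat set set) measure set"
    assume "U \<in> {{P \<in> borel_prob_measures InHyN_topology. integral\<^sup>L P f \<in> V} | f V.
        continuous_map InHyN_topology euclideanreal f \<and> bounded (f ` topspace InHyN_topology) \<and> open V}"
    then obtain f V where U: "U = {P \<in> borel_prob_measures InHyN_topology. integral\<^sup>L P f \<in> V}"
      and f: "continuous_map InHyN_topology euclideanreal f" "bounded (f ` InHyN)" and V: "open V"
      unfolding topspace_InHyN by blast
    have pre: "Law_ih -` U \<inter> topspace InSy_topology = {K \<in> InSy. integral\<^sup>L (Law_ih K) f \<in> V}"
      unfolding top U using in_borel by blast
    have "\<exists>r>0. M.mball K r \<subseteq> {K \<in> InSy. integral\<^sup>L (Law_ih K) f \<in> V}"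
      if K: "K \<in> InSy" "integral\<^sup>L (Law_ih K) f \<in> V" for K
    proof (rule ccontr)
      assume neg: "\<not> ?thesis"
      have "\<exists>K'. K' \<in> InSy \<and> hausdorff_l1 K' K < inverse (real (Suc k)) \<and> integral\<^sup>L (Law_ih K') f \<notin> V" for k
      proof -
        have "0 < inverse (real (Suc k))" by (rule positive_imp_inverse_positive) simp
        then obtain K' where "K' \<in> M.mball K (inverse (real (Suc k)))" "\<not> (K' \<in> InSy \<and> integral\<^sup>L (Law_ih K') f \<in> V)"
          using neg by blast
        then show ?thesis by (intro exI[of _ K']) (auto simp: M.commute)
      qed
      then have "\<exists>Ks. \<forall>k. Ks k \<in> InSy \<and> hausdorff_l1 (Ks k) K < inverse (real (Suc k)) \<and> integral\<^sup>L (Law_ih (Ks k)) f \<notin> V"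
        by (intro choice allI)
      then obtain Ks where Ks: "\<And>k. Ks k \<in> InSy" "\<And>k. hausdorff_l1 (Ks k) K < inverse (real (Suc k))"
        "\<And>k. integral\<^sup>L (Law_ih (Ks k)) f \<notin> V" by blast
      have "(\<lambda>k. hausdorff_l1 (Ks k) K) \<longlonglongrightarrow> 0"
      proof (rule Lim_null_comparison[OF _ LIMSEQ_inverse_real_of_nat], rule always_eventually, rule allI)
        show "norm (hausdorff_l1 (Ks k) K) \<le> inverse (real (Suc k))" for k
          using Ks(2)[of k] M.nonneg[of "Ks k" K] by simp
      qed
      then have "fell_conv Ks K" by (rule hausdorff_imp_fell_conv[OF Ks(1) K(1)])
      then have "(\<lambda>k. integral\<^sup>L (Law_ih (Ks k)) f) \<longlonglongrightarrow> integral\<^sup>L (Law_ih K) f"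
        by (rule integral_Law_ih_tendsto[OF InSy_D(1)[OF Ks(1)] InSy_D(1)[OF K(1)] _ f])
      then have "\<forall>\<^sub>F k in sequentially. integral\<^sup>L (Law_ih (Ks k)) f \<in> V"
        by (rule topological_tendstoD[OF _ V K(2)])
      then show False using Ks(3) by simp
    qed
    then show "openin InSy_topology (Law_ih -` U \<inter> topspace InSy_topology)"
      unfolding pre unfolding InSy_topology_def M.openin_mtopology by blast
  next
    have "continuous_map InHyN_topology euclideanreal (\<lambda>_. 0)" "bounded ((\<lambda>_. 0::real) ` topspace InHyN_topology)"
      by (simp_all add: image_constant_conv)
    then have "borel_prob_measures InHyN_topology \<subseteq> \<Union> {{P \<in> borel_prob_measures InHyN_topology. integral\<^sup>L P f \<in> V} | f V.
        continuous_map InHyN_topology euclideanreal f \<and> bounded (f ` topspace InHyN_topology) \<and> open V}"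
      using open_UNIV by blast
    then show "Law_ih ` topspace InSy_topology \<subseteq> \<Union> {{P \<in> borel_prob_measures InHyN_topology. integral\<^sup>L P f \<in> V} | f V.
        continuous_map InHyN_topology euclideanreal f \<and> bounded (f ` topspace InHyN_topology) \<and> open V}"
      unfolding top using in_borel by blast
  qed
  then show ?thesis
    unfolding continuous_map_in_subtopology top Law_ih_image by (intro conjI) (auto simp: top Law_ih_image[symmetric])
qed

theorem corollary2p6:
  shows "(\<forall>K\<in>InSy. \<forall>(M :: 'a measure) U. iid_uniform M U \<longrightarrow>
            ergodic_exch_int_hypergraph M (\<lambda>n \<omega>. sample_hy K n (\<lambda>j. U j \<omega>)) \<and>
            hy_law M (\<lambda>n \<omega>. sample_hy K n (\<lambda>j. U j \<omega>)) = Law_ih K) \<and>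
         (\<forall>(N :: 'b measure) H. ergodic_exch_int_hypergraph N H \<longrightarrow>
            (\<exists>K\<in>InSy. hy_law N H = Law_ih K)) \<and>
         Law_ih ` InSy = erg_ExInHy \<and>
         continuous_map InSy_topology (subtopology (weak_topology InHyN_topology) erg_ExInHy) Law_ih"
proof (intro conjI ballI allI impI)
  fix K and M :: "'a measure" and U
  assume K: "K \<in> InSy" and iid: "iid_uniform M U"
  note c = InSy_D(1)[OF K]
  show law: "hy_law M (\<lambda>n \<omega>. sample_hy K n (\<lambda>j. U j \<omega>)) = Law_ih K"
    by (rule hy_law_sample_eq_Law_ih[OF c iid])
  show "ergodic_exch_int_hypergraph M (\<lambda>n \<omega>. sample_hy K n (\<lambda>j. U j \<omega>))"
    unfolding ergodic_exch_int_hypergraph_def law using exch_sample[OF c iid] Law_ih_in_erg[OF c] by (rule conjI)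
next
  fix N :: "'b measure" and H
  assume "ergodic_exch_int_hypergraph N H"
  then have "hy_law N H \<in> erg_ExInHy" unfolding ergodic_exch_int_hypergraph_def by (rule conjunct2)
  then show "\<exists>K\<in>InSy. hy_law N H = Law_ih K" by (rule erg_ExInHy_eq_Law_ih)
next
  show "Law_ih ` InSy = erg_ExInHy" by (rule Law_ih_image)
  show "continuous_map InSy_topology (subtopology (weak_topology InHyN_topology) erg_ExInHy) Law_ih"
    by (rule continuous_Law_ih)
qed

end
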